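(* Let $\lambda\vdash k$, let $n\ge k+\lambda_1$ (with $n\ge2$), and let $\tau\in S_n$ be a transposition. Let $P_\lambda$ be the polynomial with $P_\lambda(n)=\chi^{(n-k,\lambda)}(\tau)$ for all such $n$, and write $P_\lambda(x)=\sum_{h=0}^{k}(-1)^h b^{(2)}_{\lambda,h}\binom{x-2}{k-h}$, setting $b^{(2)}_{\lambda,h}:=0$ for $h>k$. Then for every $0\le h\le\ell(\lambda)+2$, \[b^{(2)}_{\lambda,h}=b^{+}_{\lambda,h}-b^{-}_{\lambda,h},\] where for $0\le h\le3$ one sets $b^{+}_{\lambda,h}:=f^{\lambda\setminus(h)}$ and $b^{-}_{\lambda,h}:=0$, and for $h\ge4$ one sets $b^{+}_{\lambda,h}:=f^{\lambda\setminus(3,1^{h-3})}$ and $b^{-}_{\lambda,h}:=f^{\lambda\setminus(2,2,1^{h-4})}$.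
   Context: For $\mu\vdash n$, $\chi^\mu$ is the irreducible character of $S_n$ indexed by $\mu$; $(n-k,\lambda)$ is the partition of $n$ with first row $n-k$ followed by the rows of $\lambda$; $\ell(\lambda)$ is the number of parts and $\lambda_1$ the largest part of $\lambda$. A transposition is viewed in $S_n$ for all $n\ge2$ via the standard embeddings, and $\chi^{(n-k,\lambda)}(\tau)$ is, for $n\ge\max\{k+\lambda_1,2\}$, the value at $n$ of a polynomial $P_\lambda$ of degree $k$ (taken as given). For partitions $\lambda,\nu$: if $\nu\subseteq\lambda$ as Young diagrams, $f^{\lambda\setminus\nu}$ is the number of standard Young tableaux of skew shape $\lambda\setminus\nu$ ($f^{\lambda\setminus\lambda}=1$); otherwise $f^{\lambda\setminus\nu}:=0$. Here $(h)$ is the one-row partition of $h$ (with $(0)=\emptyset$), and $(a,b,1^j)$ denotes parts $a,b$ followed by $j$ ones. *)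

theory Defs
  imports
    Complex_Main
    "HOL-Library.FuncSet"
    "HOL-Library.Function_Algebras"
    "HOL-Combinatorics.Permutations"
    "HOL-Computational_Algebra.Polynomial"
begin

section \<open>Partitions, Young diagrams and skew standard tableaux\<close>

definition is_partition :: "nat list \<Rightarrow> nat \<Rightarrow> bool"  (infix "\<turnstile>p" 50) where
  "\<mu> \<turnstile>p n \<longleftrightarrow> sorted_wrt (\<ge>) \<mu> \<and> 0 \<notin> set \<mu> \<and> sum_list \<mu> = n"

definition largest_part :: "nat list \<Rightarrow> nat" where
  "largest_part \<mu> = (if \<mu> = [] then 0 else hd \<mu>)"

text \<open>Cells are pairs (row, column), both counted from 0.\<close>

definition diagram :: "nat list \<Rightarrow> (nat \<times> nat) set" where
  "diagram \<mu> = {(i, j). i < length \<mu> \<and> j < \<mu> ! i}"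

text \<open>Fillings are extensional functions, so that distinct elements are distinct as fillings
  of the skew shape.\<close>

definition skew_SYT :: "nat list \<Rightarrow> nat list \<Rightarrow> (nat \<times> nat \<Rightarrow> nat) set" where
  "skew_SYT \<mu> \<nu> = (let D = diagram \<mu> - diagram \<nu> in
     {T \<in> extensional D. bij_betw T D {1..card D} \<and>
        (\<forall>i j j'. (i, j) \<in> D \<and> (i, j') \<in> D \<and> j < j' \<longrightarrow> T (i, j) < T (i, j')) \<and>
        (\<forall>i i' j. (i, j) \<in> D \<and> (i', j) \<in> D \<and> i < i' \<longrightarrow> T (i, j) < T (i', j))})"

definition num_skew_SYT :: "nat list \<Rightarrow> nat list \<Rightarrow> nat" where
  "num_skew_SYT \<mu> \<nu> = (if diagram \<nu> \<subseteq> diagram \<mu> then card (skew_SYT \<mu> \<nu>) else 0)"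

section \<open>Irreducible characters of the symmetric group\<close>

text \<open>The irreducible complex representation of \<open>S\<^sub>n\<close> indexed by \<open>\<mu>\<close> is the Specht module,
  the span of the polytabloids inside the permutation module on the tabloids of shape \<open>\<mu>\<close>.
  With this convention \<open>(n)\<close> indexes the trivial representation.
  Here \<open>S\<^sub>n\<close> consists of the functions \<open>\<sigma>\<close> with \<open>\<sigma> permutes {1..n}\<close>.\<close>

definition cscale :: "complex \<Rightarrow> ('a \<Rightarrow> complex) \<Rightarrow> 'a \<Rightarrow> complex" where
  "cscale c v = (\<lambda>x. c * v x)"

interpretation cfun: vector_space cscale
  by unfold_locales (auto simp: cscale_def fun_eq_iff algebra_simps)

text \<open>The trace of an endomorphism \<open>f\<close> of a finite-dimensional subspace \<open>V\<close>, computed in an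
  arbitrary basis of \<open>V\<close>.\<close>

definition subspace_trace ::
    "('a \<Rightarrow> complex) set \<Rightarrow> (('a \<Rightarrow> complex) \<Rightarrow> ('a \<Rightarrow> complex)) \<Rightarrow> complex" where
  "subspace_trace V f =
     (let B = (SOME B. cfun.independent B \<and> cfun.span B = V)
      in \<Sum>b\<in>B. cfun.representation B (f b) b)"

definition tableaux :: "nat list \<Rightarrow> (nat \<times> nat \<Rightarrow> nat) set" where
  "tableaux \<mu> = {t. bij_betw t (diagram \<mu>) {1..sum_list \<mu>}}"

text \<open>A tabloid (a tableau up to reordering within rows) is the sequence of the sets of entries
  of its rows; elements of the permutation module are complex functions of tabloids.\<close>

type_synonym tabloid = "nat \<Rightarrow> nat set"

definition tabloid_of :: "nat list \<Rightarrow> (nat \<times> nat \<Rightarrow> nat) \<Rightarrow> tabloid" where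
  "tabloid_of \<mu> t = (\<lambda>i. {t (i, j) | j. (i, j) \<in> diagram \<mu>})"

definition column_group :: "nat list \<Rightarrow> (nat \<times> nat \<Rightarrow> nat) \<Rightarrow> (nat \<Rightarrow> nat) set" where
  "column_group \<mu> t = {\<pi>. \<pi> permutes {1..sum_list \<mu>} \<and>
     (\<forall>(i, j)\<in>diagram \<mu>. \<exists>i'. (i', j) \<in> diagram \<mu> \<and> \<pi> (t (i, j)) = t (i', j))}"

definition polytabloid :: "nat list \<Rightarrow> (nat \<times> nat \<Rightarrow> nat) \<Rightarrow> tabloid \<Rightarrow> complex" where
  "polytabloid \<mu> t = (\<lambda>X. \<Sum>\<pi>\<in>column_group \<mu> t.
     of_int (sign \<pi>) * (if X = tabloid_of \<mu> (\<pi> \<circ> t) then 1 else 0))"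

definition specht_module :: "nat list \<Rightarrow> (tabloid \<Rightarrow> complex) set" where
  "specht_module \<mu> = cfun.span (polytabloid \<mu> ` tableaux \<mu>)"

text \<open>The linear extension of \<open>X \<mapsto> \<sigma> X\<close> on tabloids, hence the inverse.\<close>

definition perm_act :: "(nat \<Rightarrow> nat) \<Rightarrow> (tabloid \<Rightarrow> complex) \<Rightarrow> (tabloid \<Rightarrow> complex)" where
  "perm_act \<sigma> v = (\<lambda>X. v (\<lambda>i. inv \<sigma> ` X i))"

definition sym_char :: "nat list \<Rightarrow> (nat \<Rightarrow> nat) \<Rightarrow> complex" where
  "sym_char \<mu> \<sigma> = subspace_trace (specht_module \<mu>) (perm_act \<sigma>)"

definition is_transposition :: "nat \<Rightarrow> (nat \<Rightarrow> nat) \<Rightarrow> bool" where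
  "is_transposition n \<tau> \<longleftrightarrow>
     (\<exists>a b. a \<in> {1..n} \<and> b \<in> {1..n} \<and> a \<noteq> b \<and> \<tau> = transpose a b)"

section \<open>The signed coefficients\<close>

definition b_plus :: "nat list \<Rightarrow> nat \<Rightarrow> nat" where
  "b_plus \<mu> h = (if h \<le> 3 then num_skew_SYT \<mu> (if h = 0 then [] else [h])
                 else num_skew_SYT \<mu> (3 # replicate (h - 3) 1))"

definition b_minus :: "nat list \<Rightarrow> nat \<Rightarrow> nat" where
  "b_minus \<mu> h = (if h \<le> 3 then 0 else num_skew_SYT \<mu> (2 # 2 # replicate (h - 4) 1))"

end

(*
  The proof avoids the Murnaghan-Nakayama rule and symmetric functions. Restricting a Specht module
  to the stabiliser of the largest entry gives the branching rule, both for dimensions and for the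
  trace of a fixed transposition. For the shapes obtained by putting a row of length n - k on top of
  lambda it reads P_lambda(n + 1) - P_lambda(n) = sum of P_mu(n) over all mu obtained by removing a
  corner of lambda, and the same for the dimensions. As the skew numbers f satisfy the same
  recursion, by induction the binomial expansions of the dimension polynomial Q (with coefficients
  f of lambda minus the column 1^h, in x choose k - h) and of P are correct up to the coefficient
  with h = k. These two constants come out of one polynomial identity: the sum of all transpositions
  acts on the Specht module by the sum of the contents, whence
    x (x - 1) P(x) = Q(x) ((x - k) (x - k - 1) + 2 c - 2 k),  c the content sum of lambda.
  At x = 0 the last factor vanishes only if lambda is a column, so Q(0) = 0 otherwise; for a column
  x = 1 gives Q(1) = 0; and x = 2 expresses P(2), the last coefficient of P up to sign, through Q(2).
  For k > 0, Q(2) is nonzero only for (1), (2), (3,1^(k-3)) and (2,2,1^(k-4)).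

  The standard polytabloids span because any family of vectors with the column antisymmetry and the
  Garnir relations is spanned by its standard members, by induction on the shape. They are
  independent because evaluating at tabloids with the largest entry in a given row isolates the
  polytabloids in which that entry lies in the corner of that row.
*)

theory Submission
  imports Defs
begin


section \<open>Standard fillings of finite sets of cells\<close>

text \<open>For small n the shape with first row n - k is not a diagram, so the values of P and Q at
  0, 1 and 2 are neither characters nor dimensions, and representation theory does not supply the
  missing constants directly. They become accessible because the relation between P and Q holds for
  infinitely many n, hence between polynomials. That relation dictates the three points: the factor
  x (x - 1) removes P at 0 and 1, so Q stands there alone, and at x = 2 every binomial x - 2 choose
  k - h with h < k vanishes. Branching cannot see the constants, since it only controls differences
  in n: the forward difference of x choose j is x choose j - 1, and the recursion of f under removal
  of corners fits exactly the terms with h < k. The trace in the definition of the character refers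
  to an unspecified basis, whereas branching and the class sum are read off from individual matrix
  entries; hence a concrete basis is constructed. Conjugation invariance allows the transposition to
  be that of 1 and 2, which leaves the largest entry alone.\<close>

definition downset :: "(nat \<times> nat) set \<Rightarrow> bool" where
  "downset D \<longleftrightarrow> (\<forall>i j i' j'. (i, j) \<in> D \<longrightarrow> i' \<le> i \<longrightarrow> j' \<le> j \<longrightarrow> (i', j') \<in> D)"

text \<open>The set of cells is arbitrary, so that one notion covers straight shapes, where it
  indexes a basis, and differences of diagrams, where it is counted.\<close>

definition std_fillings :: "(nat \<times> nat) set \<Rightarrow> (nat \<times> nat \<Rightarrow> nat) set" where
  "std_fillings S = {T \<in> extensional S. bij_betw T S {1..card S} \<and>
     (\<forall>i j j'. (i, j) \<in> S \<and> (i, j') \<in> S \<and> j < j' \<longrightarrow> T (i, j) < T (i, j')) \<and>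
     (\<forall>i i' j. (i, j) \<in> S \<and> (i', j) \<in> S \<and> i < i' \<longrightarrow> T (i, j) < T (i', j))}"

text \<open>For a downset these are the removable corners. In any finite set of cells they are the
  possible positions of the largest entry, since a standard filling only compares cells in one row
  or in one column.\<close>

definition max_cells :: "(nat \<times> nat) set \<Rightarrow> (nat \<times> nat) set" where
  "max_cells S = {(i, j) \<in> S. (\<forall>j'>j. (i, j') \<notin> S) \<and> (\<forall>i'>i. (i', j) \<notin> S)}"

lemma downsetD: "downset D \<Longrightarrow> (i, j) \<in> D \<Longrightarrow> i' \<le> i \<Longrightarrow> j' \<le> j \<Longrightarrow> (i', j') \<in> D"
  by (auto simp: downset_def)

lemma max_cells_subset: "max_cells S \<subseteq> S"
  by (auto simp: max_cells_def)

lemma finite_max_cells: "finite S \<Longrightarrow> finite (max_cells S)"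
  using finite_subset max_cells_subset by blast

lemma downset_remove:
  assumes "downset D" and "c \<in> max_cells D"
  shows "downset (D - {c})"
  unfolding downset_def
proof (intro allI impI)
  fix i j i' j' assume A: "(i, j) \<in> D - {c}" "i' \<le> i" "j' \<le> j"
  have "(i, j') \<in> D" using downsetD[OF assms(1), of i j i j'] A by simp
  have "(i', j') \<noteq> c"
  proof
    assume c: "(i', j') = c"
    then have "i' = i" using assms(2) \<open>(i, j') \<in> D\<close> A(2) by (auto simp: max_cells_def le_less)
    then have "j' = j" using assms(2) A c by (auto simp: max_cells_def le_less)
    then show False using \<open>i' = i\<close> A c by auto
  qed
  then show "(i', j') \<in> D - {c}" using downsetD[OF assms(1), of i j i' j'] A by simp
qed

lemma finite_std_fillings: "finite S \<Longrightarrow> finite (std_fillings S)"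
  by (rule finite_subset[OF _ finite_PiE[of S "\<lambda>_. {1..card S}"]])
    (auto simp: std_fillings_def PiE_def Pi_def bij_betw_def)

lemma std_fillings_empty: "std_fillings {} = {\<lambda>x. undefined}"
  by (auto simp: std_fillings_def bij_betw_def)

lemma std_fillings_insert_max:
  assumes "finite S" and c: "c \<in> max_cells S" and T: "T \<in> std_fillings (S - {c})"
  shows "T(c := card S) \<in> std_fillings S"
proof -
  obtain a b where cab: "c = (a, b)" by force
  have cS: "c \<in> S" using c max_cells_subset by blast
  have pos: "card S > 0" using cS assms(1) card_gt_0_iff by blast
  have cd: "card (S - {c}) = card S - 1" using cS by simp
  have bij: "bij_betw T (S - {c}) {1..card S - 1}"
    using T cd by (auto simp: std_fillings_def)
  have lt: "T x < card S" if "x \<in> S - {c}" for x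
  proof -
    have "T x \<in> {1..card S - 1}" using bij that by (meson bij_betwE)
    then show ?thesis using pos by auto
  qed
  have "bij_betw (T(c := card S)) (S - {c}) {1..card S - 1}"
    using bij by (subst bij_betw_cong[where g=T]) auto
  moreover have "bij_betw (T(c := card S)) {c} {card S}" by auto
  ultimately have "bij_betw (T(c := card S)) ((S - {c}) \<union> {c}) ({1..card S - 1} \<union> {card S})"
    by (rule bij_betw_combine) auto
  moreover have "(S - {c}) \<union> {c} = S" "{1..card S - 1} \<union> {card S} = {1..card S}"
    using cS pos by auto
  ultimately have b: "bij_betw (T(c := card S)) S {1..card S}" by simp
  have rw: "\<forall>i j j'. (i, j) \<in> S - {c} \<and> (i, j') \<in> S - {c} \<and> j < j' \<longrightarrow> T (i, j) < T (i, j')"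
    and cl: "\<forall>i i' j. (i, j) \<in> S - {c} \<and> (i', j) \<in> S - {c} \<and> i < i' \<longrightarrow> T (i, j) < T (i', j)"
    and ex: "T \<in> extensional (S - {c})"
    using T unfolding std_fillings_def by blast+
  have mx: "\<And>j. j > b \<Longrightarrow> (a, j) \<notin> S" "\<And>i. i > a \<Longrightarrow> (i, b) \<notin> S"
    using c cab by (auto simp: max_cells_def)
  show ?thesis unfolding std_fillings_def
  proof (intro CollectI conjI allI impI)
    show "T(c := card S) \<in> extensional S" using ex cS by (auto simp: extensional_def)
    show "bij_betw (T(c := card S)) S {1..card S}" by (rule b)
  next
    fix i j j' assume A: "(i, j) \<in> S \<and> (i, j') \<in> S \<and> j < j'"
    then have "(i, j) \<noteq> c" using mx cab by auto
    then show "(T(c := card S)) (i, j) < (T(c := card S)) (i, j')"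
      using A lt[of "(i,j)"] rw by auto
  next
    fix i i' j assume A: "(i, j) \<in> S \<and> (i', j) \<in> S \<and> i < i'"
    then have "(i, j) \<noteq> c" using mx cab by auto
    then show "(T(c := card S)) (i, j) < (T(c := card S)) (i', j)"
      using A lt[of "(i,j)"] cl by auto
  qed
qed

lemma std_fillings_remove_max:
  assumes "finite S" and "S \<noteq> {}" and T: "T \<in> std_fillings S"
  obtains c T' where "c \<in> max_cells S" "T' \<in> std_fillings (S - {c})" "T = T'(c := card S)"
proof -
  have bij: "bij_betw T S {1..card S}"
    and rw: "\<forall>i j j'. (i, j) \<in> S \<and> (i, j') \<in> S \<and> j < j' \<longrightarrow> T (i, j) < T (i, j')"
    and cl: "\<forall>i i' j. (i, j) \<in> S \<and> (i', j) \<in> S \<and> i < i' \<longrightarrow> T (i, j) < T (i', j)"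
    and ex: "T \<in> extensional S"
    using T unfolding std_fillings_def by blast+
  have pos: "card S > 0" using assms card_gt_0_iff by blast
  then have "card S \<in> T ` S" using bij by (auto simp: bij_betw_def)
  then obtain c where c: "c \<in> S" "T c = card S" by auto
  have le: "T x \<le> card S" if "x \<in> S" for x using bij that by (auto simp: bij_betw_def)
  have mx: "c \<in> max_cells S"
  proof -
    obtain a b where cab: "c = (a, b)" by force
    have "\<not> (a, j') \<in> S" if "j' > b" for j'
      using rw le[of "(a,j')"] c cab that by (metis leD)
    moreover have "\<not> (i', b) \<in> S" if "i' > a" for i'
      using cl le[of "(i',b)"] c cab that by (metis leD)
    ultimately show ?thesis using c cab by (auto simp: max_cells_def)
  qed
  have "bij_betw T (S - {c}) ({1..card S} - {T c})"
    using bij c by (auto simp: bij_betw_def inj_on_def)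
  moreover have "{1..card S} - {T c} = {1..card S - 1}" using c by auto
  ultimately have "bij_betw T (S - {c}) {1..card (S - {c})}" using c by simp
  then have "bij_betw (restrict T (S - {c})) (S - {c}) {1..card (S - {c})}"
    by (subst bij_betw_cong[where g=T]) auto
  then have "restrict T (S - {c}) \<in> std_fillings (S - {c})"
    using rw cl unfolding std_fillings_def by auto
  moreover have "T = (restrict T (S - {c}))(c := card S)"
    using c ex by (auto simp: fun_eq_iff extensional_def)
  ultimately show ?thesis using mx that by blast
qed

text \<open>The largest entry lies in a maximal cell, and erasing it is a bijection. The summand is
  arbitrary because the same recursion serves numbers of fillings, diagonal coefficients and linear
  relations among polytabloids.\<close>

lemma sum_std_fillings:
  assumes "finite S" and "S \<noteq> {}"
  shows "(\<Sum>T\<in>std_fillings S. g T) =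
    (\<Sum>c\<in>max_cells S. \<Sum>T\<in>std_fillings (S - {c}). g (T(c := card S)))"
proof -
  let ?A = "SIGMA c:max_cells S. std_fillings (S - {c})"
  let ?h = "\<lambda>(c, T). T(c := card S)"
  have lt: "T x < card S" if "c \<in> S" "T \<in> std_fillings (S - {c})" "x \<in> S - {c}" for c T x
  proof -
    have "bij_betw T (S - {c}) {1..card S - 1}"
      using that by (auto simp: std_fillings_def)
    then have "T x \<in> {1..card S - 1}" using that by (meson bij_betwE)
    then show ?thesis by auto
  qed
  have inj: "inj_on ?h ?A"
  proof (rule inj_onI)
    fix p q assume p: "p \<in> ?A" and q: "q \<in> ?A" and pq: "?h p = ?h q"
    obtain c T c' T' where pc: "p = (c, T)" "q = (c', T')" by (metis surj_pair)
    have A: "c \<in> max_cells S" "T \<in> std_fillings (S - {c})"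
      "c' \<in> max_cells S" "T' \<in> std_fillings (S - {c'})"
      and eq: "T(c := card S) = T'(c' := card S)"
      using p q pq pc by auto
    have S: "c \<in> S" "c' \<in> S" using A max_cells_subset by blast+
    have c: "c = c'"
    proof (rule ccontr)
      assume ne: "c \<noteq> c'"
      have "T' c = card S" using fun_cong[OF eq, of c] ne by auto
      then show False using lt[OF S(2) A(4), of c] S ne by auto
    qed
    have "T x = T' x" for x
    proof (cases "x = c")
      case True
      have "T \<in> extensional (S - {c})" "T' \<in> extensional (S - {c'})"
        using A by (auto simp: std_fillings_def)
      then show ?thesis using True c extensional_arb[of T "S - {c}" c] extensional_arb[of T' "S - {c}" c] by simp
    next
      case False
      then show ?thesis using fun_cong[OF eq, of x] c by auto
    qed
    then show "p = q" using c pc by auto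
  qed
  have im: "?h ` ?A = std_fillings S"
  proof
    show "?h ` ?A \<subseteq> std_fillings S"
    proof (rule image_subsetI)
      fix p assume p: "p \<in> ?A"
      obtain c T where "p = (c, T)" by (metis surj_pair)
      then show "?h p \<in> std_fillings S" using std_fillings_insert_max[OF assms(1), of c T] p by simp
    qed
    show "std_fillings S \<subseteq> ?h ` ?A"
    proof
      fix T assume "T \<in> std_fillings S"
      then obtain c T' where cT: "c \<in> max_cells S" "T' \<in> std_fillings (S - {c})" "T = T'(c := card S)"
        by (rule std_fillings_remove_max[OF assms])
      show "T \<in> ?h ` ?A" by (rule image_eqI[of _ _ "(c, T')"]) (use cT in auto)
    qed
  qed
  have "(\<Sum>T\<in>std_fillings S. g T) = (\<Sum>p\<in>?A. g (?h p))"
    using sum.reindex[OF inj, of g] im by (simp add: o_def)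
  also have "\<dots> = (\<Sum>c\<in>max_cells S. \<Sum>T\<in>std_fillings (S - {c}). g (T(c := card S)))"
    using sum.Sigma[of "max_cells S" "\<lambda>c. std_fillings (S - {c})" "\<lambda>c T. g (T(c := card S))"]
    by (simp add: finite_max_cells finite_std_fillings assms split_beta)
  finally show ?thesis .
qed

lemma card_std_fillings:
  assumes "finite S" and "S \<noteq> {}"
  shows "card (std_fillings S) = (\<Sum>c\<in>max_cells S. card (std_fillings (S - {c})))"
  using sum_std_fillings[OF assms, of "\<lambda>_. 1::nat"] by simp

section \<open>Polytabloids and Garnir relations\<close>

text \<open>Shapes are sets of cells from here on, because removing a corner is awkward for lists of parts;
  \<open>fillings\<close>, \<open>column_stabiliser\<close>, \<open>rows_of\<close> and \<open>polytab\<close> correspond to \<open>tableaux\<close>,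
  \<open>column_group\<close>, \<open>tabloid_of\<close> and \<open>polytabloid\<close>.\<close>

definition fillings :: "(nat \<times> nat) set \<Rightarrow> (nat \<times> nat \<Rightarrow> nat) set" where
  "fillings D = {t. bij_betw t D {1..card D}}"

definition column_entries :: "(nat \<times> nat) set \<Rightarrow> (nat \<times> nat \<Rightarrow> nat) \<Rightarrow> nat \<Rightarrow> nat set" where
  "column_entries D t j = {t (i, j) | i. (i, j) \<in> D}"

definition column_stabiliser :: "(nat \<times> nat) set \<Rightarrow> (nat \<times> nat \<Rightarrow> nat) \<Rightarrow> (nat \<Rightarrow> nat) set" where
  "column_stabiliser D t = {\<pi>. \<pi> permutes {1..card D} \<and> (\<forall>j. \<forall>x\<in>column_entries D t j. \<pi> x \<in> column_entries D t j)}"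

definition rows_of :: "(nat \<times> nat) set \<Rightarrow> (nat \<times> nat \<Rightarrow> nat) \<Rightarrow> tabloid" where
  "rows_of D t = (\<lambda>i. {t (i, j) | j. (i, j) \<in> D})"

definition polytab :: "(nat \<times> nat) set \<Rightarrow> (nat \<times> nat \<Rightarrow> nat) \<Rightarrow> tabloid \<Rightarrow> complex" where
  "polytab D t = (\<lambda>X. \<Sum>\<pi>\<in>column_stabiliser D t. of_int (sign \<pi>) * (if X = rows_of D (\<pi> \<circ> t) then 1 else 0))"

section \<open>Column stabilisers and the action of permutations\<close>

lemma sign_comp_permutes:
  "p permutes S \<Longrightarrow> q permutes S \<Longrightarrow> finite S \<Longrightarrow> sign (p \<circ> q) = sign p * sign q"
  by (meson permutation_permutes sign_compose)

lemma finite_column_stabiliser: "finite (column_stabiliser D t)"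
  by (rule finite_subset[OF _ finite_permutations[of "{1..card D}"]]) (auto simp: column_stabiliser_def)

lemma fillings_comp: "t \<in> fillings D \<Longrightarrow> \<sigma> permutes {1..card D} \<Longrightarrow> \<sigma> \<circ> t \<in> fillings D"
  by (auto simp: fillings_def intro: bij_betw_trans permutes_imp_bij)

lemma col_comp: "column_entries D (\<sigma> \<circ> t) j = \<sigma> ` column_entries D t j"
  by (auto simp: column_entries_def)

lemma rows_of_comp: "rows_of D (\<sigma> \<circ> t) i = \<sigma> ` rows_of D t i"
  by (auto simp: rows_of_def)

lemma col_subset: "t \<in> fillings D \<Longrightarrow> column_entries D t j \<subseteq> {1..card D}"
  by (auto simp: fillings_def column_entries_def bij_betw_def)

lemma finite_col: "t \<in> fillings D \<Longrightarrow> finite (column_entries D t j)"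
  by (rule finite_subset[OF col_subset]) auto

lemma col_disjoint: "t \<in> fillings D \<Longrightarrow> j \<noteq> j' \<Longrightarrow> column_entries D t j \<inter> column_entries D t j' = {}"
  by (auto simp: fillings_def column_entries_def bij_betw_def inj_on_def)

lemma col_ex:
  assumes "t \<in> fillings D" "x \<in> {1..card D}"
  shows "\<exists>j. x \<in> column_entries D t j"
proof -
  have "x \<in> t ` D" using assms by (simp add: fillings_def bij_betw_def)
  then obtain i j where "(i, j) \<in> D" "x = t (i, j)" by auto
  then show ?thesis by (auto simp: column_entries_def)
qed

lemma sum_fun_apply: "(\<Sum>a\<in>A. f a) x = (\<Sum>a\<in>A. f a x)"
  by (induction A rule: infinite_finite_induct) auto

lemma card_col: "t \<in> fillings D \<Longrightarrow> card (column_entries D t j) = card {i. (i, j) \<in> D}"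
proof -
  assume t: "t \<in> fillings D"
  have "column_entries D t j = (\<lambda>i. t (i, j)) ` {i. (i, j) \<in> D}" by (auto simp: column_entries_def)
  moreover have "inj_on (\<lambda>i. t (i, j)) {i. (i, j) \<in> D}"
    using t by (auto simp: fillings_def bij_betw_def inj_on_def)
  ultimately show ?thesis by (simp add: card_image)
qed

lemma column_stabiliser_image: 
  assumes "t \<in> fillings D" "\<pi> \<in> column_stabiliser D t"
  shows "\<pi> ` column_entries D t j = column_entries D t j"
proof (rule card_subset_eq[OF finite_col[OF assms(1)]])
  show "\<pi> ` column_entries D t j \<subseteq> column_entries D t j" using assms by (auto simp: column_stabiliser_def)
  have "inj \<pi>" using assms permutes_inj by (auto simp: column_stabiliser_def)
  then show "card (\<pi> ` column_entries D t j) = card (column_entries D t j)"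
    by (meson card_image inj_on_subset top_greatest)
qed

lemma column_stabiliser_comp:
  assumes "t \<in> fillings D" "\<rho> \<in> column_stabiliser D t"
  shows "column_stabiliser D (\<rho> \<circ> t) = column_stabiliser D t"
  using column_stabiliser_image[OF assms] by (auto simp: column_stabiliser_def col_comp)

lemma column_stabiliser_permutes_col:
  assumes "t \<in> fillings D" "\<rho> permutes S" "S \<subseteq> column_entries D t j"
  shows "\<rho> \<in> column_stabiliser D t"
proof -
  have "\<rho> permutes {1..card D}"
    using permutes_subset[OF assms(2)] assms(3) col_subset[OF assms(1), of j] by simp
  moreover have "\<rho> x \<in> column_entries D t k" if "x \<in> column_entries D t k" for k x
  proof (cases "x \<in> S")
    case True
    then have "k = j" using assms(3) that col_disjoint[OF assms(1), of j k] by blast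
    moreover have "\<rho> x \<in> S" using True assms(2) by (simp add: permutes_in_image)
    ultimately show ?thesis using assms(3) by blast
  next
    case False
    then show ?thesis using assms(2) that by (simp add: permutes_not_in)
  qed
  ultimately show ?thesis by (auto simp: column_stabiliser_def)
qed

lemma column_stabiliser_conj_mem:
  assumes t: "t \<in> fillings D" and \<sigma>: "\<sigma> permutes {1..card D}" and \<pi>: "\<pi> \<in> column_stabiliser D t"
  shows "\<sigma> \<circ> \<pi> \<circ> inv \<sigma> \<in> column_stabiliser D (\<sigma> \<circ> t)"
proof -
  have "\<sigma> \<circ> \<pi> \<circ> inv \<sigma> permutes {1..card D}"
    using \<sigma> \<pi> by (auto simp: column_stabiliser_def intro!: permutes_compose permutes_inv)
  moreover have "(\<sigma> \<circ> \<pi> \<circ> inv \<sigma>) x \<in> column_entries D (\<sigma> \<circ> t) j" if "x \<in> column_entries D (\<sigma> \<circ> t) j" for j x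
    using that \<pi> permutes_inverses(2)[OF \<sigma>] by (auto simp: col_comp column_stabiliser_def)
  ultimately show ?thesis by (auto simp: column_stabiliser_def)
qed

lemma bij_betw_conj_column_stabiliser:
  assumes t: "t \<in> fillings D" and \<sigma>: "\<sigma> permutes {1..card D}"
  shows "bij_betw (\<lambda>\<pi>. \<sigma> \<circ> \<pi> \<circ> inv \<sigma>) (column_stabiliser D t) (column_stabiliser D (\<sigma> \<circ> t))"
proof (rule bij_betw_byWitness[where f' = "\<lambda>\<pi>. inv \<sigma> \<circ> \<pi> \<circ> \<sigma>"])
  note i = permutes_inverses[OF \<sigma>]
  show "\<forall>\<pi>\<in>column_stabiliser D t. inv \<sigma> \<circ> (\<sigma> \<circ> \<pi> \<circ> inv \<sigma>) \<circ> \<sigma> = \<pi>"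
    using i by (auto simp: fun_eq_iff)
  show "\<forall>\<pi>\<in>column_stabiliser D (\<sigma> \<circ> t). \<sigma> \<circ> (inv \<sigma> \<circ> \<pi> \<circ> \<sigma>) \<circ> inv \<sigma> = \<pi>"
    using i by (auto simp: fun_eq_iff)
  show "(\<lambda>\<pi>. \<sigma> \<circ> \<pi> \<circ> inv \<sigma>) ` column_stabiliser D t \<subseteq> column_stabiliser D (\<sigma> \<circ> t)"
    using column_stabiliser_conj_mem[OF t \<sigma>] by auto
  have "inv \<sigma> \<circ> (\<sigma> \<circ> t) = t" using i by (auto simp: fun_eq_iff)
  moreover have "inv (inv \<sigma>) = \<sigma>" using \<sigma> by (simp add: permutes_inv_inv)
  ultimately show "(\<lambda>\<pi>. inv \<sigma> \<circ> \<pi> \<circ> \<sigma>) ` column_stabiliser D (\<sigma> \<circ> t) \<subseteq> column_stabiliser D t"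
    using column_stabiliser_conj_mem[OF fillings_comp[OF t \<sigma>] permutes_inv[OF \<sigma>]] by auto
qed

lemma sign_conj:
  assumes "\<sigma> permutes S" "\<pi> permutes S" "finite S"
  shows "sign (\<sigma> \<circ> \<pi> \<circ> inv \<sigma>) = sign \<pi>"
  using assms by (simp add: sign_comp_permutes[of _ S] permutes_compose permutes_inv
      sign_inverse permutation_permutes) (metis mult.commute mult.left_commute mult_1_right sign_idempotent permutation_permutes sign_inverse)

text \<open>The column stabiliser of \<open>\<sigma> \<circ> t\<close> is conjugate to that of
  \<open>t\<close>. Conjugating the summation index moves \<open>\<sigma>\<close> to the outside, so
  that the sum runs over a group that does not depend on \<open>\<sigma>\<close>.\<close>

lemma polytab_comp:
  assumes t: "t \<in> fillings D" and \<sigma>: "\<sigma> permutes {1..card D}"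
  shows "polytab D (\<sigma> \<circ> t) X =
    (\<Sum>\<pi>\<in>column_stabiliser D t. of_int (sign \<pi>) * (if X = rows_of D (\<sigma> \<circ> \<pi> \<circ> t) then 1 else 0))"
  unfolding polytab_def
proof (subst sum.reindex_bij_betw[OF bij_betw_conj_column_stabiliser[OF t \<sigma>], symmetric], rule sum.cong[OF refl])
  fix \<pi> assume "\<pi> \<in> column_stabiliser D t"
  then have "sign (\<sigma> \<circ> \<pi> \<circ> inv \<sigma>) = sign \<pi>"
    using sign_conj[OF \<sigma>, of \<pi>] by (simp add: column_stabiliser_def)
  moreover have "\<sigma> \<circ> \<pi> \<circ> inv \<sigma> \<circ> (\<sigma> \<circ> t) = \<sigma> \<circ> \<pi> \<circ> t"
    using permutes_inverses(2)[OF \<sigma>] by (auto simp: fun_eq_iff)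
  ultimately show "of_int (sign (\<sigma> \<circ> \<pi> \<circ> inv \<sigma>)) * (if X = rows_of D (\<sigma> \<circ> \<pi> \<circ> inv \<sigma> \<circ> (\<sigma> \<circ> t)) then 1 else 0)
    = of_int (sign \<pi>) * (if X = rows_of D (\<sigma> \<circ> \<pi> \<circ> t) then 1 else (0::complex))" by simp
qed

lemma perm_act_polytab:
  assumes t: "t \<in> fillings D" and \<sigma>: "\<sigma> permutes {1..card D}"
  shows "perm_act \<sigma> (polytab D t) = polytab D (\<sigma> \<circ> t)"
proof
  fix X
  have eq: "(\<lambda>i. inv \<sigma> ` X i) = rows_of D u \<longleftrightarrow> X = rows_of D (\<sigma> \<circ> u)" for u
  proof
    assume A: "(\<lambda>i. inv \<sigma> ` X i) = rows_of D u"
    show "X = rows_of D (\<sigma> \<circ> u)"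
    proof
      fix i
      have "rows_of D (\<sigma> \<circ> u) i = \<sigma> ` inv \<sigma> ` X i" using fun_cong[OF A, of i] by (simp add: rows_of_comp)
      also have "\<dots> = X i" using permutes_inverses(1)[OF \<sigma>] by (auto simp: image_image)
      finally show "X i = rows_of D (\<sigma> \<circ> u) i" by simp
    qed
  next
    assume A: "X = rows_of D (\<sigma> \<circ> u)"
    show "(\<lambda>i. inv \<sigma> ` X i) = rows_of D u"
      using permutes_inverses(2)[OF \<sigma>] by (auto simp: A rows_of_comp image_image)
  qed
  show "perm_act \<sigma> (polytab D t) X = polytab D (\<sigma> \<circ> t) X"
    unfolding perm_act_def polytab_comp[OF t \<sigma>] by (simp add: polytab_def eq comp_assoc)
qed

text \<open>Fillings are not extensional and take arbitrary values outside \<open>D\<close>; these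
  values must not matter when a filling is restricted to a smaller shape or updated at a
  corner.\<close>

lemma polytab_cong:
  assumes "\<And>c. c \<in> D \<Longrightarrow> t' c = t c"
  shows "polytab D t' = polytab D t"
proof -
  have "column_entries D t' j = column_entries D t j" for j using assms by (auto simp: column_entries_def) metis+
  moreover have "rows_of D (\<pi> \<circ> t') = rows_of D (\<pi> \<circ> t)" for \<pi> using assms by (auto simp: rows_of_def fun_eq_iff) metis+
  ultimately show ?thesis by (simp add: polytab_def column_stabiliser_def)
qed

text \<open>Two features make the induction on the shape work. The relations hold modulo a subspace, so that
  fillings with the largest entry further to the right can be neglected. And they are imposed for
  all pairs of subsets of two columns, not only for those used by straightening algorithms: this
  set of relations is inherited by the shape without the corner.\<close>

definition garnir_mod :: "(nat \<times> nat) set \<Rightarrow> ('a \<Rightarrow> complex) set \<Rightarrow> ((nat \<times> nat \<Rightarrow> nat) \<Rightarrow> 'a \<Rightarrow> complex) \<Rightarrow> bool" where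
  "garnir_mod D U E \<longleftrightarrow>
    (\<forall>t\<in>fillings D. \<forall>t'. (\<forall>c\<in>D. t' c = t c) \<longrightarrow> E t' = E t) \<and>
    (\<forall>t\<in>fillings D. \<forall>\<rho>\<in>column_stabiliser D t. E (\<rho> \<circ> t) - cscale (of_int (sign \<rho>)) (E t) \<in> U) \<and>
    (\<forall>t\<in>fillings D. \<forall>j j' X Y. j \<noteq> j' \<longrightarrow> X \<subseteq> column_entries D t j \<longrightarrow> Y \<subseteq> column_entries D t j' \<longrightarrow>
       max (card (column_entries D t j)) (card (column_entries D t j')) < card X + card Y \<longrightarrow>
       (\<Sum>\<sigma> | \<sigma> permutes X \<union> Y. cscale (of_int (sign \<sigma>)) (E (\<sigma> \<circ> t))) \<in> U)"

text \<open>Right translation by \<open>\<rho>\<close> permutes the column stabiliser and multiplies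
  every sign by that of \<open>\<rho>\<close>.\<close>

lemma polytab_column_stabiliser:
  assumes t: "t \<in> fillings D" and \<rho>: "\<rho> \<in> column_stabiliser D t"
  shows "polytab D (\<rho> \<circ> t) = cscale (of_int (sign \<rho>)) (polytab D t)"
proof
  fix X
  have \<rho>p: "\<rho> permutes {1..card D}" using \<rho> by (simp add: column_stabiliser_def)
  let ?g = "\<lambda>\<pi>. of_int (sign \<pi>) * (if X = rows_of D (\<pi> \<circ> t) then 1 else (0::complex))"
  have b: "bij_betw (\<lambda>\<pi>. \<pi> \<circ> \<rho>) (column_stabiliser D t) (column_stabiliser D t)"
  proof (rule bij_betw_byWitness[where f' = "\<lambda>\<pi>. \<pi> \<circ> inv \<rho>"])
    note i = permutes_inverses[OF \<rho>p]
    show "\<forall>\<pi>\<in>column_stabiliser D t. \<pi> \<circ> \<rho> \<circ> inv \<rho> = \<pi>" "\<forall>\<pi>\<in>column_stabiliser D t. \<pi> \<circ> inv \<rho> \<circ> \<rho> = \<pi>"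
      using i by (auto simp: fun_eq_iff)
    show "(\<lambda>\<pi>. \<pi> \<circ> \<rho>) ` column_stabiliser D t \<subseteq> column_stabiliser D t"
      using \<rho> by (auto simp: column_stabiliser_def intro: permutes_compose)
    have "inv \<rho> x \<in> column_entries D t j" if "x \<in> column_entries D t j" for x j
      using that column_stabiliser_image[OF t \<rho>, of j] i(2) by (metis image_iff)
    then show "(\<lambda>\<pi>. \<pi> \<circ> inv \<rho>) ` column_stabiliser D t \<subseteq> column_stabiliser D t"
      using \<rho>p by (auto simp: column_stabiliser_def intro!: permutes_compose permutes_inv)
  qed
  have "polytab D t X = (\<Sum>\<pi>\<in>column_stabiliser D t. ?g (\<pi> \<circ> \<rho>))"
    unfolding polytab_def by (rule sum.reindex_bij_betw[OF b, symmetric])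
  also have "\<dots> = (\<Sum>\<pi>\<in>column_stabiliser D t. of_int (sign \<rho>) * (of_int (sign \<pi>) * (if X = rows_of D (\<pi> \<circ> (\<rho> \<circ> t)) then 1 else 0)))"
  proof (rule sum.cong[OF refl])
    fix \<pi> assume "\<pi> \<in> column_stabiliser D t"
    then have "sign (\<pi> \<circ> \<rho>) = sign \<pi> * sign \<rho>"
      using sign_comp_permutes[of \<pi> "{1..card D}" \<rho>] \<rho>p by (simp add: column_stabiliser_def)
    then show "?g (\<pi> \<circ> \<rho>) = of_int (sign \<rho>) * (of_int (sign \<pi>) * (if X = rows_of D (\<pi> \<circ> (\<rho> \<circ> t)) then 1 else 0))"
      by (simp add: comp_assoc)
  qed
  also have "\<dots> = of_int (sign \<rho>) * polytab D (\<rho> \<circ> t) X"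
    unfolding polytab_def column_stabiliser_comp[OF t \<rho>] by (simp add: sum_distrib_left)
  finally have "of_int (sign \<rho>) * polytab D t X = of_int (sign \<rho> * sign \<rho>) * polytab D (\<rho> \<circ> t) X"
    by (simp only: of_int_mult mult.assoc)
  then show "polytab D (\<rho> \<circ> t) X = cscale (of_int (sign \<rho>)) (polytab D t) X"
    by (simp add: cscale_def)
qed

text \<open>Composing with the transposition on the right permutes the summands and reverses their
  signs, so the sum equals its own negative.\<close>

lemma signed_sum_zero:
  fixes f :: "_ \<Rightarrow> 'b :: field_char_0"
  assumes S: "finite S" "a \<in> S" "b \<in> S" "a \<noteq> b"
    and f: "\<And>\<sigma>. \<sigma> permutes S \<Longrightarrow> f (\<sigma> \<circ> transpose a b) = f \<sigma>"
  shows "(\<Sum>\<sigma> | \<sigma> permutes S. of_int (sign \<sigma>) * f \<sigma>) = 0"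
proof -
  have tp: "transpose a b permutes S" using S by (simp add: permutes_swap_id)
  have "(\<Sum>\<sigma> | \<sigma> permutes S. of_int (sign \<sigma>) * f \<sigma>)
      = (\<Sum>\<sigma> | \<sigma> permutes S. of_int (sign (\<sigma> \<circ> transpose a b)) * f (\<sigma> \<circ> transpose a b))"
    by (rule sum_permutations_compose_right[OF tp])
  also have "\<dots> = (\<Sum>\<sigma> | \<sigma> permutes S. - (of_int (sign \<sigma>) * f \<sigma>))"
    using f S tp by (intro sum.cong) (auto simp: sign_comp_permutes[of _ S] sign_swap_id)
  finally show ?thesis by (simp add: sum_negf eq_neg_iff_add_eq_0 flip: mult_2)
qed

text \<open>Pigeonhole: in a downset the sets of rows met by two columns are nested, so both sets of
  rows lie in the larger one, which is too small to hold them disjointly.\<close>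

lemma rows_overlap:
  assumes D: "downset D" "finite D"
    and R: "R \<subseteq> {i. (i, j) \<in> D}" "R' \<subseteq> {i. (i, j') \<in> D}"
    and c: "max (card {i. (i, j) \<in> D}) (card {i. (i, j') \<in> D}) < card R + card R'"
  obtains r where "r \<in> R" "r \<in> R'"
proof -
  have fin: "finite {i. (i, j) \<in> D}" for j
    by (rule finite_subset[OF _ finite_imageI[OF D(2), of fst]]) (force)
  have "\<exists>k\<in>{j, j'}. {i. (i, j) \<in> D} \<union> {i. (i, j') \<in> D} = {i. (i, k) \<in> D}"
  proof (cases "j \<le> j'")
    case True
    then have "{i. (i, j) \<in> D} \<union> {i. (i, j') \<in> D} = {i. (i, j) \<in> D}" using downsetD[OF D(1)] by blast
    then show ?thesis by auto
  next
    case False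
    then have "{i. (i, j) \<in> D} \<union> {i. (i, j') \<in> D} = {i. (i, j') \<in> D}" using downsetD[OF D(1)] by fastforce
    then show ?thesis by auto
  qed
  then obtain k where k: "k \<in> {j, j'}" "{i. (i, j) \<in> D} \<union> {i. (i, j') \<in> D} = {i. (i, k) \<in> D}" by blast
  have "card (R \<union> R') \<le> card {i. (i, k) \<in> D}"
    using R k fin by (intro card_mono) auto
  also have "\<dots> < card R + card R'" using c k by auto
  finally have "card (R \<union> R') < card R + card R'" .
  moreover have "finite R" "finite R'" using R fin finite_subset by blast+
  ultimately have "R \<inter> R' \<noteq> {}" using card_Un_disjoint by fastforce
  then show ?thesis using that by blast
qed

text \<open>The cancellation takes place for each column permutation \<open>\<pi>\<close> of
  \<open>t\<close> separately. In \<open>\<pi> \<circ> t\<close> the entries from \<open>X\<close>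
  and from \<open>Y\<close> occupy rows that overlap, so some \<open>a\<close> in \<open>X\<close>
  and \<open>b\<close> in \<open>Y\<close> share a row. Exchanging them does not change the tabloid
  but reverses the sign.\<close>

lemma polytab_garnir:
  assumes D: "downset D" "finite D" and t: "t \<in> fillings D" and jj: "j \<noteq> j'"
    and X: "X \<subseteq> column_entries D t j" and Y: "Y \<subseteq> column_entries D t j'"
    and c: "max (card (column_entries D t j)) (card (column_entries D t j')) < card X + card Y"
  shows "(\<Sum>\<sigma> | \<sigma> permutes X \<union> Y. cscale (of_int (sign \<sigma>)) (polytab D (\<sigma> \<circ> t))) = 0"
proof
  fix Z
  let ?S = "X \<union> Y"
  have S: "?S \<subseteq> {1..card D}" "finite ?S" using X Y col_subset[OF t] finite_col[OF t] by (blast, meson finite_Un finite_subset)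
  have perm: "\<sigma> permutes {1..card D}" if "\<sigma> permutes ?S" for \<sigma> using permutes_subset[OF that S(1)] .
  let ?I = "\<lambda>\<sigma> \<pi>. if Z = rows_of D (\<sigma> \<circ> \<pi> \<circ> t) then 1 else (0::complex)"
  have inner: "(\<Sum>\<sigma> | \<sigma> permutes ?S. of_int (sign \<sigma>) * ?I \<sigma> \<pi>) = 0" if \<pi>: "\<pi> \<in> column_stabiliser D t" for \<pi>
  proof -
    let ?R = "\<lambda>W j. {i. (i, j) \<in> D \<and> \<pi> (t (i, j)) \<in> W}"
    have u: "\<pi> \<circ> t \<in> fillings D" using fillings_comp[OF t] \<pi> by (simp add: column_stabiliser_def)
    have cR: "card (?R W j) = card W" if W: "W \<subseteq> column_entries D t j" for W j
    proof -
      have "(\<lambda>i. (\<pi> \<circ> t) (i, j)) ` ?R W j = W"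
      proof
        show "W \<subseteq> (\<lambda>i. (\<pi> \<circ> t) (i, j)) ` ?R W j"
        proof
          fix x assume x: "x \<in> W"
          then have "x \<in> column_entries D (\<pi> \<circ> t) j" using W column_stabiliser_image[OF t \<pi>, of j] by (auto simp: col_comp)
          then show "x \<in> (\<lambda>i. (\<pi> \<circ> t) (i, j)) ` ?R W j" using x by (auto simp: column_entries_def)
        qed
      qed auto
      moreover have "inj_on (\<lambda>i. (\<pi> \<circ> t) (i, j)) (?R W j)"
      proof (rule inj_onI)
        fix x y assume xy: "x \<in> ?R W j" "y \<in> ?R W j" "(\<pi> \<circ> t) (x, j) = (\<pi> \<circ> t) (y, j)"
        have "inj_on (\<pi> \<circ> t) D" using u by (simp add: fillings_def bij_betw_def)
        then have "(x, j) = (y, j)" using xy by (intro inj_onD[of "\<pi> \<circ> t" D]) auto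
        then show "x = y" by simp
      qed
      ultimately show ?thesis using card_image[of "\<lambda>i. (\<pi> \<circ> t) (i, j)" "?R W j"] by simp
    qed
    obtain r where r: "r \<in> ?R X j" "r \<in> ?R Y j'"
    proof (rule rows_overlap[OF D, of "?R X j" j "?R Y j'" j'])
      show "max (card {i. (i, j) \<in> D}) (card {i. (i, j') \<in> D}) < card (?R X j) + card (?R Y j')"
        using c cR[OF X] cR[OF Y] card_col[OF t] by simp
    qed auto
    define a where "a = \<pi> (t (r, j))"
    define b where "b = \<pi> (t (r, j'))"
    have ab: "a \<in> ?S" "b \<in> ?S" using r by (auto simp: a_def b_def)
    have "a \<in> X" "b \<in> Y" using r by (auto simp: a_def b_def)
    then have "a \<noteq> b" using col_disjoint[OF t jj] X Y by blast
    moreover have "rows_of D (transpose a b \<circ> (\<pi> \<circ> t)) = rows_of D (\<pi> \<circ> t)"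
    proof
      fix i
      show "rows_of D (transpose a b \<circ> (\<pi> \<circ> t)) i = rows_of D (\<pi> \<circ> t) i"
      proof (cases "i = r")
        case True
        then have "a \<in> rows_of D (\<pi> \<circ> t) i" "b \<in> rows_of D (\<pi> \<circ> t) i"
          using r by (auto simp: rows_of_def a_def b_def)
        then show ?thesis by (simp add: rows_of_comp[of D "transpose a b"])
      next
        case False
        have inj: "inj_on (\<pi> \<circ> t) D" using u by (simp add: fillings_def bij_betw_def)
        have "x \<noteq> a \<and> x \<noteq> b" if x: "x \<in> rows_of D (\<pi> \<circ> t) i" for x
        proof -
          obtain l where l: "x = (\<pi> \<circ> t) (i, l)" "(i, l) \<in> D" using x by (auto simp: rows_of_def)
          have "x \<noteq> (\<pi> \<circ> t) (r, m)" if "(r, m) \<in> D" for m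
            using inj_onD[OF inj, of "(i, l)" "(r, m)"] l that False by auto
          then show ?thesis using r by (auto simp: a_def b_def)
        qed
        then have "transpose a b x = x" if "x \<in> rows_of D (\<pi> \<circ> t) i" for x
          using that by (simp add: transpose_apply_other)
        then show ?thesis by (simp add: rows_of_comp[of D "transpose a b"])
      qed
    qed
    then have "rows_of D (\<sigma> \<circ> transpose a b \<circ> \<pi> \<circ> t) = rows_of D (\<sigma> \<circ> \<pi> \<circ> t)" for \<sigma>
      using rows_of_comp[of D \<sigma> "transpose a b \<circ> (\<pi> \<circ> t)"] rows_of_comp[of D \<sigma> "\<pi> \<circ> t"]
      by (auto simp: comp_assoc fun_eq_iff)
    ultimately show ?thesis
      by (intro signed_sum_zero[OF S(2) ab]) auto
  qed
  have "(\<Sum>\<sigma> | \<sigma> permutes ?S. cscale (of_int (sign \<sigma>)) (polytab D (\<sigma> \<circ> t))) Z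
    = (\<Sum>\<sigma> | \<sigma> permutes ?S. \<Sum>\<pi>\<in>column_stabiliser D t. of_int (sign \<pi>) * (of_int (sign \<sigma>) * ?I \<sigma> \<pi>))"
    by (simp add: sum_fun_apply cscale_def polytab_comp[OF t perm] sum_distrib_left mult.left_commute)
  also have "\<dots> = (\<Sum>\<pi>\<in>column_stabiliser D t. of_int (sign \<pi>) * (\<Sum>\<sigma> | \<sigma> permutes ?S. of_int (sign \<sigma>) * ?I \<sigma> \<pi>))"
    by (subst sum.swap) (simp only: sum_distrib_left)
  also have "\<dots> = 0" by (simp add: inner)
  finally show "(\<Sum>\<sigma> | \<sigma> permutes ?S. cscale (of_int (sign \<sigma>)) (polytab D (\<sigma> \<circ> t))) Z = (0 :: _ \<Rightarrow> complex) Z"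
    by simp
qed

lemma garnir_mod_polytab:
  assumes D: "downset D" "finite D"
  shows "garnir_mod D {0} (polytab D)"
  unfolding garnir_mod_def
proof (intro conjI ballI allI impI)
  fix t t' :: "nat \<times> nat \<Rightarrow> nat" assume "\<forall>c\<in>D. t' c = t c"
  then show "polytab D t' = polytab D t" by (intro polytab_cong) blast
next
  fix t \<rho> assume "t \<in> fillings D" "\<rho> \<in> column_stabiliser D t"
  then show "polytab D (\<rho> \<circ> t) - cscale (of_int (sign \<rho>)) (polytab D t) \<in> {0}"
    by (simp only: polytab_column_stabiliser diff_self singleton_iff)
next
  fix t j j' X Y
  assume "t \<in> fillings D" "j \<noteq> j'" "X \<subseteq> column_entries D t j" "Y \<subseteq> column_entries D t j'"
    "max (card (column_entries D t j)) (card (column_entries D t j')) < card X + card Y"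
  then show "(\<Sum>\<sigma> | \<sigma> permutes X \<union> Y. cscale (of_int (sign \<sigma>)) (polytab D (\<sigma> \<circ> t))) \<in> {0}"
    by (simp only: polytab_garnir[OF D] singleton_iff)
qed

section \<open>Standard polytabloids span\<close>

lemma garnir_mod_cong:
  "garnir_mod D U E \<Longrightarrow> t \<in> fillings D \<Longrightarrow> (\<And>c. c \<in> D \<Longrightarrow> t' c = t c) \<Longrightarrow> E t' = E t"
  unfolding garnir_mod_def by blast

lemma garnir_mod_column_stabiliser:
  "garnir_mod D U E \<Longrightarrow> t \<in> fillings D \<Longrightarrow> \<rho> \<in> column_stabiliser D t \<Longrightarrow>
    E (\<rho> \<circ> t) - cscale (of_int (sign \<rho>)) (E t) \<in> U"
  unfolding garnir_mod_def by blast

lemma garnir_mod_garnir: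
  "garnir_mod D U E \<Longrightarrow> t \<in> fillings D \<Longrightarrow> j \<noteq> j' \<Longrightarrow> X \<subseteq> column_entries D t j \<Longrightarrow> Y \<subseteq> column_entries D t j' \<Longrightarrow>
   max (card (column_entries D t j)) (card (column_entries D t j')) < card X + card Y \<Longrightarrow>
   (\<Sum>\<sigma> | \<sigma> permutes X \<union> Y. cscale (of_int (sign \<sigma>)) (E (\<sigma> \<circ> t))) \<in> U"
  unfolding garnir_mod_def by blast

lemma garnir_mod_mono:
  assumes "U \<subseteq> V" and E: "garnir_mod D U E"
  shows "garnir_mod D V E"
  unfolding garnir_mod_def
proof (intro conjI ballI allI impI)
  fix t t' :: "nat \<times> nat \<Rightarrow> nat" assume "t \<in> fillings D" "\<forall>c\<in>D. t' c = t c"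
  then show "E t' = E t" by (intro garnir_mod_cong[OF E]) auto
next
  fix t \<rho> assume "t \<in> fillings D" "\<rho> \<in> column_stabiliser D t"
  then show "E (\<rho> \<circ> t) - cscale (of_int (sign \<rho>)) (E t) \<in> V"
    using garnir_mod_column_stabiliser[OF E] assms(1) by blast
next
  fix t j j' X Y
  assume "t \<in> fillings D" "j \<noteq> j'" "X \<subseteq> column_entries D t j" "Y \<subseteq> column_entries D t j'"
    "max (card (column_entries D t j)) (card (column_entries D t j')) < card X + card Y"
  then show "(\<Sum>\<sigma> | \<sigma> permutes X \<union> Y. cscale (of_int (sign \<sigma>)) (E (\<sigma> \<circ> t))) \<in> V"
    by (rule subsetD[OF assms(1) garnir_mod_garnir[OF E]])
qed

text \<open>In the signed sums the column permutation acts before \<open>\<sigma>\<close>, whereas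
  the antisymmetry concerns the column stabiliser of \<open>\<sigma> \<circ> t\<close>; conjugation
  by \<open>\<sigma>\<close> mediates.\<close>

lemma garnir_mod_column_stabiliser':
  assumes E: "garnir_mod D U E" and t: "t \<in> fillings D" and \<sigma>: "\<sigma> permutes {1..card D}"
    and q: "q \<in> column_stabiliser D t"
  shows "E (\<sigma> \<circ> q \<circ> t) - cscale (of_int (sign q)) (E (\<sigma> \<circ> t)) \<in> U"
proof -
  have "\<sigma> \<circ> q \<circ> inv \<sigma> \<circ> (\<sigma> \<circ> t) = \<sigma> \<circ> q \<circ> t"
    using permutes_inverses(2)[OF \<sigma>] by (auto simp: fun_eq_iff)
  moreover have "sign (\<sigma> \<circ> q \<circ> inv \<sigma>) = sign q"
    using q by (intro sign_conj[OF \<sigma>]) (auto simp: column_stabiliser_def)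
  ultimately show ?thesis
    using garnir_mod_column_stabiliser[OF E fillings_comp[OF t \<sigma>] column_stabiliser_conj_mem[OF t \<sigma> q]] by simp
qed

lemma subspace_diff_iff:
  assumes "cfun.subspace U" "a - b \<in> U"
  shows "a \<in> U \<longleftrightarrow> b \<in> U"
  using cfun.subspace_add[OF assms(1) assms(2), of b] cfun.subspace_diff[OF assms(1) _ assms(2), of a]
  by auto

lemma subspace_unscale:
  assumes "cfun.subspace U" "cscale c v \<in> U" "c \<noteq> 0"
  shows "v \<in> U"
  using cfun.subspace_scale[OF assms(1,2), of "inverse c"] assms(3) by (simp add: cscale_def mult.assoc[symmetric])

lemma sum_const_cscale: "(\<Sum>q\<in>P. v) = cscale (of_nat (card P)) v"
  by (auto simp: fun_eq_iff sum_fun_apply cscale_def)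

text \<open>This is the Garnir relation for the single entry \<open>a\<close> and the whole column
  \<open>j'\<close>; the assumption on the column lengths is exactly what makes it long enough.
  Permutations of the enlarged column factor as \<open>transpose a x \<circ> q\<close> with
  \<open>q\<close> permuting the column. By antisymmetry all \<open>q\<close> contribute equally,
  and their number, a factorial, can be divided out. The term \<open>x = a\<close> is
  \<open>E t\<close>, all others carry the sign -1.\<close>

lemma garnir_exchange:
  assumes E: "garnir_mod D U E" and U: "cfun.subspace U" and t: "t \<in> fillings D"
    and jj: "j \<noteq> j'" and a: "a \<in> column_entries D t j" and c: "card (column_entries D t j) \<le> card (column_entries D t j')"
  shows "E t - (\<Sum>x\<in>column_entries D t j'. E (transpose a x \<circ> t)) \<in> U"
proof -
  let ?Y = "column_entries D t j'"
  have fY: "finite ?Y" by (rule finite_col[OF t])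
  have aY: "a \<notin> ?Y" using col_disjoint[OF t jj] a by blast
  have sub: "insert a ?Y \<subseteq> {1..card D}" using col_subset[OF t] a by blast
  let ?P = "{q. q permutes ?Y}"
  let ?F = "\<lambda>x q. cscale (of_int (sign (transpose a x \<circ> q))) (E (transpose a x \<circ> q \<circ> t))"
  let ?G = "\<lambda>x. cscale (of_int (sign (transpose a x))) (E (transpose a x \<circ> t))"
  have "(\<Sum>\<sigma> | \<sigma> permutes {a} \<union> ?Y. cscale (of_int (sign \<sigma>)) (E (\<sigma> \<circ> t))) \<in> U"
    by (rule garnir_mod_garnir[OF E t jj]) (use a c in auto)
  then have 1: "(\<Sum>x\<in>insert a ?Y. \<Sum>q\<in>?P. ?F x q) \<in> U"
    by (simp only: insert_is_Un[symmetric] sum_over_permutations_insert[OF fY aY])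
  have diff: "?F x q - ?G x \<in> U" if x: "x \<in> insert a ?Y" and q: "q \<in> ?P" for x q
  proof -
    have tx: "transpose a x permutes {1..card D}" using x sub by (intro permutes_swap_id) auto
    have qc: "q \<in> column_stabiliser D t" using column_stabiliser_permutes_col[OF t] q by blast
    have s: "sign (transpose a x \<circ> q) = sign (transpose a x) * sign q"
      using sign_comp_permutes[OF tx, of q] qc by (simp add: column_stabiliser_def)
    have s2: "of_int (sign q) * of_int (sign q) = (1::complex)" by (metis of_int_1 of_int_mult sign_idempotent)
    have "?F x q - ?G x = cscale (of_int (sign (transpose a x) * sign q))
       (E (transpose a x \<circ> q \<circ> t) - cscale (of_int (sign q)) (E (transpose a x \<circ> t)))"
      unfolding s using s2 by (auto simp: cscale_def fun_eq_iff algebra_simps)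
    then show ?thesis using garnir_mod_column_stabiliser'[OF E t tx qc] cfun.subspace_scale[OF U] by simp
  qed
  have "(\<Sum>x\<in>insert a ?Y. \<Sum>q\<in>?P. ?F x q) - (\<Sum>x\<in>insert a ?Y. \<Sum>q\<in>?P. ?G x) \<in> U"
    unfolding sum_subtractf[symmetric] by (intro cfun.subspace_sum[OF U] diff)
  then have 2: "(\<Sum>x\<in>insert a ?Y. \<Sum>q\<in>?P. ?G x) \<in> U" using subspace_diff_iff[OF U] 1 by blast
  have "(\<Sum>x\<in>insert a ?Y. \<Sum>q\<in>?P. ?G x) = cscale (fact (card ?Y)) (\<Sum>x\<in>insert a ?Y. ?G x)"
    by (simp only: sum_const_cscale card_permutations[OF refl fY] cfun.scale_sum_right of_nat_fact)
  also have "(\<Sum>x\<in>insert a ?Y. ?G x) = E t - (\<Sum>x\<in>?Y. E (transpose a x \<circ> t))"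
  proof -
    have "?G x = - E (transpose a x \<circ> t)" if "x \<in> ?Y" for x
      using that aY by (auto simp: sign_swap_id cscale_def fun_eq_iff)
    then have "(\<Sum>x\<in>?Y. ?G x) = - (\<Sum>x\<in>?Y. E (transpose a x \<circ> t))" by (simp add: sum_negf)
    then show ?thesis using aY fY by (simp add: cscale_def)
  qed
  finally have "cscale (fact (card ?Y)) (E t - (\<Sum>x\<in>?Y. E (transpose a x \<circ> t))) \<in> U" using 2 by (simp only:)
  then show ?thesis by (rule subspace_unscale[OF U]) simp
qed

section \<open>Inserting and removing the largest entry at a corner\<close>

lemma fillings_insert:
  assumes "finite D" "c \<in> D" "s \<in> fillings (D - {c})"
  shows "s(c := card D) \<in> fillings D"
proof -
  have pos: "card D > 0" using assms card_gt_0_iff by blast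
  have "bij_betw s (D - {c}) {1..card D - 1}" using assms by (simp add: fillings_def)
  then have "bij_betw (s(c := card D)) (D - {c}) {1..card D - 1}"
    by (subst bij_betw_cong[where g=s]) auto
  moreover have "bij_betw (s(c := card D)) {c} {card D}" by auto
  ultimately have "bij_betw (s(c := card D)) ((D - {c}) \<union> {c}) ({1..card D - 1} \<union> {card D})"
    by (rule bij_betw_combine) auto
  moreover have "(D - {c}) \<union> {c} = D" "{1..card D - 1} \<union> {card D} = {1..card D}"
    using assms pos by auto
  ultimately show ?thesis by (simp add: fillings_def)
qed

lemma fillings_remove:
  assumes "c \<in> D" "t \<in> fillings D" "t c = card D"
  shows "t \<in> fillings (D - {c})"
proof -
  have b: "bij_betw t D {1..card D}" using assms by (simp add: fillings_def)
  then have "bij_betw t (D - {c}) ({1..card D} - {t c})"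
    using assms(1) by (auto simp: bij_betw_def inj_on_def)
  moreover have "{1..card D} - {t c} = {1..card D - 1}" using assms by auto
  ultimately show ?thesis using assms(1) by (simp add: fillings_def)
qed

lemma col_insert:
  assumes "c \<in> D"
  shows "column_entries D (s(c := n)) j = (if j = snd c then insert n (column_entries (D - {c}) s j) else column_entries (D - {c}) s j)"
proof -
  obtain a b where c: "c = (a, b)" by force
  show ?thesis using assms unfolding column_entries_def c by (auto; metis)
qed

lemma notin_col_remove:
  assumes "finite D" "c \<in> D" "s \<in> fillings (D - {c})"
  shows "card D \<notin> column_entries (D - {c}) s j"
  using col_subset[OF assms(3), of j] assms(1,2) card_gt_0_iff[of D] by fastforce

lemma comp_upd_permutes:
  fixes n :: nat
  assumes "q permutes S" "n \<notin> S"
  shows "(q \<circ> s)(c := n) = q \<circ> s(c := n)"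
  using assms by (auto simp: fun_eq_iff permutes_not_in)

lemma card_col_antimono:
  assumes "downset D" "finite D" "t \<in> fillings D" "j \<le> j'"
  shows "card (column_entries D t j') \<le> card (column_entries D t j)"
proof -
  have "finite {i. (i, j) \<in> D}"
    by (rule finite_subset[OF _ finite_imageI[OF assms(2), of fst]]) force
  moreover have "{i. (i, j') \<in> D} \<subseteq> {i. (i, j) \<in> D}" using downsetD[OF assms(1)] assms(4) by blast
  ultimately show ?thesis by (simp add: card_col[OF assms(3)] card_mono)
qed


text \<open>If the relation for \<open>X\<close>, \<open>Y\<close> is too short for the larger shape, the one for \<open>insert n X\<close>, \<open>Y\<close> is
  not, where \<open>n = card D\<close>. Its terms either move \<open>n\<close> to a column further right or, by antisymmetry
  in the column of \<open>c\<close>, are equal to terms that leave \<open>n\<close> in place.\<close>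

lemma garnir_lift_corner:
  assumes D: "downset D" "finite D" and c: "c \<in> D" and U: "cfun.subspace U"
    and E: "garnir_mod D U E" and s: "s \<in> fillings (D - {c})"
    and right: "\<And>u j'. u \<in> fillings D \<Longrightarrow> snd c < j' \<Longrightarrow> card D \<in> column_entries D u j' \<Longrightarrow> E u \<in> U"
    and jj: "j' \<noteq> snd c"
    and X: "X \<subseteq> column_entries (D - {c}) s (snd c)" and Y: "Y \<subseteq> column_entries (D - {c}) s j'"
    and XY: "max (card (column_entries (D - {c}) s (snd c))) (card (column_entries (D - {c}) s j')) < card X + card Y"
  shows "(\<Sum>\<sigma> | \<sigma> permutes X \<union> Y. cscale (of_int (sign \<sigma>)) (E ((\<sigma> \<circ> s)(c := card D)))) \<in> U"
proof -
  define n where "n = card D"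
  define t where "t = s(c := n)"
  let ?j = "snd c" and ?D = "D - {c}" and ?Z = "X \<union> Y"
  have t: "t \<in> fillings D" unfolding t_def n_def by (rule fillings_insert[OF D(2) c s])
  have cj: "column_entries D t ?j = insert n (column_entries ?D s ?j)" and cj': "column_entries D t j' = column_entries ?D s j'"
    using jj by (simp_all add: t_def col_insert[OF c])
  have nX: "n \<notin> X" "n \<notin> Y" using notin_col_remove[OF D(2) c s] X Y by (auto simp: n_def)
  have fin: "finite X" "finite Y" using X Y finite_col[OF s] finite_subset by metis+
  have disj: "X \<inter> Y = {}" using X Y col_disjoint[OF s, of j' ?j] jj by blast
  have eqt: "(\<sigma> \<circ> s)(c := n) = \<sigma> \<circ> t" if "\<sigma> permutes ?Z" for \<sigma>
    unfolding t_def by (rule comp_upd_permutes[OF that]) (use nX in simp)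
  have Zs: "?Z \<subseteq> {1..card D}" "insert n ?Z \<subseteq> {1..card D}"
    using X Y cj cj' col_subset[OF t, of ?j] col_subset[OF t, of j'] by auto
  let ?S = "\<Sum>\<sigma> | \<sigma> permutes ?Z. cscale (of_int (sign \<sigma>)) (E (\<sigma> \<circ> t))"
  have "?S \<in> U"
  proof (cases "max (card (column_entries D t ?j)) (card (column_entries D t j')) < card X + card Y")
    case True
    show ?thesis
      by (rule garnir_mod_garnir[OF E t _ _ _ True]) (use jj X Y cj cj' in auto)
  next
    case False
    have nc: "card (column_entries D t ?j) = Suc (card (column_entries ?D s ?j))"
      unfolding cj using notin_col_remove[OF D(2) c s] finite_col[OF s] by (simp add: n_def)
    \<comment> \<open>Restoring \<open>c\<close> lengthens only its own column. If that column is to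
      the right of column \<open>j'\<close>, it is still no longer than column \<open>j'\<close>,
      the maximum is unchanged, and the relation would have been long enough.\<close>
    have lt: "?j < j'"
    proof (rule ccontr)
      assume "\<not> ?j < j'"
      then have "card (column_entries D t ?j) \<le> card (column_entries D t j')" by (intro card_col_antimono[OF D t]) simp
      then show False using False XY cj' by simp
    qed
    have "max (card (column_entries D t ?j)) (card (column_entries D t j')) < card (insert n X) + card Y"
      using XY nc cj' nX fin by simp
    then have "(\<Sum>\<sigma> | \<sigma> permutes insert n X \<union> Y. cscale (of_int (sign \<sigma>)) (E (\<sigma> \<circ> t))) \<in> U"
      by (intro garnir_mod_garnir[OF E t, where j = ?j and j' = j']) (use jj X Y cj cj' in auto)
    then have "(\<Sum>x\<in>insert n ?Z. \<Sum>q | q permutes ?Z. cscale (of_int (sign (transpose n x \<circ> q))) (E (transpose n x \<circ> q \<circ> t))) \<in> U"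
      by (subst (asm) Un_insert_left, subst (asm) sum_over_permutations_insert) (use nX fin in auto)
    then have 1: "(\<Sum>q | q permutes ?Z. \<Sum>x\<in>insert n ?Z. cscale (of_int (sign (transpose n x \<circ> q))) (E (transpose n x \<circ> q \<circ> t))) \<in> U"
      by (subst sum.swap)
    let ?F = "\<lambda>q x. cscale (of_int (sign (transpose n x \<circ> q))) (E (transpose n x \<circ> q \<circ> t))"
    have inner: "(\<Sum>x\<in>insert n ?Z. ?F q x) - (\<Sum>x\<in>insert n X. cscale (of_int (sign q)) (E (q \<circ> t))) \<in> U"
      if q: "q permutes ?Z" for q
    proof -
      have qp: "q permutes {1..card D}" by (rule permutes_subset[OF q Zs(1)])
      have qt: "q \<circ> t \<in> fillings D" by (rule fillings_comp[OF t qp])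
      have qn: "q n = n" using q nX by (simp add: permutes_not_in)
      have tp: "transpose n x permutes {1..card D}" if "x \<in> ?Z" for x
        using that Zs by (intro permutes_swap_id) auto
      have nj: "n \<in> column_entries D (q \<circ> t) ?j" using qn cj by (auto simp: col_comp intro: rev_image_eqI)
      \<comment> \<open>As \<open>q\<close> fixes \<open>n\<close>, the partners of \<open>n\<close>
        split according to their column in \<open>q \<circ> t\<close>: those in
        \<open>insert n (q\<close> X)\<open>are in the column of\<close>c\<open>, those in\<close>q
        \<open>Y\<close> in column \<open>j'\<close>.\<close>
      have Zim: "insert n ?Z = insert n (q ` X) \<union> q ` Y"
        using permutes_image[OF q] by (auto simp: image_Un)
      have dis: "insert n (q ` X) \<inter> q ` Y = {}"
        using disj nX qn permutes_inj[OF q] by (auto simp: inj_eq)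
      have y: "?F q x \<in> U" if x: "x \<in> q ` Y" for x
      proof -
        have "x \<in> column_entries D (q \<circ> t) j'" using x Y cj' by (auto simp: col_comp)
        then have "n \<in> column_entries D (transpose n x \<circ> (q \<circ> t)) j'"
          by (subst col_comp) (rule rev_image_eqI, assumption, simp)
        moreover have "transpose n x \<circ> (q \<circ> t) \<in> fillings D"
          using x permutes_image[OF q] by (intro fillings_comp[OF qt] tp) auto
        ultimately show ?thesis using right[OF _ lt] cfun.subspace_scale[OF U]
          by (auto simp: n_def comp_assoc)
      qed
      have x: "?F q x - cscale (of_int (sign q)) (E (q \<circ> t)) \<in> U" if x: "x \<in> insert n (q ` X)" for x
      proof (cases "x = n")
        case True
        then show ?thesis using cfun.subspace_0[OF U] by simp
      next
        case False
        then have xX: "x \<in> q ` X" using x by simp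
        then have "x \<in> column_entries D (q \<circ> t) ?j" using X cj by (auto simp: col_comp)
        then have "transpose n x \<in> column_stabiliser D (q \<circ> t)"
          using nj by (intro column_stabiliser_permutes_col[OF qt, of _ "{n, x}" ?j] permutes_swap_id) auto
        then have 1: "E (transpose n x \<circ> (q \<circ> t)) - cscale (of_int (sign (transpose n x))) (E (q \<circ> t)) \<in> U"
          by (rule garnir_mod_column_stabiliser[OF E qt])
        have "sign (transpose n x \<circ> q) = - sign q"
        proof -
          have "x \<in> ?Z" using xX permutes_image[OF q] by blast
          then show ?thesis using sign_comp_permutes[OF tp qp] False by (simp add: sign_swap_id)
        qed
        then have "?F q x - cscale (of_int (sign q)) (E (q \<circ> t)) =
            cscale (- of_int (sign q)) (E (transpose n x \<circ> (q \<circ> t)) - cscale (of_int (sign (transpose n x))) (E (q \<circ> t)))"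
          using False by (auto simp: cscale_def fun_eq_iff algebra_simps sign_swap_id comp_assoc)
        then show ?thesis using cfun.subspace_scale[OF U 1, of "- of_int (sign q)"] by (simp only:)
      qed
      have "(\<Sum>x\<in>insert n ?Z. ?F q x) = (\<Sum>x\<in>insert n (q ` X). ?F q x) + (\<Sum>x\<in>q ` Y. ?F q x)"
        unfolding Zim using fin dis by (intro sum.union_disjoint) auto
      moreover have "(\<Sum>x\<in>insert n (q ` X). ?F q x) - (\<Sum>x\<in>insert n (q ` X). cscale (of_int (sign q)) (E (q \<circ> t)))
          + (\<Sum>x\<in>q ` Y. ?F q x) \<in> U"
        unfolding sum_subtractf[symmetric]
        by (intro cfun.subspace_add[OF U] cfun.subspace_sum[OF U] x y)
      moreover have "(\<Sum>x\<in>insert n (q ` X). cscale (of_int (sign q)) (E (q \<circ> t)))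
          = (\<Sum>x\<in>insert n X. cscale (of_int (sign q)) (E (q \<circ> t)))"
      proof -
        have "insert n (q ` X) = q ` insert n X" using qn by simp
        then have "card (insert n (q ` X)) = card (insert n X)"
          using card_image[OF permutes_inj_on[OF q, of "insert n X"]] by (simp only:)
        then show ?thesis by (simp only: sum_const_cscale)
      qed
      ultimately show ?thesis by (simp only: diff_add_eq)
    qed
    have "(\<Sum>q | q permutes ?Z. \<Sum>x\<in>insert n ?Z. ?F q x) - (\<Sum>q | q permutes ?Z. \<Sum>x\<in>insert n X. cscale (of_int (sign q)) (E (q \<circ> t))) \<in> U"
      unfolding sum_subtractf[symmetric] by (intro cfun.subspace_sum[OF U]) (use inner in blast)
    then have "(\<Sum>q | q permutes ?Z. \<Sum>x\<in>insert n X. cscale (of_int (sign q)) (E (q \<circ> t))) \<in> U"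
      using subspace_diff_iff[OF U] 1 by blast
    \<comment> \<open>Every exchange inside the column of \<open>c\<close> gives the same term, so
      modulo \<open>U\<close> the longer relation is the wanted one times the nonzero number
      \<open>card (insert n X)\<close>.\<close>
    then have "cscale (of_nat (card (insert n X))) ?S \<in> U"
      by (simp only: sum_const_cscale cfun.scale_sum_right)
    then show ?thesis by (rule subspace_unscale[OF U]) (use fin in auto)
  qed
  also have "?S = (\<Sum>\<sigma> | \<sigma> permutes ?Z. cscale (of_int (sign \<sigma>)) (E ((\<sigma> \<circ> s)(c := card D))))"
    using eqt by (intro sum.cong) (auto simp: n_def)
  finally show ?thesis .
qed

text \<open>This prepares the induction on the shape: fixing the largest entry at \<open>c\<close>
  turns \<open>E\<close> into a family for \<open>D - {c}\<close>. Column permutations of the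
  smaller shape fix the largest entry, and relations avoiding the column of \<open>c\<close> are
  relations for \<open>D\<close>; only those meeting that column require an argument.\<close>

lemma garnir_lift:
  assumes D: "downset D" "finite D" and c: "c \<in> D" and U: "cfun.subspace U"
    and E: "garnir_mod D U E"
    and right: "\<And>u j'. u \<in> fillings D \<Longrightarrow> snd c < j' \<Longrightarrow> card D \<in> column_entries D u j' \<Longrightarrow> E u \<in> U"
  shows "garnir_mod (D - {c}) U (\<lambda>s. E (s(c := card D)))"
  unfolding garnir_mod_def
proof (intro conjI ballI allI impI)
  fix s s' :: "nat \<times> nat \<Rightarrow> nat" assume s: "s \<in> fillings (D - {c})" and eq: "\<forall>x\<in>D - {c}. s' x = s x"
  show "E (s'(c := card D)) = E (s(c := card D))"
    by (rule garnir_mod_cong[OF E fillings_insert[OF D(2) c s]]) (use eq in auto)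
next
  fix s \<rho> assume s: "s \<in> fillings (D - {c})" and \<rho>: "\<rho> \<in> column_stabiliser (D - {c}) s"
  let ?t = "s(c := card D)"
  have t: "?t \<in> fillings D" by (rule fillings_insert[OF D(2) c s])
  have \<rho>p: "\<rho> permutes {1..card D - 1}" using \<rho> c by (simp add: column_stabiliser_def)
  have nin: "card D \<notin> {1..card D - 1}" using c D(2) card_gt_0_iff[of D] by auto
  then have \<rho>n: "\<rho> (card D) = card D" using \<rho>p by (simp add: permutes_not_in)
  have "\<rho> \<in> column_stabiliser D ?t"
    using \<rho> \<rho>n permutes_subset[OF \<rho>p, of "{1..card D}"] by (auto simp: column_stabiliser_def col_insert[OF c])
  then show "E ((\<rho> \<circ> s)(c := card D)) - cscale (of_int (sign \<rho>)) (E ?t) \<in> U"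
    unfolding comp_upd_permutes[OF \<rho>p nin] by (rule garnir_mod_column_stabiliser[OF E t])
next
  fix s j j' X Y
  assume s: "s \<in> fillings (D - {c})" and jj: "j \<noteq> j'"
    and X: "X \<subseteq> column_entries (D - {c}) s j" and Y: "Y \<subseteq> column_entries (D - {c}) s j'"
    and XY: "max (card (column_entries (D - {c}) s j)) (card (column_entries (D - {c}) s j')) < card X + card Y"
  consider "j = snd c" | "j' = snd c" | "j \<noteq> snd c" "j' \<noteq> snd c" by blast
  then show "(\<Sum>\<sigma> | \<sigma> permutes X \<union> Y. cscale (of_int (sign \<sigma>)) (E ((\<sigma> \<circ> s)(c := card D)))) \<in> U"
  proof cases
    case 1
    show ?thesis
      by (rule garnir_lift_corner[OF D c U E s right, where j' = j']) (use 1 jj X Y XY in auto)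
  next
    case 2
    show ?thesis unfolding Un_commute[of X Y]
      by (rule garnir_lift_corner[OF D c U E s right, where j' = j]) (use 2 jj X Y XY in auto)
  next
    case 3
    let ?t = "s(c := card D)"
    have t: "?t \<in> fillings D" by (rule fillings_insert[OF D(2) c s])
    have "column_entries D ?t j = column_entries (D - {c}) s j" "column_entries D ?t j' = column_entries (D - {c}) s j'"
      using 3 by (simp_all add: col_insert[OF c])
    then have "(\<Sum>\<sigma> | \<sigma> permutes X \<union> Y. cscale (of_int (sign \<sigma>)) (E (\<sigma> \<circ> ?t))) \<in> U"
      using X Y XY by (intro garnir_mod_garnir[OF E t jj]) auto
    moreover have "(\<sigma> \<circ> s)(c := card D) = \<sigma> \<circ> ?t" if "\<sigma> permutes X \<union> Y" for \<sigma>
      by (rule comp_upd_permutes[OF that]) (use X Y notin_col_remove[OF D(2) c s] in blast)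
    then have "(\<Sum>\<sigma> | \<sigma> permutes X \<union> Y. cscale (of_int (sign \<sigma>)) (E ((\<sigma> \<circ> s)(c := card D)))) =
        (\<Sum>\<sigma> | \<sigma> permutes X \<union> Y. cscale (of_int (sign \<sigma>)) (E (\<sigma> \<circ> ?t)))"
      by (intro sum.cong) auto
    ultimately show ?thesis by (simp only:)
  qed
qed


text \<open>Descending induction on the column \<open>j\<close> of the largest entry. If the lowest
  cell of column \<open>j\<close> is not a corner, the exchange relation with the next column moves
  the entry to the right. Otherwise antisymmetry puts it into the corner, and the hypothesis for the
  smaller shape applies modulo \<open>W j\<close>, which already contains all fillings with that
  entry further right. The bound on the column in the conclusion records that straightening never
  moves the largest entry to the left.\<close>

lemma column_span:
  fixes E :: "(nat \<times> nat \<Rightarrow> nat) \<Rightarrow> 'a \<Rightarrow> complex"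
  assumes D: "downset D" "finite D" and U: "cfun.subspace U" and E: "garnir_mod D U E"
    and IH: "\<And>c V F s. c \<in> max_cells D \<Longrightarrow> cfun.subspace V \<Longrightarrow> garnir_mod (D - {c}) V F \<Longrightarrow>
      s \<in> fillings (D - {c}) \<Longrightarrow> (F s :: 'a \<Rightarrow> complex) \<in> cfun.span (V \<union> F ` std_fillings (D - {c}))"
    and t: "t \<in> fillings D" "card D \<in> column_entries D t j"
  shows "E t \<in> cfun.span (U \<union> E ` {u \<in> std_fillings D. \<exists>j'\<ge>j. card D \<in> column_entries D u j'})"
proof -
  define n where "n = card D"
  define W where "W = (\<lambda>j. cfun.span (U \<union> E ` {u \<in> std_fillings D. \<exists>j'\<ge>j. n \<in> column_entries D u j'}))"
  have WU: "U \<subseteq> W j" for j unfolding W_def using cfun.span_superset by blast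
  have Wmono: "W j' \<subseteq> W j" if "j \<le> j'" for j j'
    unfolding W_def by (intro cfun.span_mono Un_mono order.refl image_mono) (use that le_trans in blast)
  have Wsub: "cfun.subspace (W j)" for j unfolding W_def by (rule cfun.subspace_span)
  obtain M where M: "\<And>i j. (i, j) \<in> D \<Longrightarrow> j \<le> M"
  proof -
    have "finite (snd ` D)" using D by simp
    then show ?thesis using that[of "Max (snd ` D)"] by (metis Max_ge image_eqI snd_conv)
  qed
  have "E t \<in> W j" if "t \<in> fillings D" "n \<in> column_entries D t j" for t j
    using that
  proof (induction "M - j" arbitrary: t j rule: less_induct)
    case less
    note t = less.prems
    have "{i. (i, j) \<in> D} \<noteq> {}" using t(2) by (auto simp: column_entries_def)
    moreover have finc: "finite {i. (i, j) \<in> D}"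
      by (rule finite_subset[OF _ finite_imageI[OF D(2), of fst]]) force
    ultimately obtain r where r: "(r, j) \<in> D" "\<And>i. (i, j) \<in> D \<Longrightarrow> i \<le> r"
      using Max_in[of "{i. (i, j) \<in> D}"] Max_ge[of "{i. (i, j) \<in> D}"] by blast
    have jM: "j \<le> M" using M r by blast
    have right: "E u \<in> W j" if "u \<in> fillings D" "j < j'" "n \<in> column_entries D u j'" for u j'
    proof -
      have "j' \<le> M" using that(3) M by (auto simp: column_entries_def)
      then have "E u \<in> W j'" using that by (intro less.hyps) auto
      then show ?thesis using Wmono[of j j'] that(2) by auto
    qed
    show ?case
    proof (cases "(r, Suc j) \<in> D")
      case True
      \<comment> \<open>Row \<open>r\<close> is the lowest one of column \<open>j\<close>, so the
        next column reaches as far down, which the exchange relation needs.\<close>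
      have "{i. (i, j) \<in> D} \<subseteq> {i. (i, Suc j) \<in> D}" using r(2) downsetD[OF D(1) True] by blast
      moreover have "finite {i. (i, Suc j) \<in> D}"
        by (rule finite_subset[OF _ finite_imageI[OF D(2), of fst]]) force
      ultimately have "card (column_entries D t j) \<le> card (column_entries D t (Suc j))"
        unfolding card_col[OF t(1)] by (rule card_mono[rotated])
      then have ex: "E t - (\<Sum>x\<in>column_entries D t (Suc j). E (transpose n x \<circ> t)) \<in> U"
        using t by (intro garnir_exchange[OF E U]) auto
      have "E (transpose n x \<circ> t) \<in> W j" if x: "x \<in> column_entries D t (Suc j)" for x
      proof (rule right[of _ "Suc j"])
        show "transpose n x \<circ> t \<in> fillings D"
          using x t col_subset[OF t(1)] by (intro fillings_comp permutes_swap_id) (auto simp del: atLeastAtMost_iff)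
        show "n \<in> column_entries D (transpose n x \<circ> t) (Suc j)"
          unfolding col_comp using x by (rule rev_image_eqI) simp
      qed simp
      then have "(\<Sum>x\<in>column_entries D t (Suc j). E (transpose n x \<circ> t)) \<in> W j"
        by (intro cfun.subspace_sum[OF Wsub])
      then show ?thesis using subspace_diff_iff[OF Wsub, of "E t" _ j] ex WU by blast
    next
      case False
      define c where "c = (r, j)"
      have cD: "c \<in> D" using r by (simp add: c_def)
      have c: "c \<in> max_cells D"
      proof -
        have "(r, j') \<notin> D" if "j' > j" for j' using False downsetD[OF D(1), of r j' r "Suc j"] that by auto
        moreover have "(i', j) \<notin> D" if "i' > r" for i' using r(2) that by force
        ultimately show ?thesis using r by (auto simp: max_cells_def c_def)
      qed
      have corner: "E u \<in> W j" if u: "u \<in> fillings D" "u c = n" for u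
      proof -
        have g: "garnir_mod D (W j) E"
          by (rule garnir_mod_mono[OF WU E])
        have gl: "garnir_mod (D - {c}) (W j) (\<lambda>s. E (s(c := card D)))"
          by (rule garnir_lift[OF D cD Wsub g]) (use right in \<open>auto simp: c_def n_def\<close>)
        have "u \<in> fillings (D - {c})" using fillings_remove[OF cD u(1)] u(2) by (simp add: n_def)
        then have "E (u(c := card D)) \<in> cfun.span (W j \<union> (\<lambda>s. E (s(c := card D))) ` std_fillings (D - {c}))"
          by (rule IH[OF c Wsub gl])
        moreover have "u(c := card D) = u" using u by (auto simp: n_def)
        moreover have "cfun.span (W j \<union> (\<lambda>s. E (s(c := card D))) ` std_fillings (D - {c})) \<subseteq> W j"
        proof (rule cfun.span_minimal[OF _ Wsub], rule Un_least[OF order.refl], rule image_subsetI)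
          fix s assume s: "s \<in> std_fillings (D - {c})"
          have "s(c := card D) \<in> std_fillings D" by (rule std_fillings_insert_max[OF D(2) c s])
          moreover have "n \<in> column_entries D (s(c := card D)) j"
            using cD by (force simp: column_entries_def c_def n_def)
          ultimately show "E (s(c := card D)) \<in> W j"
            unfolding W_def by (intro cfun.span_base) blast
        qed
        ultimately show ?thesis by auto
      qed
      have tc: "t c \<in> column_entries D t j" using cD by (auto simp: column_entries_def c_def)
      define \<rho> where "\<rho> = transpose n (t c)"
      have \<rho>: "\<rho> \<in> column_stabiliser D t" unfolding \<rho>_def
        using t tc by (intro column_stabiliser_permutes_col[OF t(1), of _ "{n, t c}" j] permutes_swap_id) auto
      have "\<rho> \<circ> t \<in> fillings D" using \<rho> by (intro fillings_comp[OF t(1)]) (simp add: column_stabiliser_def)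
      then have "E (\<rho> \<circ> t) \<in> W j" by (rule corner) (simp add: \<rho>_def)
      moreover have "E (\<rho> \<circ> t) - cscale (of_int (sign \<rho>)) (E t) \<in> W j"
        using garnir_mod_column_stabiliser[OF E t(1) \<rho>] WU by blast
      ultimately have "cscale (of_int (sign \<rho>)) (E t) \<in> W j"
        using subspace_diff_iff[OF Wsub] by blast
      then show ?thesis by (rule subspace_unscale[OF Wsub]) simp
    qed
  qed
  then show ?thesis using t unfolding W_def n_def by blast
qed

lemma std_span:
  fixes E :: "(nat \<times> nat \<Rightarrow> nat) \<Rightarrow> 'a \<Rightarrow> complex"
  assumes "downset D" "finite D" and "cfun.subspace U" and "garnir_mod D U E" and "t \<in> fillings D"
  shows "E t \<in> cfun.span (U \<union> E ` std_fillings D)"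
  using assms
proof (induction "card D" arbitrary: D U E t rule: less_induct)
  case less
  note D = less.prems(1,2) and U = less.prems(3) and E = less.prems(4) and t = less.prems(5)
  show ?case
  proof (cases "D = {}")
    case True
    have "E (\<lambda>x. undefined) = E t" using True by (intro garnir_mod_cong[OF E t]) auto
    then have "E t \<in> U \<union> E ` std_fillings D" using True by (auto simp: std_fillings_empty)
    then show ?thesis by (rule cfun.span_base)
  next
    case False
    then have "card D \<in> {1..card D}" using D(2) card_gt_0_iff[of D] by auto
    then obtain j where j: "card D \<in> column_entries D t j" using col_ex[OF t] by blast
    have "E t \<in> cfun.span (U \<union> E ` {u \<in> std_fillings D. \<exists>j'\<ge>j. card D \<in> column_entries D u j'})"
    proof (rule column_span[OF D U E _ t j])
      fix c V s and F :: "(nat \<times> nat \<Rightarrow> nat) \<Rightarrow> 'a \<Rightarrow> complex"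
      assume c: "c \<in> max_cells D" and V: "cfun.subspace V" "garnir_mod (D - {c}) V F" "s \<in> fillings (D - {c})"
      have "c \<in> D" using c max_cells_subset by blast
      then have "card (D - {c}) < card D" using D(2) by (meson card_Diff1_less)
      then show "(F s :: 'a \<Rightarrow> complex) \<in> cfun.span (V \<union> F ` std_fillings (D - {c}))"
        using D V downset_remove[OF D(1) c] by (intro less.hyps) auto
    qed
    moreover have "cfun.span (U \<union> E ` {u \<in> std_fillings D. \<exists>j'\<ge>j. card D \<in> column_entries D u j'}) \<subseteq> cfun.span (U \<union> E ` std_fillings D)"
      by (rule cfun.span_mono) blast
    ultimately show ?thesis by blast
  qed
qed

text \<open>\<open>std_span\<close> supplies the hypothesis on smaller shapes. The information on
  the column, lost in \<open>polytab_span\<close>, is what makes the coefficients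
  triangular.\<close>

lemma polytab_column_span:
  assumes D: "downset D" "finite D" and t: "t \<in> fillings D" "card D \<in> column_entries D t j"
  shows "polytab D t \<in> cfun.span (polytab D ` {u \<in> std_fillings D. \<exists>j'\<ge>j. card D \<in> column_entries D u j'})"
proof -
  have "polytab D t \<in> cfun.span ({0} \<union> polytab D ` {u \<in> std_fillings D. \<exists>j'\<ge>j. card D \<in> column_entries D u j'})"
    by (rule column_span[OF D cfun.subspace_single_0 garnir_mod_polytab[OF D] std_span t])
      (use D downset_remove in auto)
  then show ?thesis by (simp add: cfun.span_insert_0)
qed

lemma polytab_span:
  assumes D: "downset D" "finite D" and t: "t \<in> fillings D"
  shows "polytab D t \<in> cfun.span (polytab D ` std_fillings D)"
  using std_span[OF D cfun.subspace_single_0 garnir_mod_polytab[OF D] t] by (simp add: cfun.span_insert_0)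

section \<open>Independence, matrix coefficients and branching\<close>

lemma std_fillings_in_fillings: "T \<in> std_fillings D \<Longrightarrow> T \<in> fillings D"
  by (simp add: std_fillings_def fillings_def)

lemma rows_of_insert:
  assumes "c \<in> D"
  shows "rows_of D (s(c := n)) i = (if i = fst c then insert n (rows_of (D - {c}) s i) else rows_of (D - {c}) s i)"
proof -
  obtain a b where c: "c = (a, b)" by force
  show ?thesis using assms unfolding rows_of_def c by (auto; metis)
qed

lemma notin_rows_of_remove:
  assumes "finite D" "c \<in> D" "s \<in> fillings (D - {c})"
  shows "card D \<notin> rows_of (D - {c}) s i"
proof -
  have "rows_of (D - {c}) s i \<subseteq> {1..card D - 1}"
    using assms by (auto simp: rows_of_def fillings_def bij_betw_def)
  then show ?thesis using assms(1,2) card_gt_0_iff[of D] by fastforce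
qed

lemma column_stabiliser_row:
  assumes t: "t \<in> fillings D" and \<pi>: "\<pi> \<in> column_stabiliser D t" and n: "n \<in> column_entries D t j"
    and i: "n \<in> rows_of D (\<pi> \<circ> t) i"
  shows "(i, j) \<in> D \<and> \<pi> (t (i, j)) = n"
proof -
  obtain l where l: "(i, l) \<in> D" "n = \<pi> (t (i, l))" using i by (auto simp: rows_of_def)
  have "t (i, l) \<in> column_entries D t l" using l by (auto simp: column_entries_def)
  then have "n \<in> column_entries D t l" using l \<pi> by (auto simp: column_stabiliser_def)
  then have "l = j" using n col_disjoint[OF t, of l j] by blast
  then show ?thesis using l by simp
qed

lemma polytab_eq_0:
  assumes t: "t \<in> fillings D" and n: "n \<in> column_entries D t j" and i: "(i, j) \<notin> D" "n \<in> Z i"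
  shows "polytab D t Z = 0"
  unfolding polytab_def using column_stabiliser_row[OF t _ n] i by (intro sum.neutral) auto

lemma column_stabiliser_fix_corner:
  assumes D: "finite D" and c: "c \<in> D" and s: "s \<in> fillings (D - {c})"
  shows "{\<pi> \<in> column_stabiliser D (s(c := card D)). \<pi> (card D) = card D} = column_stabiliser (D - {c}) s"
proof (intro equalityI subsetI)
  have pos: "card D > 0" using D c card_gt_0_iff by blast
  then have set: "{1..card D} - {1..card (D - {c})} = {card D}" using c by auto
  fix \<pi>
  {
    assume A: "\<pi> \<in> {\<pi> \<in> column_stabiliser D (s(c := card D)). \<pi> (card D) = card D}"
    then have p: "\<pi> permutes {1..card D}" by (simp add: column_stabiliser_def)
    have "\<pi> permutes {1..card (D - {c})}"
      by (rule permutes_superset[OF p], unfold set) (use A in simp)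
    moreover have "\<pi> x \<in> column_entries (D - {c}) s j" if x: "x \<in> column_entries (D - {c}) s j" for x j
    proof -
      have "x \<noteq> card D" using x notin_col_remove[OF D c s] by blast
      then have "\<pi> x \<noteq> card D" using A injD[OF permutes_inj[OF p], of x "card D"] by auto
      moreover have "\<pi> x \<in> column_entries D (s(c := card D)) j"
      proof -
        have "x \<in> column_entries D (s(c := card D)) j" using x by (auto simp: col_insert[OF c])
        then show ?thesis using A unfolding column_stabiliser_def by blast
      qed
      ultimately show ?thesis by (auto simp: col_insert[OF c] split: if_splits)
    qed
    ultimately show "\<pi> \<in> column_stabiliser (D - {c}) s" by (simp add: column_stabiliser_def)
  }
  {
    assume A: "\<pi> \<in> column_stabiliser (D - {c}) s"
    then have p: "\<pi> permutes {1..card (D - {c})}" by (simp add: column_stabiliser_def)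
    have n: "\<pi> (card D) = card D" using set by (intro permutes_not_in[OF p]) auto
    moreover have "\<pi> permutes {1..card D}" by (rule permutes_subset[OF p]) (use c in auto)
    ultimately show "\<pi> \<in> {\<pi> \<in> column_stabiliser D (s(c := card D)). \<pi> (card D) = card D}"
      using A by (auto simp: column_stabiliser_def col_insert[OF c])
  }
qed

lemma upd_insert_eq_iff:
  assumes "n \<notin> X r" "n \<notin> Y r"
  shows "X(r := insert n (X r)) = Y(r := insert n (Y r)) \<longleftrightarrow> X = Y"
proof
  assume eq: "X(r := insert n (X r)) = Y(r := insert n (Y r))"
  have "X i = Y i" for i
    using fun_cong[OF eq, of i] insert_ident[OF assms] by (cases "i = r") simp_all
  then show "X = Y" ..
qed simp

text \<open>The column of \<open>c\<close> meets the row of \<open>c\<close> only in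
  \<open>c\<close>. A column permutation that puts the largest entry into this row therefore fixes
  it, and what remains is the column stabiliser of the smaller shape.\<close>

lemma polytab_remove_corner:
  assumes D: "finite D" and c: "c \<in> D" and s: "s \<in> fillings (D - {c})"
    and X: "card D \<notin> X (fst c)"
  shows "polytab D (s(c := card D)) (X(fst c := insert (card D) (X (fst c)))) = polytab (D - {c}) s X"
proof -
  let ?n = "card D" and ?t = "s(c := card D)" and ?Z = "X(fst c := insert (card D) (X (fst c)))"
  have t: "?t \<in> fillings D" by (rule fillings_insert[OF D c s])
  have nc: "?n \<in> column_entries D ?t (snd c)" by (simp add: col_insert[OF c])
  have zero: "?Z \<noteq> rows_of D (\<pi> \<circ> ?t)" if "\<pi> \<in> column_stabiliser D ?t - {\<pi> \<in> column_stabiliser D ?t. \<pi> ?n = ?n}" for \<pi>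
  proof
    assume "?Z = rows_of D (\<pi> \<circ> ?t)"
    then have "?n \<in> rows_of D (\<pi> \<circ> ?t) (fst c)" by (metis fun_upd_same insertI1)
    then have "\<pi> (?t (fst c, snd c)) = ?n" using column_stabiliser_row[OF t _ nc] that by blast
    then show False using that by simp
  qed
  have eq: "?Z = rows_of D (\<pi> \<circ> ?t) \<longleftrightarrow> X = rows_of (D - {c}) (\<pi> \<circ> s)" if \<pi>: "\<pi> \<in> column_stabiliser (D - {c}) s" for \<pi>
  proof -
    have \<pi>n: "\<pi> ?n = ?n" using \<pi> column_stabiliser_fix_corner[OF D c s] by blast
    have u: "\<pi> \<circ> s \<in> fillings (D - {c})" using \<pi> by (intro fillings_comp[OF s]) (simp add: column_stabiliser_def)
    have "\<pi> \<circ> ?t = (\<pi> \<circ> s)(c := ?n)" using \<pi>n by (auto simp: fun_eq_iff)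
    then have "rows_of D (\<pi> \<circ> ?t) = rows_of D ((\<pi> \<circ> s)(c := ?n))" by (rule arg_cong)
    also have "\<dots> = (rows_of (D - {c}) (\<pi> \<circ> s))(fst c := insert ?n (rows_of (D - {c}) (\<pi> \<circ> s) (fst c)))"
      by (simp only: rows_of_insert[OF c] fun_eq_iff fun_upd_apply) simp
    finally have "rows_of D (\<pi> \<circ> ?t) = (rows_of (D - {c}) (\<pi> \<circ> s))(fst c := insert ?n (rows_of (D - {c}) (\<pi> \<circ> s) (fst c)))" .
    then show ?thesis
      by (simp only: upd_insert_eq_iff[where X = X and Y = "rows_of (D - {c}) (\<pi> \<circ> s)", OF X notin_rows_of_remove[OF D c u]])
  qed
  have "polytab D ?t ?Z = (\<Sum>\<pi>\<in>{\<pi> \<in> column_stabiliser D ?t. \<pi> ?n = ?n}. of_int (sign \<pi>) * (if ?Z = rows_of D (\<pi> \<circ> ?t) then 1 else 0))"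
    unfolding polytab_def
  proof (rule sum.mono_neutral_right[OF finite_column_stabiliser])
    show "\<forall>\<pi>\<in>column_stabiliser D ?t - {\<pi> \<in> column_stabiliser D ?t. \<pi> ?n = ?n}.
        of_int (sign \<pi>) * (if ?Z = rows_of D (\<pi> \<circ> ?t) then 1 else 0) = (0::complex)"
    proof (rule ballI)
      fix \<pi> assume "\<pi> \<in> column_stabiliser D ?t - {\<pi> \<in> column_stabiliser D ?t. \<pi> ?n = ?n}"
      then have "?Z \<noteq> rows_of D (\<pi> \<circ> ?t)" by (rule zero)
      then show "of_int (sign \<pi>) * (if ?Z = rows_of D (\<pi> \<circ> ?t) then 1 else 0) = (0::complex)"
        by (simp only: if_False mult_zero_right)
    qed
  qed blast
  also have "\<dots> = polytab (D - {c}) s X"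
    unfolding polytab_def column_stabiliser_fix_corner[OF D c s] by (rule sum.cong[OF refl]) (simp only: eq)
  finally show ?thesis .
qed

lemma polytab_remove_eq_0:
  assumes D: "finite D" and c: "c \<in> D" and s: "s \<in> fillings (D - {c})" and X: "card D \<in> X i"
  shows "polytab (D - {c}) s X = 0"
  unfolding polytab_def
proof (rule sum.neutral, rule ballI)
  fix \<pi> assume "\<pi> \<in> column_stabiliser (D - {c}) s"
  then have "\<pi> \<circ> s \<in> fillings (D - {c})" by (intro fillings_comp[OF s]) (simp add: column_stabiliser_def)
  then have "X \<noteq> rows_of (D - {c}) (\<pi> \<circ> s)" using notin_rows_of_remove[OF D c] X by metis
  then show "of_int (sign \<pi>) * (if X = rows_of (D - {c}) (\<pi> \<circ> s) then 1 else 0) = (0::complex)" by simp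
qed

text \<open>At a tabloid with the largest entry in the row of \<open>c\<close>, polytabloids having
  that entry in a corner further right vanish, because their columns do not reach this row. Corners
  further left are excluded by the assumption on \<open>b\<close>, so \<open>c\<close> is the only
  one left.\<close>

lemma sum_polytab_corner:
  assumes D: "downset D" "finite D" and c: "c \<in> max_cells D"
    and X: "card D \<notin> X (fst c)"
    and b: "\<And>c' s. c' \<in> max_cells D \<Longrightarrow> snd c' < snd c \<Longrightarrow> s \<in> std_fillings (D - {c'}) \<Longrightarrow> b (s(c' := card D)) = 0"
  shows "(\<Sum>t\<in>std_fillings D. b t * polytab D t (X(fst c := insert (card D) (X (fst c)))))
    = (\<Sum>s\<in>std_fillings (D - {c}). b (s(c := card D)) * polytab (D - {c}) s X)"
proof -
  let ?n = "card D" and ?Z = "X(fst c := insert (card D) (X (fst c)))"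
  let ?f = "\<lambda>c'. \<Sum>s\<in>std_fillings (D - {c'}). b (s(c' := ?n)) * polytab D (s(c' := ?n)) ?Z"
  have cD: "c \<in> D" using c max_cells_subset by blast
  have zero: "?f c' = 0" if c': "c' \<in> max_cells D - {c}" for c'
  proof -
    have c'D: "c' \<in> D" using c' max_cells_subset by blast
    have "snd c' \<noteq> snd c"
      using c c' by (auto simp: max_cells_def) (metis linorder_neqE_nat)
    then consider "snd c' < snd c" | "snd c < snd c'" by linarith
    then show ?thesis
    proof cases
      case 1
      then show ?thesis using b c' by (intro sum.neutral) auto
    next
      case 2
      then have nD: "(fst c, snd c') \<notin> D" using c by (auto simp: max_cells_def)
      have "polytab D (s(c' := ?n)) ?Z = 0" if "s \<in> std_fillings (D - {c'})" for s
      proof (rule polytab_eq_0[OF _ _ nD])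
        show "s(c' := ?n) \<in> fillings D" by (rule fillings_insert[OF D(2) c'D std_fillings_in_fillings[OF that]])
        show "?n \<in> column_entries D (s(c' := ?n)) (snd c')" by (simp add: col_insert[OF c'D])
      qed simp
      then show ?thesis by (intro sum.neutral) auto
    qed
  qed
  have "(\<Sum>t\<in>std_fillings D. b t * polytab D t ?Z) = (\<Sum>c'\<in>max_cells D. ?f c')"
    by (rule sum_std_fillings) (use D cD in auto)
  also have "\<dots> = ?f c"
    using sum.remove[OF finite_max_cells[OF D(2)] c, of ?f] zero by (simp add: sum.neutral)
  also have "\<dots> = (\<Sum>s\<in>std_fillings (D - {c}). b (s(c := card D)) * polytab (D - {c}) s X)"
    by (rule sum.cong[OF refl]) (simp only: polytab_remove_corner[where X = X, OF D(2) cD std_fillings_in_fillings X])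
  finally show ?thesis .
qed

text \<open>Two nested inductions: on the shape and, for a fixed shape, over the corners from left
  to right. The corners already treated provide the vanishing assumption of
  \<open>sum_polytab_corner\<close>.\<close>

lemma polytab_independent:
  assumes "downset D" "finite D" "\<And>X. (\<Sum>t\<in>std_fillings D. a t * polytab D t X) = 0" "t \<in> std_fillings D"
  shows "a t = 0"
  using assms
proof (induction "card D" arbitrary: D a t rule: less_induct)
  case less
  note D = less.prems(1,2) and z = less.prems(3)
  show ?case
  proof (cases "D = {}")
    case True
    have "column_stabiliser {} t = {id}" by (auto simp: column_stabiliser_def column_entries_def)
    then have "polytab {} t (rows_of {} t) = 1" by (simp add: polytab_def)
    then show ?thesis using z[of "rows_of {} t"] less.prems(4) True by (auto simp: std_fillings_empty)
  next
    case False
    have main: "\<forall>s\<in>std_fillings (D - {c}). a (s(c := card D)) = 0" if "c \<in> max_cells D" for c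
      using that
    proof (induction "snd c" arbitrary: c rule: less_induct)
      case (less c)
      have cD: "c \<in> D" using less.prems max_cells_subset by blast
      have "(\<Sum>s\<in>std_fillings (D - {c}). a (s(c := card D)) * polytab (D - {c}) s X) = 0" for X
      proof (cases "card D \<in> X (fst c)")
        case True
        then show ?thesis using polytab_remove_eq_0[OF D(2) cD std_fillings_in_fillings] by (intro sum.neutral) auto
      next
        case False
        show ?thesis
          using sum_polytab_corner[where X = X and b = a, OF D less.prems False] less.hyps z by auto
      qed
      moreover have "card (D - {c}) < card D" using D(2) cD by (meson card_Diff1_less)
      \<comment> \<open>The hypothesis cited here is the outer one, for the smaller shape; the inner
        one, for corners further left, has been used above.\<close>
      ultimately show ?case
        using \<open>\<And>D' a t. card D' < card D \<Longrightarrow> downset D' \<Longrightarrow> finite D' \<Longrightarrow>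
           (\<And>X. (\<Sum>t\<in>std_fillings D'. a t * polytab D' t X) = 0) \<Longrightarrow> t \<in> std_fillings D' \<Longrightarrow> a t = 0\<close>[of "D - {c}" "\<lambda>s. a (s(c := card D))"]
          downset_remove[OF D(1) less.prems] D(2) by blast
    qed
    obtain c T' where "c \<in> max_cells D" "T' \<in> std_fillings (D - {c})" "t = T'(c := card D)"
      by (rule std_fillings_remove_max[OF D(2) False less.prems(4)])
    then show ?thesis using main by blast
  qed
qed

lemma inj_on_polytab:
  assumes "downset D" "finite D" shows "inj_on (polytab D) (std_fillings D)"
proof (rule inj_onI, rule ccontr)
  fix u v assume uv: "u \<in> std_fillings D" "v \<in> std_fillings D" "polytab D u = polytab D v" "u \<noteq> v"
  let ?a = "\<lambda>t. if t = u then 1 else if t = v then - 1 else (0::complex)"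
  have fin: "finite (std_fillings D)" by (rule finite_std_fillings[OF assms(2)])
  have "(\<Sum>t\<in>std_fillings D. ?a t * polytab D t X) = 0" for X
  proof -
    have "(\<Sum>t\<in>std_fillings D. ?a t * polytab D t X) = (\<Sum>t\<in>{u, v}. ?a t * polytab D t X)"
      by (rule sum.mono_neutral_right[OF fin]) (use uv in auto)
    then show ?thesis using uv by simp
  qed
  then have "?a u = 0" using polytab_independent[OF assms, of ?a u] uv by blast
  then show False by simp
qed


text \<open>These are the entries of the representation matrices in the standard basis: the column
  of \<open>\<sigma>\<close> at \<open>t\<close> is \<open>std_coeff D (\<sigma> \<circ> t)\<close>.
  The choice is determined only on \<open>std_fillings D\<close>, and only for downsets and fillings
  is an expansion known to exist.\<close>

definition std_coeff :: "(nat \<times> nat) set \<Rightarrow> (nat \<times> nat \<Rightarrow> nat) \<Rightarrow> (nat \<times> nat \<Rightarrow> nat) \<Rightarrow> complex" where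
  "std_coeff D t = (SOME a. \<forall>X. polytab D t X = (\<Sum>u\<in>std_fillings D. a u * polytab D u X))"

lemma span_polytab_image:
  assumes D: "downset D" "finite D" and S: "S \<subseteq> std_fillings D" and v: "v \<in> cfun.span (polytab D ` S)"
  shows "\<exists>a. (\<forall>X. v X = (\<Sum>u\<in>std_fillings D. a u * polytab D u X)) \<and> (\<forall>u. u \<notin> S \<longrightarrow> a u = 0)"
proof -
  have fin: "finite (std_fillings D)" by (rule finite_std_fillings[OF D(2)])
  have finS: "finite S" using S fin finite_subset by blast
  have inj: "inj_on (polytab D) S" using inj_on_polytab[OF D] S inj_on_subset by blast
  obtain w where w: "v = (\<Sum>b\<in>polytab D ` S. cscale (w b) b)"
    using v cfun.span_finite[of "polytab D ` S"] finS by auto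
  have "v X = (\<Sum>u\<in>S. w (polytab D u) * polytab D u X)" for X
    unfolding w sum_fun_apply by (simp add: sum.reindex[OF inj] cscale_def)
  also have "(\<Sum>u\<in>S. w (polytab D u) * polytab D u X) = (\<Sum>u\<in>std_fillings D. (if u \<in> S then w (polytab D u) else 0) * polytab D u X)" for X
    using S by (intro sum.mono_neutral_cong_left[OF fin]) auto
  finally show ?thesis by (intro exI[of _ "\<lambda>u. if u \<in> S then w (polytab D u) else 0"]) simp
qed

lemma std_coeff_unique:
  assumes D: "downset D" "finite D"
    and a: "\<And>X. polytab D t X = (\<Sum>u\<in>std_fillings D. a u * polytab D u X)" and u: "u \<in> std_fillings D"
  shows "std_coeff D t u = a u"
proof -
  have "\<exists>a. \<forall>X. polytab D t X = (\<Sum>u\<in>std_fillings D. a u * polytab D u X)"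
    by (rule exI[of _ a], rule allI, rule a)
  then have "\<forall>X. polytab D t X = (\<Sum>u\<in>std_fillings D. std_coeff D t u * polytab D u X)"
    unfolding std_coeff_def by (rule someI_ex)
  then have "(\<Sum>u\<in>std_fillings D. (std_coeff D t u - a u) * polytab D u X) = 0" for X
    using a[of X] by (simp add: left_diff_distrib sum_subtractf)
  then have "std_coeff D t u - a u = 0"
    using polytab_independent[OF D, of "\<lambda>u. std_coeff D t u - a u"] u by blast
  then show ?thesis by simp
qed

lemma polytab_eq_std_coeff:
  assumes D: "downset D" "finite D" and t: "t \<in> fillings D"
  shows "polytab D t X = (\<Sum>u\<in>std_fillings D. std_coeff D t u * polytab D u X)"
proof -
  have "\<exists>a. \<forall>X. polytab D t X = (\<Sum>u\<in>std_fillings D. a u * polytab D u X)"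
    using span_polytab_image[OF D order.refl polytab_span[OF D t]] by (elim exE conjE exI)
  then have "\<forall>X. polytab D t X = (\<Sum>u\<in>std_fillings D. std_coeff D t u * polytab D u X)"
    unfolding std_coeff_def by (rule someI_ex)
  then show ?thesis by (rule spec)
qed

text \<open>Block triangularity: the column of the largest entry filters the module, and
  straightening respects this filtration.\<close>

lemma std_coeff_eq_0:
  assumes D: "downset D" "finite D" and t: "t \<in> fillings D" "card D \<in> column_entries D t j"
    and u: "u \<in> std_fillings D" "card D \<in> column_entries D u j'" "j' < j"
  shows "std_coeff D t u = 0"
proof -
  let ?S = "{u \<in> std_fillings D. \<exists>j'\<ge>j. card D \<in> column_entries D u j'}"
  have "?S \<subseteq> std_fillings D" by blast
  from span_polytab_image[OF D this polytab_column_span[OF D t]] obtain a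
    where a: "\<forall>X. polytab D t X = (\<Sum>u\<in>std_fillings D. a u * polytab D u X)"
      "\<forall>u. u \<notin> ?S \<longrightarrow> a u = 0"
    by (elim exE conjE)
  have "u \<notin> ?S"
  proof
    assume "u \<in> ?S"
    then obtain l where l: "j \<le> l" "card D \<in> column_entries D u l" by blast
    then show False using col_disjoint[OF std_fillings_in_fillings[OF u(1)], of l j'] u by auto
  qed
  then show ?thesis using std_coeff_unique[OF D spec[OF a(1)] u(1)] a(2) by simp
qed

text \<open>The diagonal blocks of the filtration are the Specht modules of the smaller shapes.
  Evaluating the expansion at tabloids with the largest entry in the row of \<open>c\<close>
  isolates the block of \<open>c\<close>; the blocks further left vanish by triangularity.\<close>

lemma std_coeff_remove:
  assumes D: "downset D" "finite D" and c: "c \<in> max_cells D"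
    and s: "s \<in> fillings (D - {c})" and s': "s' \<in> std_fillings (D - {c})"
  shows "std_coeff D (s(c := card D)) (s'(c := card D)) = std_coeff (D - {c}) s s'"
proof -
  have cD: "c \<in> D" using c max_cells_subset by blast
  let ?t = "s(c := card D)"
  have t: "?t \<in> fillings D" by (rule fillings_insert[OF D(2) cD s])
  have nc: "card D \<in> column_entries D ?t (snd c)" by (simp add: col_insert[OF cD])
  have "polytab (D - {c}) s X = (\<Sum>s'\<in>std_fillings (D - {c}). std_coeff D ?t (s'(c := card D)) * polytab (D - {c}) s' X)" for X
  proof (cases "card D \<in> X (fst c)")
    case True
    then have "polytab (D - {c}) s' X = 0" if "s' \<in> fillings (D - {c})" for s'
      using polytab_remove_eq_0[OF D(2) cD that] by blast
    then show ?thesis using s std_fillings_in_fillings by (auto intro!: sum.neutral)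
  next
    case False
    have "std_coeff D ?t (u(c' := card D)) = 0"
      if c': "c' \<in> max_cells D" "snd c' < snd c" "u \<in> std_fillings (D - {c'})" for c' u
    proof (rule std_coeff_eq_0[OF D t nc _ _ c'(2)])
      have c'D: "c' \<in> D" using c' max_cells_subset by blast
      show "u(c' := card D) \<in> std_fillings D" by (rule std_fillings_insert_max[OF D(2) c'(1,3)])
      show "card D \<in> column_entries D (u(c' := card D)) (snd c')" by (simp add: col_insert[OF c'D])
    qed
    then show ?thesis
      using sum_polytab_corner[where X = X and b = "std_coeff D ?t", OF D c False] polytab_eq_std_coeff[OF D t]
        polytab_remove_corner[where X = X, OF D(2) cD s False] by auto
  qed
  then show ?thesis
    using std_coeff_unique[OF downset_remove[OF D(1) c] finite_Diff[OF D(2)], of s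
        "\<lambda>s'. std_coeff D ?t (s'(c := card D))"] s' by auto
qed

section \<open>Traces in the standard basis and the branching rule\<close>

definition specht_char :: "(nat \<times> nat) set \<Rightarrow> (nat \<Rightarrow> nat) \<Rightarrow> complex" where
  "specht_char D \<sigma> = (\<Sum>t\<in>std_fillings D. std_coeff D (\<sigma> \<circ> t) t)"

text \<open>A permutation that fixes the largest entry keeps it in its corner, so the trace is the
  sum over the diagonal blocks; no invariant complement is involved.\<close>

lemma specht_char_branching:
  assumes D: "downset D" "finite D" and \<sigma>: "\<sigma> permutes {1..card D - 1}" and ne: "D \<noteq> {}"
  shows "specht_char D \<sigma> = (\<Sum>c\<in>max_cells D. specht_char (D - {c}) \<sigma>)"
proof -
  have "card D > 0" using D ne card_gt_0_iff by blast
  then have nin: "card D \<notin> {1..card D - 1}" by auto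
  have "std_coeff D (\<sigma> \<circ> s(c := card D)) (s(c := card D)) = std_coeff (D - {c}) (\<sigma> \<circ> s) s"
    if c: "c \<in> max_cells D" and s: "s \<in> std_fillings (D - {c})" for c s
  proof -
    have cD: "c \<in> D" using c max_cells_subset by blast
    have "\<sigma> \<circ> s \<in> fillings (D - {c})"
      by (rule fillings_comp[OF std_fillings_in_fillings[OF s]]) (use \<sigma> cD in simp)
    then show ?thesis
      unfolding comp_upd_permutes[OF \<sigma> nin, symmetric] by (rule std_coeff_remove[OF D c _ s])
  qed
  then show ?thesis
    unfolding specht_char_def by (subst sum_std_fillings[OF D(2) ne]) (auto intro!: sum.cong)
qed

text \<open>Multiplicativity of the matrices. A permutation acts by substitution in the argument
  \<open>X\<close>, hence linearly on the expansion of \<open>t\<close>.\<close>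

lemma std_coeff_mult:
  assumes D: "downset D" "finite D" and t: "t \<in> fillings D"
    and \<sigma>: "\<sigma> permutes {1..card D}" and w: "w \<in> std_fillings D"
  shows "std_coeff D (\<sigma> \<circ> t) w = (\<Sum>u\<in>std_fillings D. std_coeff D t u * std_coeff D (\<sigma> \<circ> u) w)"
proof (rule std_coeff_unique[OF D _ w])
  fix X
  have act: "polytab D (\<sigma> \<circ> u) X = polytab D u (\<lambda>i. inv \<sigma> ` X i)" if "u \<in> fillings D" for u
    using perm_act_polytab[OF that \<sigma>] by (simp add: perm_act_def fun_eq_iff)
  have "polytab D (\<sigma> \<circ> t) X = (\<Sum>u\<in>std_fillings D. std_coeff D t u * polytab D (\<sigma> \<circ> u) X)"
    unfolding act[OF t] polytab_eq_std_coeff[OF D t]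
    by (rule sum.cong[OF refl]) (simp only: act[OF std_fillings_in_fillings])
  also have "\<dots> = (\<Sum>u\<in>std_fillings D. std_coeff D t u * (\<Sum>w\<in>std_fillings D. std_coeff D (\<sigma> \<circ> u) w * polytab D w X))"
    by (rule sum.cong[OF refl]) (simp only: polytab_eq_std_coeff[OF D fillings_comp[OF std_fillings_in_fillings \<sigma>]])
  also have "\<dots> = (\<Sum>w\<in>std_fillings D. (\<Sum>u\<in>std_fillings D. std_coeff D t u * std_coeff D (\<sigma> \<circ> u) w) * polytab D w X)"
    unfolding sum_distrib_left sum_distrib_right by (subst sum.swap) (simp add: mult.assoc)
  finally show "polytab D (\<sigma> \<circ> t) X = (\<Sum>w\<in>std_fillings D. (\<Sum>u\<in>std_fillings D. std_coeff D t u * std_coeff D (\<sigma> \<circ> u) w) * polytab D w X)" .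
qed

lemma specht_char_comm:
  assumes D: "downset D" "finite D" and \<sigma>: "\<sigma> permutes {1..card D}" and \<tau>: "\<tau> permutes {1..card D}"
  shows "specht_char D (\<sigma> \<circ> \<tau>) = specht_char D (\<tau> \<circ> \<sigma>)"
proof -
  have *: "specht_char D (\<sigma> \<circ> \<tau>) = (\<Sum>t\<in>std_fillings D. \<Sum>u\<in>std_fillings D. std_coeff D (\<tau> \<circ> t) u * std_coeff D (\<sigma> \<circ> u) t)"
    if "\<sigma> permutes {1..card D}" "\<tau> permutes {1..card D}" for \<sigma> \<tau>
    unfolding specht_char_def comp_assoc
    by (rule sum.cong[OF refl]) (simp only: std_coeff_mult[OF D fillings_comp[OF std_fillings_in_fillings that(2)] that(1)])
  show ?thesis
    unfolding *[OF \<sigma> \<tau>] *[OF \<tau> \<sigma>] by (subst sum.swap) (simp add: mult.commute)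
qed

lemma specht_char_conj:
  assumes D: "downset D" "finite D" and \<sigma>: "\<sigma> permutes {1..card D}" and \<tau>: "\<tau> permutes {1..card D}"
  shows "specht_char D (\<sigma> \<circ> \<tau> \<circ> inv \<sigma>) = specht_char D \<tau>"
proof -
  have "inv \<sigma> \<circ> (\<sigma> \<circ> \<tau>) = \<tau>" using permutes_inverses(2)[OF \<sigma>] by (auto simp: fun_eq_iff)
  then show ?thesis
    using specht_char_comm[OF D permutes_compose[OF \<tau> \<sigma>] permutes_inv[OF \<sigma>]] by simp
qed

section \<open>Traces and the class sum of transpositions\<close>

text \<open>\<open>subspace_trace\<close> selects some basis, which has to be compared with the
  standard one. Expanding \<open>b\<close> in \<open>C\<close> and \<open>f c\<close> in
  \<open>B\<close> gives the double sum of a trace of a product of two matrices, which may be taken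
  in either order.\<close>

lemma trace_basis_invariant:
  assumes B: "cfun.independent B" "finite B" and C: "cfun.independent C" "finite C"
    and span: "cfun.span B = cfun.span C"
    and add: "\<And>u v. f (u + v) = f u + f v" and scale: "\<And>c v. f (cscale c v) = cscale c (f v)"
    and inv: "\<And>v. v \<in> C \<Longrightarrow> f v \<in> cfun.span C"
  shows "(\<Sum>b\<in>B. cfun.representation B (f b) b) = (\<Sum>c\<in>C. cfun.representation C (f c) c)"
proof -
  have f0: "f 0 = 0" using scale[of 0 0] by (simp add: cscale_def zero_fun_def)
  have fsum: "f (\<Sum>i\<in>I. g i) = (\<Sum>i\<in>I. f (g i))" for I :: "('a \<Rightarrow> complex) set" and g
    by (induction I rule: infinite_finite_induct) (simp_all only: sum.infinite sum.empty sum.insert f0 add not_False_eq_True)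
  have 1: "cfun.representation B (f b) b =
      (\<Sum>c\<in>C. cfun.representation C b c * cfun.representation B (f c) b)" if "b \<in> B" for b
  proof -
    have bC: "b \<in> cfun.span C" using that span cfun.span_base by blast
    have "f b = f (\<Sum>c\<in>C. cscale (cfun.representation C b c) c)"
      using cfun.sum_representation_eq[OF C(1) bC C(2)] by simp
    also have "\<dots> = (\<Sum>c\<in>C. cscale (cfun.representation C b c) (f c))"
      by (simp add: fsum scale)
    finally have fb: "f b = \<dots>" .
    have fc: "f c \<in> cfun.span B" if "c \<in> C" for c using inv[OF that] span by simp
    show ?thesis unfolding fb
      by (subst cfun.representation_sum[OF B(1)])
        (auto simp: cfun.representation_scale[OF B(1)] fc intro: cfun.span_scale)
  qed
  have 2: "(\<Sum>b\<in>B. cfun.representation B (f c) b * cfun.representation C b c) = cfun.representation C (f c) c"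
    if "c \<in> C" for c
  proof -
    have fc: "f c \<in> cfun.span B" using inv[OF that] span by simp
    have bC: "b \<in> cfun.span C" if "b \<in> B" for b using that span cfun.span_base by blast
    have "f c = (\<Sum>b\<in>B. cscale (cfun.representation B (f c) b) b)"
      using cfun.sum_representation_eq[OF B(1) fc B(2)] by simp
    then have "cfun.representation C (f c) = cfun.representation C (\<Sum>b\<in>B. cscale (cfun.representation B (f c) b) b)"
      by simp
    also have "\<dots> = (\<lambda>x. \<Sum>b\<in>B. cfun.representation B (f c) b * cfun.representation C b x)"
      by (subst cfun.representation_sum[OF C(1)])
        (auto simp: cfun.representation_scale[OF C(1)] bC intro: cfun.span_scale)
    finally show ?thesis by simp
  qed
  have "(\<Sum>b\<in>B. cfun.representation B (f b) b) =
      (\<Sum>b\<in>B. \<Sum>c\<in>C. cfun.representation C b c * cfun.representation B (f c) b)"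
    by (rule sum.cong[OF refl 1])
  also have "\<dots> = (\<Sum>c\<in>C. \<Sum>b\<in>B. cfun.representation B (f c) b * cfun.representation C b c)"
    by (subst sum.swap) (simp add: mult.commute)
  also have "\<dots> = (\<Sum>c\<in>C. cfun.representation C (f c) c)"
    by (rule sum.cong[OF refl 2])
  finally show ?thesis .
qed

lemma independent_polytab:
  assumes D: "downset D" "finite D"
  shows "cfun.independent (polytab D ` std_fillings D)"
proof (rule cfun.independent_if_scalars_zero)
  show "finite (polytab D ` std_fillings D)" using finite_std_fillings[OF D(2)] by simp
  fix w x assume z: "(\<Sum>x\<in>polytab D ` std_fillings D. cscale (w x) x) = 0" and x: "x \<in> polytab D ` std_fillings D"
  obtain t where t: "t \<in> std_fillings D" "x = polytab D t" using x by blast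
  have "(\<Sum>u\<in>std_fillings D. w (polytab D u) * polytab D u X) = 0" for X
    using fun_cong[OF z, of X] by (simp add: sum.reindex[OF inj_on_polytab[OF D]] sum_fun_apply cscale_def)
  then show "w x = 0" using polytab_independent[OF D, of "\<lambda>u. w (polytab D u)"] t by simp
qed

lemma subspace_trace_polytab:
  assumes D: "downset D" "finite D" and \<sigma>: "\<sigma> permutes {1..card D}"
  shows "subspace_trace (cfun.span (polytab D ` fillings D)) (perm_act \<sigma>) = specht_char D \<sigma>"
proof -
  let ?C = "polytab D ` std_fillings D"
  have C: "cfun.independent ?C" "finite ?C"
    using independent_polytab[OF D] finite_std_fillings[OF D(2)] by auto
  have span: "cfun.span (polytab D ` fillings D) = cfun.span ?C"
  proof (rule subset_antisym)
    show "cfun.span (polytab D ` fillings D) \<subseteq> cfun.span ?C"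
      by (intro cfun.span_minimal cfun.subspace_span image_subsetI polytab_span[OF D])
    show "cfun.span ?C \<subseteq> cfun.span (polytab D ` fillings D)"
      by (intro cfun.span_mono image_mono subsetI std_fillings_in_fillings)
  qed
  define B where "B = (SOME B. cfun.independent B \<and> cfun.span B = cfun.span (polytab D ` fillings D))"
  have "cfun.independent B \<and> cfun.span B = cfun.span (polytab D ` fillings D)"
    unfolding B_def by (rule someI[of _ ?C]) (use C span in simp)
  then have B: "cfun.independent B" "cfun.span B = cfun.span ?C" using span by auto
  \<comment> \<open>Nothing in the choice of \<open>B\<close> makes it finite, and a sum over an
    infinite set would be 0; finiteness follows as \<open>B\<close> is independent inside the span
    of a finite set.\<close>
  have finB: "finite B"
    using cfun.independent_span_bound[OF C(2) B(1)] B(2) cfun.span_superset[of B] by auto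
  have act: "perm_act \<sigma> (polytab D t) = polytab D (\<sigma> \<circ> t)" if "t \<in> std_fillings D" for t
    by (rule perm_act_polytab[OF std_fillings_in_fillings[OF that] \<sigma>])
  have "subspace_trace (cfun.span (polytab D ` fillings D)) (perm_act \<sigma>)
      = (\<Sum>b\<in>B. cfun.representation B (perm_act \<sigma> b) b)"
    unfolding subspace_trace_def B_def[symmetric] by simp
  also have "\<dots> = (\<Sum>c\<in>?C. cfun.representation ?C (perm_act \<sigma> c) c)"
  proof (rule trace_basis_invariant[OF B(1) finB C B(2)])
    fix v assume "v \<in> ?C"
    then show "perm_act \<sigma> v \<in> cfun.span ?C"
      using act polytab_span[OF D fillings_comp[OF std_fillings_in_fillings \<sigma>]] by auto
  qed (auto simp: perm_act_def cscale_def fun_eq_iff)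
  also have "\<dots> = (\<Sum>t\<in>std_fillings D. cfun.representation ?C (polytab D (\<sigma> \<circ> t)) (polytab D t))"
    by (simp add: sum.reindex[OF inj_on_polytab[OF D]] act)
  also have "\<dots> = specht_char D \<sigma>"
    unfolding specht_char_def
  proof (rule sum.cong[OF refl])
    fix t assume t: "t \<in> std_fillings D"
    let ?v = "polytab D (\<sigma> \<circ> t)"
    have v: "?v \<in> cfun.span ?C" by (rule polytab_span[OF D fillings_comp[OF std_fillings_in_fillings[OF t] \<sigma>]])
    have "?v X = (\<Sum>u\<in>std_fillings D. cfun.representation ?C ?v (polytab D u) * polytab D u X)" for X
    proof -
      have "?v X = (\<Sum>b\<in>?C. cscale (cfun.representation ?C ?v b) b) X"
        using cfun.sum_representation_eq[OF C(1) v C(2) order.refl] by simp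
      then show ?thesis
        by (simp add: sum.reindex[OF inj_on_polytab[OF D]] sum_fun_apply cscale_def)
    qed
    then show "cfun.representation ?C ?v (polytab D t) = std_coeff D (\<sigma> \<circ> t) t"
      using std_coeff_unique[OF D _ t, of "\<sigma> \<circ> t" "\<lambda>u. cfun.representation ?C ?v (polytab D u)"] by simp
  qed
  finally show ?thesis .
qed

section \<open>Contents and the sum of all transpositions\<close>

definition content_sum :: "(nat \<times> nat) set \<Rightarrow> complex" where
  "content_sum D = (\<Sum>(i, j)\<in>D. of_nat j - of_nat i)"

text \<open>The exchange relation modulo zero, read off in coefficients. Column \<open>j'\<close> is
  to the left of column \<open>j\<close> and so at least as long, as that relation requires.\<close>

lemma std_coeff_exchange:
  assumes D: "downset D" "finite D" and t: "t \<in> fillings D" and b: "b \<in> column_entries D t j" and jj: "j' < j"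
    and u: "u \<in> std_fillings D"
  shows "(\<Sum>x\<in>column_entries D t j'. std_coeff D (transpose b x \<circ> t) u) = std_coeff D t u"
proof -
  have "polytab D t - (\<Sum>x\<in>column_entries D t j'. polytab D (transpose b x \<circ> t)) \<in> {0}"
    by (rule garnir_exchange[OF garnir_mod_polytab[OF D] cfun.subspace_single_0 t _ b])
      (use jj card_col_antimono[OF D t] in auto)
  then have e: "polytab D t = (\<Sum>x\<in>column_entries D t j'. polytab D (transpose b x \<circ> t))" by simp
  have tt: "transpose b x \<circ> t \<in> fillings D" if "x \<in> column_entries D t j'" for x
    using that b by (intro fillings_comp[OF t] permutes_swap_id subsetD[OF col_subset[OF t]])
  have "std_coeff D t u = (\<Sum>x\<in>column_entries D t j'. std_coeff D (transpose b x \<circ> t) u)"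
  proof (rule std_coeff_unique[OF D _ u])
    fix X
    have "polytab D t X = (\<Sum>x\<in>column_entries D t j'. polytab D (transpose b x \<circ> t) X)"
      by (subst e) (rule sum_fun_apply)
    also have "\<dots> = (\<Sum>x\<in>column_entries D t j'. \<Sum>u\<in>std_fillings D. std_coeff D (transpose b x \<circ> t) u * polytab D u X)"
      by (rule sum.cong[OF refl], rule polytab_eq_std_coeff[OF D tt])
    also have "\<dots> = (\<Sum>u\<in>std_fillings D. (\<Sum>x\<in>column_entries D t j'. std_coeff D (transpose b x \<circ> t) u) * polytab D u X)"
      by (subst sum.swap) (simp only: sum_distrib_right)
    finally show "polytab D t X = \<dots>" .
  qed
  then show ?thesis by simp
qed

lemma std_coeff_transpose_column:
  assumes D: "downset D" "finite D" and t: "t \<in> fillings D"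
    and ab: "a \<in> column_entries D t j" "b \<in> column_entries D t j" "a \<noteq> b" and u: "u \<in> std_fillings D"
  shows "std_coeff D (transpose a b \<circ> t) u = - std_coeff D t u"
proof (rule std_coeff_unique[OF D _ u])
  fix X
  have "transpose a b \<in> column_stabiliser D t"
    using ab by (intro column_stabiliser_permutes_col[OF t, of _ "{a, b}" j] permutes_swap_id) auto
  then have "polytab D (transpose a b \<circ> t) X = - polytab D t X"
    using ab by (simp add: polytab_column_stabiliser[OF t] sign_swap_id cscale_def)
  then show "polytab D (transpose a b \<circ> t) X = (\<Sum>u\<in>std_fillings D. - std_coeff D t u * polytab D u X)"
    using polytab_eq_std_coeff[OF D t, of X] by (simp add: sum_negf)
qed

lemma std_coeff_self:
  assumes D: "downset D" "finite D" and t: "t \<in> std_fillings D"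
  shows "std_coeff D t t = 1"
proof -
  have "std_coeff D t t = (if t = t then 1 else 0)"
    by (rule std_coeff_unique[OF D _ t, of t "\<lambda>u. if u = t then 1 else 0"])
      (use t finite_std_fillings[OF D(2)] in \<open>simp add: if_distrib[of "\<lambda>x. x * _"] cong: if_cong\<close>)
  then show ?thesis by simp
qed

text \<open>In the sum over all \<open>p\<close> before \<open>q\<close> each column to the left of \<open>q\<close> contributes 1 by the exchange
  relation and each cell above \<open>q\<close> contributes -1, which adds up to the content of \<open>q\<close>.\<close>

definition cell_less :: "nat \<times> nat \<Rightarrow> nat \<times> nat \<Rightarrow> bool" where
  "cell_less p q \<longleftrightarrow> snd p < snd q \<or> snd p = snd q \<and> fst p < fst q"

lemma sum_std_coeff_less:
  assumes D: "downset D" "finite D" and t: "t \<in> std_fillings D" and q: "q \<in> D"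
  shows "(\<Sum>p | p \<in> D \<and> cell_less p q. std_coeff D (transpose (t p) (t q) \<circ> t) t)
    = of_nat (snd q) - of_nat (fst q)"
proof -
  let ?h = "\<lambda>x. std_coeff D (transpose x (t q) \<circ> t) t"
  have tt: "t \<in> fillings D" by (rule std_fillings_in_fillings[OF t])
  have inj: "inj_on t D" using tt by (simp add: fillings_def bij_betw_def)
  have qc: "t q \<in> column_entries D t (snd q)" using q by (auto simp: column_entries_def) (metis prod.collapse)
  have split: "{p. p \<in> D \<and> cell_less p q} = {p \<in> D. snd p < snd q} \<union> {p \<in> D. snd p = snd q \<and> fst p < fst q}"
    by (auto simp: cell_less_def)
  \<comment> \<open>The order on cells runs through whole columns, so every column to the left of
    \<open>q\<close> occurs completely, and only for a complete column is there an exchange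
    relation.\<close>
  have A: "(\<Sum>p\<in>{p \<in> D. snd p < snd q}. ?h (t p)) = of_nat (snd q)"
  proof -
    have "(\<Sum>p\<in>{p \<in> D. snd p < snd q}. ?h (t p)) =
        (\<Sum>j'\<in>{..<snd q}. \<Sum>p\<in>{p \<in> {p \<in> D. snd p < snd q}. snd p = j'}. ?h (t p))"
      by (rule sum.group[symmetric]) (use D in auto)
    also have "\<dots> = (\<Sum>j'\<in>{..<snd q}. 1)"
    proof (rule sum.cong[OF refl])
      fix j' assume j': "j' \<in> {..<snd q}"
      have im: "t ` {p \<in> {p \<in> D. snd p < snd q}. snd p = j'} = column_entries D t j'"
        using j' by (force simp: column_entries_def)
      have "(\<Sum>p\<in>{p \<in> {p \<in> D. snd p < snd q}. snd p = j'}. ?h (t p)) = (\<Sum>x\<in>column_entries D t j'. ?h x)"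
        unfolding im[symmetric] by (rule sum.reindex_cong[OF _ refl refl, symmetric]) (rule inj_on_subset[OF inj], blast)
      also have "\<dots> = std_coeff D t t"
        using std_coeff_exchange[OF D tt qc _ t, of j'] j' by (simp add: transpose_commute)
      finally show "(\<Sum>p\<in>{p \<in> {p \<in> D. snd p < snd q}. snd p = j'}. ?h (t p)) = 1"
        by (simp add: std_coeff_self[OF D t])
    qed
    finally show ?thesis by simp
  qed
  have "{p \<in> D. snd p = snd q \<and> fst p < fst q} = (\<lambda>i. (i, snd q)) ` {..<fst q}"
    using downsetD[OF D(1), of "fst q" "snd q"] q by force
  then have cardB: "card {p \<in> D. snd p = snd q \<and> fst p < fst q} = fst q"
    by (simp add: card_image inj_on_def)
  have "?h (t p) = - 1" if "p \<in> {p \<in> D. snd p = snd q \<and> fst p < fst q}" for p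
  proof -
    have p: "p \<in> D" "p \<noteq> q" "snd p = snd q" using that by auto
    have "t p \<in> column_entries D t (snd q)" using p by (auto simp: column_entries_def) (metis prod.collapse)
    moreover have "t p \<noteq> t q" using inj_onD[OF inj, of p q] p q by blast
    ultimately show ?thesis using std_coeff_transpose_column[OF D tt _ qc _ t] std_coeff_self[OF D t] by simp
  qed
  then have B: "(\<Sum>p\<in>{p \<in> D. snd p = snd q \<and> fst p < fst q}. ?h (t p)) = - of_nat (fst q)"
    by (simp add: cardB)
  show ?thesis unfolding split
    by (subst sum.union_disjoint) (use D A B in auto)
qed

lemma specht_char_transpose_eq:
  assumes D: "downset D" "finite D" and ab: "a \<in> {1..card D}" "b \<in> {1..card D}" "a \<noteq> b"
    and cd: "c \<in> {1..card D}" "d \<in> {1..card D}" "c \<noteq> d"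
  shows "specht_char D (transpose a b) = specht_char D (transpose c d)"
proof -
  \<comment> \<open>\<open>transpose a c\<close> takes \<open>c\<close> to \<open>a\<close> and
    \<open>d\<close> to \<open>d'\<close>; then \<open>transpose d' b\<close> fixes \<open>a\<close>
    and takes \<open>d'\<close> to \<open>b\<close>. So \<open>\<sigma>\<close> maps the pair
    \<open>c\<close>, \<open>d\<close> to \<open>a\<close>, \<open>b\<close>.\<close>
  define d' where "d' = transpose a c d"
  have d': "d' \<in> {1..card D}" "d' \<noteq> a" using ab cd by (auto simp: d'_def transpose_def)
  define \<sigma> where "\<sigma> = transpose d' b \<circ> transpose a c"
  have \<sigma>: "\<sigma> permutes {1..card D}"
    unfolding \<sigma>_def using ab cd d' by (intro permutes_compose permutes_swap_id)
  have s: "\<sigma> c = a" "\<sigma> d = b"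
    using ab d' by (auto simp: \<sigma>_def d'_def[symmetric] transpose_apply_other)
  have "\<sigma> \<circ> transpose c d = transpose a b \<circ> \<sigma>"
    using transpose_comp_eq[of \<sigma>] permutes_bij[OF \<sigma>] s permutes_inj[OF \<sigma>]
    by (auto simp: fun_eq_iff transpose_def inj_eq)
  then have "\<sigma> \<circ> transpose c d \<circ> inv \<sigma> = transpose a b"
    using permutes_inverses(1)[OF \<sigma>] by (simp add: fun_eq_iff)
  then show ?thesis
    using specht_char_conj[OF D \<sigma> permutes_swap_id[OF cd(1,2)]] by simp
qed

text \<open>All transpositions have the same trace, so the left side is the trace of their sum over
  ordered pairs of distinct entries. For each standard \<open>t\<close> such a pair is a pair of
  cells, comparable by \<open>cell_less\<close> in exactly one direction. Each direction contributes
  the content sum to the diagonal entry at \<open>t\<close>, whence the factor 2.\<close>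

lemma class_sum:
  assumes D: "downset D" "finite D" and ab: "a \<in> {1..card D}" "b \<in> {1..card D}" "a \<noteq> b"
  shows "of_nat (card D * (card D - 1)) * specht_char D (transpose a b)
    = 2 * of_nat (card (std_fillings D)) * content_sum D"
proof -
  let ?n = "card D"
  let ?N = "{(x, y). x \<in> {1..?n} \<and> y \<in> {1..?n} \<and> x \<noteq> y}"
  let ?O = "{(p, q). p \<in> D \<and> q \<in> D \<and> cell_less p q}"
  let ?O' = "{(p, q). p \<in> D \<and> q \<in> D \<and> cell_less q p}"
  have finO: "finite ?O" "finite ?O'"
    by (rule finite_subset[of _ "D \<times> D"]; use D in force)+
  have N: "?N = {1..?n} \<times> {1..?n} - (\<lambda>x. (x, x)) ` {1..?n}" by auto
  have "card ?N = ?n * ?n - ?n"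
    unfolding N by (subst card_Diff_subset) (auto simp: card_image inj_on_def card_cartesian_product)
  then have cardN: "card ?N = ?n * (?n - 1)" by (simp add: diff_mult_distrib2)
  have inner: "(\<Sum>(x, y)\<in>?N. std_coeff D (transpose x y \<circ> t) t) = 2 * content_sum D"
    if t: "t \<in> std_fillings D" for t
  proof -
    let ?g = "\<lambda>(p, q). std_coeff D (transpose (t p) (t q) \<circ> t) t"
    have bij: "bij_betw t D {1..?n}" using t by (simp add: std_fillings_def)
    have inj: "inj_on t D" using bij by (simp add: bij_betw_def)
    have im: "?N = map_prod t t ` (?O \<union> ?O')"
    proof
      show "?N \<subseteq> map_prod t t ` (?O \<union> ?O')"
      proof
        fix z assume "z \<in> ?N"
        then obtain x y where xy: "z = (x, y)" "x \<in> t ` D" "y \<in> t ` D" "x \<noteq> y"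
          by (auto simp: bij_betw_imp_surj_on[OF bij])
        then obtain p q where pq: "z = (t p, t q)" "p \<in> D" "q \<in> D" "p \<noteq> q" by blast
        then have "cell_less p q \<or> cell_less q p"
          unfolding cell_less_def by (metis linorder_neqE_nat prod_eqI)
        then have "(p, q) \<in> ?O \<union> ?O'" using pq by simp
        then show "z \<in> map_prod t t ` (?O \<union> ?O')"
          by (rule rev_image_eqI) (simp add: pq)
      qed
      show "map_prod t t ` (?O \<union> ?O') \<subseteq> ?N"
      proof (rule image_subsetI)
        fix z assume z: "z \<in> ?O \<union> ?O'"
        obtain p q where pq: "z = (p, q)" by (cases z)
        then have D': "p \<in> D" "q \<in> D" "p \<noteq> q" using z by (auto simp: cell_less_def)
        then have "t p \<noteq> t q" using inj_onD[OF inj] by blast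
        moreover have "t p \<in> {1..?n}" "t q \<in> {1..?n}" using D' bij_betwE[OF bij] by blast+
        ultimately show "map_prod t t z \<in> ?N" by (simp add: pq)
      qed
    qed
    have "inj_on (map_prod t t) (?O \<union> ?O')"
      by (rule inj_on_subset[OF map_prod_inj_on[OF inj inj]]) auto
    then have "(\<Sum>(x, y)\<in>?N. std_coeff D (transpose x y \<circ> t) t) = (\<Sum>z\<in>?O \<union> ?O'. ?g z)"
      by (rule sum.reindex_cong[OF _ im]) (simp add: split_beta)
    also have "\<dots> = (\<Sum>z\<in>?O. ?g z) + (\<Sum>z\<in>?O'. ?g z)"
      by (rule sum.union_disjoint[OF finO]) (auto simp: cell_less_def)
    also have "(\<Sum>z\<in>?O'. ?g z) = (\<Sum>z\<in>?O. ?g z)"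
      by (rule sum.reindex_bij_witness[of _ prod.swap prod.swap]) (auto simp: transpose_commute)
    also have "(\<Sum>z\<in>?O. ?g z) = (\<Sum>q\<in>D. \<Sum>p | p \<in> D \<and> cell_less p q. ?g (p, q))"
    proof -
      have "(\<Sum>q\<in>D. \<Sum>p | p \<in> D \<and> cell_less p q. ?g (p, q)) =
          (\<Sum>(q, p)\<in>(SIGMA q:D. {p. p \<in> D \<and> cell_less p q}). ?g (p, q))"
        by (rule sum.Sigma) (use D in auto)
      also have "\<dots> = (\<Sum>z\<in>?O. ?g z)"
        by (rule sum.reindex_bij_witness[of _ prod.swap prod.swap]) auto
      finally show ?thesis by simp
    qed
    also have "\<dots> = content_sum D"
      unfolding content_sum_def
      by (rule sum.cong[OF refl]) (use sum_std_coeff_less[OF D t] in \<open>simp add: split_beta\<close>)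
    finally show ?thesis by (simp only: mult_2)
  qed
  have "(\<Sum>(x, y)\<in>?N. specht_char D (transpose x y)) = (\<Sum>z\<in>?N. specht_char D (transpose a b))"
    by (rule sum.cong[OF refl]) (use specht_char_transpose_eq[OF D _ _ _ ab] in auto)
  then have "of_nat (?n * (?n - 1)) * specht_char D (transpose a b) = (\<Sum>(x, y)\<in>?N. specht_char D (transpose x y))"
    by (simp only: sum_constant cardN)
  also have "\<dots> = (\<Sum>t\<in>std_fillings D. \<Sum>(x, y)\<in>?N. std_coeff D (transpose x y \<circ> t) t)"
    unfolding specht_char_def split_beta by (rule sum.swap)
  also have "\<dots> = 2 * of_nat (card (std_fillings D)) * content_sum D"
    by (simp only: inner sum.cong[OF refl inner] sum_constant mult_ac)
  finally show ?thesis .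
qed

section \<open>Adding a first row\<close>

definition skew_count :: "(nat \<times> nat) set \<Rightarrow> (nat \<times> nat) set \<Rightarrow> nat" where
  "skew_count D R = (if R \<subseteq> D then card (std_fillings (D - R)) else 0)"

text \<open>The complement of a downset is closed under going right and down, so no cell that
  prevents maximality is removed with \<open>R\<close>.\<close>

lemma max_cells_Diff:
  assumes "downset R"
  shows "max_cells (D - R) = max_cells D - R"
proof -
  have "(i', j') \<notin> R" if "(i, j) \<notin> R" "i \<le> i'" "j \<le> j'" for i j i' j'
    using that downsetD[OF assms] by blast
  then show ?thesis unfolding max_cells_def by (auto dest: less_imp_le)
qed

text \<open>Corners of \<open>D\<close> inside \<open>R\<close> contribute nothing, as
  \<open>R\<close> is then not contained in the rest. The strict inequality excludes
  \<open>R = D\<close>, where the count is 1 and all summands are 0.\<close>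

lemma skew_count_branching:
  assumes D: "finite D" and R: "downset R" "finite R" and c: "card R < card D"
  shows "skew_count D R = (\<Sum>c\<in>max_cells D. skew_count (D - {c}) R)"
proof (cases "R \<subseteq> D")
  case True
  have "D - R \<noteq> {}" using c True by auto
  then have "card (std_fillings (D - R)) = (\<Sum>c\<in>max_cells D - R. card (std_fillings (D - R - {c})))"
    using card_std_fillings[of "D - R"] D by (simp add: max_cells_Diff[OF R(1)])
  also have "\<dots> = (\<Sum>c\<in>max_cells D - R. skew_count (D - {c}) R)"
  proof (rule sum.cong[OF refl])
    fix c assume "c \<in> max_cells D - R"
    then have "R \<subseteq> D - {c}" "D - R - {c} = D - {c} - R" using True by auto
    then show "card (std_fillings (D - R - {c})) = skew_count (D - {c}) R" by (simp add: skew_count_def)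
  qed
  also have "\<dots> = (\<Sum>c\<in>max_cells D. skew_count (D - {c}) R)"
    by (rule sum.mono_neutral_left[OF finite_max_cells[OF D]]) (auto simp: skew_count_def)
  finally show ?thesis using True by (simp add: skew_count_def)
next
  case False
  then show ?thesis by (auto simp: skew_count_def intro!: sum.neutral)
qed

lemma skew_count_card_ge:
  assumes "finite D" "card D \<le> card R" "finite R"
  shows "skew_count D R = (if R = D then 1 else 0)"
proof -
  have "R = D" if "R \<subseteq> D" using card_seteq[OF assms(1) that assms(2)] .
  then show ?thesis by (auto simp: skew_count_def std_fillings_empty)
qed

section \<open>Shapes with a first row on top\<close>

definition stack :: "nat \<Rightarrow> (nat \<times> nat) set \<Rightarrow> (nat \<times> nat) set" where
  "stack m D = (\<lambda>j. (0, j)) ` {..<m} \<union> map_prod Suc id ` D"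

lemma finite_stack: "finite D \<Longrightarrow> finite (stack m D)"
  by (simp add: stack_def)

lemma stack_iff: "(i, j) \<in> stack m D \<longleftrightarrow> (case i of 0 \<Rightarrow> j < m | Suc i' \<Rightarrow> (i', j) \<in> D)"
  by (cases i) (force simp: stack_def)+

lemma card_stack:
  assumes "finite D" shows "card (stack m D) = m + card D"
proof -
  have "card ((\<lambda>j. (0::nat, j)) ` {..<m}) = m" by (simp add: card_image inj_on_def)
  moreover have "card (map_prod Suc id ` D) = card D" by (rule card_image) (auto simp: inj_on_def)
  moreover have "(\<lambda>j. (0, j)) ` {..<m} \<inter> map_prod Suc id ` D = {}" by auto
  ultimately show ?thesis unfolding stack_def using assms by (subst card_Un_disjoint) auto
qed

lemma downset_stack:
  assumes D: "downset D" and m: "\<And>i j. (i, j) \<in> D \<Longrightarrow> j < m"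
  shows "downset (stack m D)"
  unfolding downset_def
proof (intro allI impI)
  fix i j i' j' assume A: "(i, j) \<in> stack m D" "i' \<le> i" "j' \<le> j"
  show "(i', j') \<in> stack m D"
  proof (cases i')
    case 0
    have "j < m" using A(1) m by (cases i) (auto simp: stack_iff)
    then show ?thesis using 0 A(3) by (simp add: stack_iff)
  next
    case (Suc l)
    then obtain l' where "i = Suc l'" "l \<le> l'" using A(2) by (cases i) auto
    then show ?thesis using A Suc downsetD[OF D, of l' j l j'] by (simp add: stack_iff)
  qed
qed

text \<open>The first row is strictly longer than the second, so its end is a corner; the other
  corners are those of \<open>D\<close>, one row further down.\<close>

lemma max_cells_stack:
  assumes m: "\<And>i j. (i, j) \<in> D \<Longrightarrow> j < m"
  shows "max_cells (stack (Suc m) D) = insert (0, m) (map_prod Suc id ` max_cells D)"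
proof (rule set_eqI)
  fix x :: "nat \<times> nat" obtain i j where x: "x = (i, j)" by (cases x)
  show "x \<in> max_cells (stack (Suc m) D) \<longleftrightarrow> x \<in> insert (0, m) (map_prod Suc id ` max_cells D)"
  proof (cases i)
    case 0
    have "(0, j) \<in> max_cells (stack (Suc m) D) \<longleftrightarrow> j = m"
    proof
      assume A: "(0, j) \<in> max_cells (stack (Suc m) D)"
      then have "j < Suc m" "\<forall>j'>j. \<not> j' < Suc m" by (auto simp: max_cells_def stack_iff)
      then show "j = m" by (metis less_antisym lessI)
    next
      assume "j = m"
      then show "(0, j) \<in> max_cells (stack (Suc m) D)"
        using m by (auto simp: max_cells_def stack_iff split: nat.splits)
    qed
    then show ?thesis using x 0 by auto
  next
    case (Suc l)
    have "(Suc l, j) \<in> max_cells (stack (Suc m) D) \<longleftrightarrow> (l, j) \<in> max_cells D"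
    proof -
      have "(\<forall>i'>Suc l. (i', j) \<notin> stack (Suc m) D) \<longleftrightarrow> (\<forall>i'>l. (i', j) \<notin> D)"
        by (auto simp: stack_iff split: nat.splits)
      then show ?thesis by (simp add: max_cells_def stack_iff)
    qed
    moreover have "(Suc l, j) \<in> map_prod Suc id ` max_cells D \<longleftrightarrow> (l, j) \<in> max_cells D"
      by force
    ultimately show ?thesis using x Suc by simp
  qed
qed

lemma stack_remove:
  "stack (Suc m) D - {(0, m)} = stack m D"
  "stack m D - {map_prod Suc id c} = stack m (D - {c})"
proof -
  show "stack (Suc m) D - {(0, m)} = stack m D" by (auto simp: stack_def)
  have "map_prod Suc id ` (D - {c}) = map_prod Suc id ` D - {map_prod Suc id c}"
    by (subst inj_on_image_set_diff[of "map_prod Suc id" UNIV]) (auto simp: inj_on_def)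
  moreover have "map_prod Suc id c \<notin> (\<lambda>j. (0, j)) ` {..<m}" by (cases c) auto
  ultimately show "stack m D - {map_prod Suc id c} = stack m (D - {c})" by (simp add: stack_def Un_Diff)
qed

text \<open>Splitting off the corner of the first row is what turns branching into a difference
  equation. The function \<open>g\<close> is arbitrary so that dimensions and traces are treated
  alike.\<close>

lemma sum_max_cells_stack:
  assumes "finite D" and m: "\<And>i j. (i, j) \<in> D \<Longrightarrow> j < m"
  shows "(\<Sum>c\<in>max_cells (stack (Suc m) D). g (stack (Suc m) D - {c}))
    = g (stack m D) + (\<Sum>c\<in>max_cells D. g (stack (Suc m) (D - {c})))"
proof -
  have inj: "inj_on (map_prod Suc id) (max_cells D)" by (auto simp: inj_on_def)
  have "(0, m) \<notin> map_prod Suc id ` max_cells D" by auto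
  moreover have "max_cells (stack (Suc m) D) = insert (0, m) (map_prod Suc id ` max_cells D)"
    by (rule max_cells_stack) (rule m)
  ultimately show ?thesis
    using finite_max_cells[OF assms(1)] by (simp add: sum.reindex[OF inj] stack_remove)
qed

text \<open>The first row has the contents 0 to \<open>m - 1\<close>, and every cell of
  \<open>D\<close> loses 1 on being shifted down.\<close>

lemma content_sum_stack:
  assumes "finite D"
  shows "2 * content_sum (stack m D) = of_nat m * (of_nat m - 1) + 2 * content_sum D - 2 * of_nat (card D)"
proof -
  have 1: "2 * (\<Sum>(i, j)\<in>(\<lambda>j. (0::nat, j)) ` {..<m}. of_nat j - of_nat i) = of_nat m * (of_nat m - (1::complex))"
    by (subst sum.reindex) (auto simp: inj_on_def, induction m, auto simp: algebra_simps)
  have "(\<Sum>(i, j)\<in>map_prod Suc id ` D. of_nat j - of_nat i) = (\<Sum>x\<in>D. (case x of (i, j) \<Rightarrow> of_nat j - of_nat i) - (1::complex))"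
    by (subst sum.reindex) (auto simp: inj_on_def split_beta intro!: sum.cong)
  then have 2: "(\<Sum>(i, j)\<in>map_prod Suc id ` D. of_nat j - of_nat i) = content_sum D - of_nat (card D)"
    by (simp add: sum_subtractf content_sum_def)
  have "content_sum (stack m D) = (\<Sum>(i, j)\<in>(\<lambda>j. (0::nat, j)) ` {..<m}. of_nat j - of_nat i)
      + (\<Sum>(i, j)\<in>map_prod Suc id ` D. of_nat j - of_nat i)"
    unfolding content_sum_def stack_def by (rule sum.union_disjoint) (use assms in auto)
  then show ?thesis by (simp only: distrib_left 1 2 right_diff_distrib[of 2] add_diff_eq)
qed

section \<open>One-column shapes and the minimal content sum\<close>

definition column :: "nat \<Rightarrow> (nat \<times> nat) set" where
  "column k = (\<lambda>i. (i, 0)) ` {..<k}"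

lemma column_iff: "(i, j) \<in> column k \<longleftrightarrow> i < k \<and> j = 0"
  by (auto simp: column_def)

lemma finite_column: "finite (column k)"
  by (simp add: column_def)

lemma card_column: "card (column k) = k"
  by (simp add: column_def card_image inj_on_def)

lemma downset_column: "downset (column k)"
  by (auto simp: downset_def column_iff)

lemma column_mono: "a \<le> b \<Longrightarrow> column a \<subseteq> column b"
  by (auto simp: column_def)

lemma max_cells_nonempty:
  assumes "finite D" "D \<noteq> {}" shows "max_cells D \<noteq> {}"
proof -
  have f: "finite ((\<lambda>(i, j). i + j) ` D)" "(\<lambda>(i, j). i + j) ` D \<noteq> {}" using assms by auto
  obtain i j where ij: "(i, j) \<in> D" "i + j = Max ((\<lambda>(i, j). i + j) ` D)"
    using Max_in[OF f] by (metis (no_types, lifting) image_iff case_prod_conv surj_pair)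
  have "a + b \<le> i + j" if "(a, b) \<in> D" for a b
    using Max_ge[OF f(1), of "a + b"] that ij(2) by (metis (no_types, lifting) case_prod_conv image_eqI)
  then have "(i, j) \<in> max_cells D" using ij by (fastforce simp: max_cells_def)
  then show ?thesis by blast
qed

text \<open>Removing a corner (a, b) lowers the doubled expression by 2 (b + card D - 1 - a). This
  is nonnegative because the first column has at least a + 1 cells, and zero only if these are all
  cells of \<open>D\<close>. Integers replace the complex numbers of \<open>content_sum\<close>
  since an order is needed.\<close>

lemma content_lower_bound:
  assumes "downset D" "finite D"
  shows "0 \<le> 2 * (\<Sum>(i, j)\<in>D. int j - int i) + int (card D) * (int (card D) - 1) \<and>
    (2 * (\<Sum>(i, j)\<in>D. int j - int i) + int (card D) * (int (card D) - 1) = 0 \<longrightarrow> D = column (card D))"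
  using assms
proof (induction "card D" arbitrary: D rule: less_induct)
  case less
  note D = less.prems
  show ?case
  proof (cases "D = {}")
    case True
    then show ?thesis by (simp add: column_def)
  next
    case False
    then obtain a b where ab: "(a, b) \<in> max_cells D" using max_cells_nonempty[OF D(2)] by fastforce
    then have abD: "(a, b) \<in> D" using max_cells_subset by blast
    let ?D' = "D - {(a, b)}"
    have card: "card D = Suc (card ?D')" by (rule card_Suc_Diff1[OF D(2) abD, symmetric])
    have IH: "0 \<le> 2 * (\<Sum>(i, j)\<in>?D'. int j - int i) + int (card ?D') * (int (card ?D') - 1)"
      using less.hyps[of ?D'] downset_remove[OF D(1) ab] D(2) card by auto
    have sub: "column (Suc a) \<subseteq> D" using downsetD[OF D(1) abD] by (auto simp: column_def)
    then have le: "Suc a \<le> card D" using card_mono[OF D(2) sub] by (simp add: card_column)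
    have sum: "(\<Sum>(i, j)\<in>D. int j - int i) = (int b - int a) + (\<Sum>(i, j)\<in>?D'. int j - int i)"
      using sum.remove[OF D(2) abD, of "\<lambda>(i, j). int j - int i"] by simp
    have eq: "2 * (\<Sum>(i, j)\<in>D. int j - int i) + int (card D) * (int (card D) - 1) =
      2 * (\<Sum>(i, j)\<in>?D'. int j - int i) + int (card ?D') * (int (card ?D') - 1)
      + 2 * (int b + (int (card D) - 1 - int a))"
      unfolding sum card by (simp add: algebra_simps)
    have "D = column (card D)" if "int b + (int (card D) - 1 - int a) = 0"
    proof -
      have "card D = Suc a" using that le by linarith
      then show ?thesis using card_seteq[OF D(2) sub] by (simp add: card_column)
    qed
    then show ?thesis unfolding eq using IH le by auto
  qed
qed

lemma content_sum_of_int: "content_sum D = of_int (\<Sum>(i, j)\<in>D. int j - int i)"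
  by (simp add: content_sum_def split_beta)

lemma content_sum_neq:
  assumes "downset D" "finite D" "D \<noteq> column (card D)"
  shows "2 * content_sum D + of_nat (card D) * (of_nat (card D) - 1) \<noteq> 0"
proof -
  have "2 * content_sum D + of_nat (card D) * (of_nat (card D) - 1) =
    of_int (2 * (\<Sum>(i, j)\<in>D. int j - int i) + int (card D) * (int (card D) - 1))"
    unfolding content_sum_of_int by simp
  then show ?thesis using content_lower_bound[OF assms(1,2)] assms(3) by (metis of_int_eq_0_iff)
qed

lemma content_sum_column: "2 * content_sum (column k) = - (of_nat k * (of_nat k - 1))"
proof -
  have "content_sum (column k) = (\<Sum>i<k. - of_nat i)"
    unfolding content_sum_def column_def by (subst sum.reindex) (auto simp: inj_on_def)
  moreover have "2 * (\<Sum>i<k. - of_nat i) = - (of_nat k * (of_nat k - (1::complex)))"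
    by (induction k) (auto simp: algebra_simps)
  ultimately show ?thesis by simp
qed

section \<open>The coefficients as numbers of skew fillings\<close>

text \<open>The one-row shape (3) is treated as the hook with an empty leg, so the case distinction
  is at 2 and not at 3 as in \<open>b_plus\<close>.\<close>

definition plus_shape :: "nat \<Rightarrow> (nat \<times> nat) set" where
  "plus_shape h = (if h \<le> 2 then (\<lambda>j. (0, j)) ` {..<h} else {(0, 1), (0, 2)} \<union> column (h - 2))"

text \<open>Only from h = 4 on does the column contain the cell (1, 0) and make this the diagram of
  (2,2,1^(h-4)).\<close>

definition minus_shape :: "nat \<Rightarrow> (nat \<times> nat) set" where
  "minus_shape h = {(0, 1), (1, 1)} \<union> column (h - 2)"

definition signed_coeff :: "(nat \<times> nat) set \<Rightarrow> nat \<Rightarrow> complex" where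
  "signed_coeff D h = of_nat (skew_count D (plus_shape h)) -
     (if h \<le> 3 then 0 else of_nat (skew_count D (minus_shape h)))"

lemma finite_plus_shape: "finite (plus_shape h)"
  by (simp add: plus_shape_def finite_column)

lemma finite_minus_shape: "finite (minus_shape h)"
  by (simp add: minus_shape_def finite_column)

lemma card_plus_shape: "card (plus_shape h) = h"
proof (cases "h \<le> 2")
  case True
  then show ?thesis by (simp add: plus_shape_def card_image inj_on_def)
next
  case False
  then show ?thesis
    by (simp add: plus_shape_def card_Un_disjoint finite_column card_column column_iff)
qed

lemma card_minus_shape: "4 \<le> h \<Longrightarrow> card (minus_shape h) = h"
  by (simp add: minus_shape_def card_Un_disjoint finite_column card_column column_iff)

lemma downset_plus_shape: "downset (plus_shape h)"
  unfolding downset_def plus_shape_def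
  by (auto simp: column_iff le_Suc_eq numeral_2_eq_2)

lemma downset_minus_shape: "4 \<le> h \<Longrightarrow> downset (minus_shape h)"
  unfolding downset_def minus_shape_def
  by (auto simp: column_iff le_Suc_eq)

lemma signed_coeff_branching:
  assumes "finite D" "h < card D"
  shows "signed_coeff D h = (\<Sum>c\<in>max_cells D. signed_coeff (D - {c}) h)"
proof -
  have p: "skew_count D (plus_shape h) = (\<Sum>c\<in>max_cells D. skew_count (D - {c}) (plus_shape h))"
    by (rule skew_count_branching[OF assms(1) downset_plus_shape finite_plus_shape])
      (use assms in \<open>simp add: card_plus_shape\<close>)
  show ?thesis
  proof (cases "h \<le> 3")
    case True
    then show ?thesis using p by (simp add: signed_coeff_def)
  next
    case False
    then have "skew_count D (minus_shape h) = (\<Sum>c\<in>max_cells D. skew_count (D - {c}) (minus_shape h))"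
      by (intro skew_count_branching[OF assms(1) downset_minus_shape finite_minus_shape])
        (use assms in \<open>simp_all add: card_minus_shape\<close>)
    then show ?thesis using False p by (simp add: signed_coeff_def sum_subtractf)
  qed
qed

lemma signed_coeff_top:
  assumes "finite D"
  shows "signed_coeff D (card D) = (if D = plus_shape (card D) then 1 else 0)
    - (if 4 \<le> card D \<and> D = minus_shape (card D) then 1 else 0)"
  using skew_count_card_ge[OF assms, of "plus_shape (card D)"]
    skew_count_card_ge[OF assms, of "minus_shape (card D)"] card_minus_shape[of "card D"]
  by (auto simp: signed_coeff_def card_plus_shape finite_plus_shape finite_minus_shape)

lemma signed_coeff_gt:
  assumes "finite D" "card D < h"
  shows "signed_coeff D h = 0"
proof -
  have "plus_shape h \<noteq> D" using card_plus_shape[of h] assms by auto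
  moreover have "h > 3 \<Longrightarrow> minus_shape h \<noteq> D" using card_minus_shape[of h] assms by auto
  ultimately show ?thesis
    using skew_count_card_ge[OF assms(1), of "plus_shape h"] assms
      skew_count_card_ge[OF assms(1), of "minus_shape h"] card_minus_shape[of h]
    by (simp add: signed_coeff_def card_plus_shape finite_plus_shape finite_minus_shape)
qed

lemma card_std_fillings_singleton: "card (std_fillings {p}) = 1"
proof -
  have "max_cells {p} = {p}" by (cases p) (auto simp: max_cells_def)
  then show ?thesis by (subst card_std_fillings) (auto simp: std_fillings_empty)
qed

text \<open>A filling of two cells is determined by the cell of the larger entry, so the number is 1
  if they share a row or a column and 2 otherwise.\<close>

lemma card_std_fillings_pair:
  assumes "p \<noteq> q"
  shows "card (std_fillings {p, q}) = card (max_cells {p, q})"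
proof -
  have "card (std_fillings ({p, q} - {c})) = 1" if "c \<in> max_cells {p, q}" for c
  proof -
    have "c \<in> {p, q}" using that max_cells_subset by blast
    then have "{p, q} - {c} = {q} \<or> {p, q} - {c} = {p}" using assms by auto
    then show ?thesis using card_std_fillings_singleton[of p] card_std_fillings_singleton[of q] by metis
  qed
  then show ?thesis by (subst card_std_fillings) auto
qed

text \<open>Two cells remain to be added to the column. The four results are (1^(m+2)), (2,1^m),
  (3,1^(m-1)) and (2,2,1^(m-2)); the bounds on \<open>m\<close> say that the rows of the added cells
  begin in the column.\<close>

lemma shape_cases:
  assumes D: "downset D" "finite D" and k: "card D = Suc (Suc m)" and sub: "column m \<subseteq> D"
  obtains "D = column (Suc (Suc m))"
  | "D = insert (0, 1) (column (Suc m))"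
  | "0 < m" "D = {(0, 1), (0, 2)} \<union> column m"
  | "1 < m" "D = {(0, 1), (1, 1)} \<union> column m"
proof -
  have sup: "D = S" if "S \<subseteq> D" "card S = Suc (Suc m)" for S
    using card_seteq[OF D(2) that(1)] that(2) k by simp
  show ?thesis
  proof (cases "(Suc m, 0) \<in> D")
    case True
    then have "column (Suc (Suc m)) \<subseteq> D" using downsetD[OF D(1), of "Suc m" 0] by (auto simp: column_def)
    then show ?thesis using sup that(1) by (simp add: card_column)
  next
    case n1: False
    have "\<exists>x\<in>D. snd x \<noteq> 0"
    proof (rule ccontr)
      assume "\<not> (\<exists>x\<in>D. snd x \<noteq> 0)"
      then have z: "j = 0" if "(i, j) \<in> D" for i j using that by force
      have "i \<le> m" if "(i, j) \<in> D" for i j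
        using z[OF that] n1 downsetD[OF D(1) that, of "Suc m" 0] by (cases "i \<le> m") auto
      then have "D \<subseteq> column (Suc m)" using z by (fastforce simp: column_iff)
      then show False using card_mono[OF finite_column, of D "Suc m"] k by (simp add: card_column)
    qed
    then obtain i j where "(i, j) \<in> D" "j \<noteq> 0" by auto
    then have 01: "(0, 1) \<in> D" using downsetD[OF D(1), of i j 0 1] by auto
    show ?thesis
    proof (cases "(m, 0) \<in> D")
      case True
      then have "insert (0, 1) (column (Suc m)) \<subseteq> D" using 01 downsetD[OF D(1), of m 0] by (auto simp: column_def)
      moreover have "card (insert (0, 1) (column (Suc m))) = Suc (Suc m)"
        by (simp add: finite_column card_column column_iff)
      ultimately show ?thesis using sup that(2) by blast
    next
      case n0: False
      have row: "i < m" if "(i, j) \<in> D" for i j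
        using n0 downsetD[OF D(1) that, of m 0] by (cases "i < m") auto
      have m: "0 < m" using row[OF 01] .
      have "card (insert (0, 1) (column m)) = Suc m" by (simp add: finite_column card_column column_iff)
      then have "\<not> D \<subseteq> insert (0, 1) (column m)"
        using card_mono[of "insert (0, 1) (column m)" D] k by (auto simp: finite_column)
      then obtain x where "x \<in> D" "x \<noteq> (0, 1)" "x \<notin> column m" by blast
      then obtain i j where ij: "(i, j) \<in> D" "(i, j) \<noteq> (0, 1)" "(i, j) \<notin> column m"
        by (cases x) blast
      have "j \<noteq> 0" using ij row by (auto simp: column_iff)
      consider "2 \<le> j" | "j = 1" "1 \<le> i"
      proof (cases "2 \<le> j")
        case False
        then have "j = 1" using \<open>j \<noteq> 0\<close> by simp
        then show ?thesis using that(2) ij(2) by (cases i) auto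
      qed (rule that(1))
      then show ?thesis
      proof cases
        case 1
        then have "(0, 2) \<in> D" using downsetD[OF D(1) ij(1), of 0 2] by auto
        then have "{(0, 1), (0, 2)} \<union> column m \<subseteq> D" using 01 sub by auto
        moreover have "card ({(0, 1), (0, 2)} \<union> column m) = Suc (Suc m)"
          by (simp add: finite_column card_column column_iff)
        ultimately show ?thesis using sup that(3)[OF m] by blast
      next
        case 2
        then have 11: "(1, 1) \<in> D" using downsetD[OF D(1) ij(1), of 1 1] by auto
        then have "1 < m" by (rule row)
        have "{(0, 1), (1, 1)} \<union> column m \<subseteq> D" using 01 11 sub by auto
        moreover have "card ({(0, 1), (1, 1)} \<union> column m) = Suc (Suc m)"
          by (simp add: finite_column card_column column_iff)
        ultimately show ?thesis using sup that(4)[OF \<open>1 < m\<close>] by blast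
      qed
    qed
  qed
qed

section \<open>Coefficients of the dimension polynomial and their relation to the signed
  ones\<close>

definition column_coeff :: "(nat \<times> nat) set \<Rightarrow> nat \<Rightarrow> complex" where
  "column_coeff D h = of_nat (skew_count D (column h))"

lemma column_coeff_branching:
  assumes "finite D" "h < card D"
  shows "column_coeff D h = (\<Sum>c\<in>max_cells D. column_coeff (D - {c}) h)"
  using skew_count_branching[OF assms(1) downset_column finite_column, of h] assms(2)
  by (simp add: column_coeff_def card_column)

lemma column_coeff_top:
  assumes "finite D"
  shows "column_coeff D (card D) = (if D = column (card D) then 1 else 0)"
  using skew_count_card_ge[OF assms, of "column (card D)"]
  by (auto simp: column_coeff_def card_column finite_column)

lemma column_coeff_column_pred: "column_coeff (column (Suc k)) k = 1"
proof -
  have "column (Suc k) - column k = {(k, 0)}" by (auto simp: column_def)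
  then show ?thesis using column_mono[of k "Suc k"] card_std_fillings_singleton
    by (simp add: column_coeff_def skew_count_def)
qed


lemma column_coeff_diff:
  assumes "column h \<subseteq> D" "D - column h = {p, q}" "p \<noteq> q" "card (max_cells {p, q}) = n"
  shows "column_coeff D h = of_nat n"
  using assms card_std_fillings_pair[of p q] by (simp add: column_coeff_def skew_count_def)

lemma column_coeff_eq_0: "\<not> column h \<subseteq> D \<Longrightarrow> column_coeff D h = 0"
  by (simp add: column_coeff_def skew_count_def)

lemma content_sum_insert:
  assumes "finite D" "(i, j) \<notin> D"
  shows "content_sum (insert (i, j) D) = of_nat j - of_nat i + content_sum D"
  using assms by (simp add: content_sum_def)

text \<open>The polynomial identity of the header at \<open>x = 2\<close>, with \<open>k = m + 2\<close>: the first factor is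
  \<open>Q(2)\<close> up to the sign \<open>(-1)^m\<close>.\<close>

lemma boundary_identity:
  assumes D: "downset D" "finite D" and k: "card D = Suc (Suc m)"
  shows "(column_coeff D (Suc (Suc m)) - 2 * column_coeff D (Suc m) + column_coeff D m) *
    (of_nat m * (of_nat m + 1) + 2 * content_sum D - 2 * of_nat (Suc (Suc m))) = 2 * signed_coeff D (Suc (Suc m))"
proof (cases "column m \<subseteq> D")
  case False
  have ge: "\<not> column h \<subseteq> D" if "m \<le> h" for h using False column_mono[OF that] by blast
  have "D \<noteq> plus_shape (Suc (Suc m))"
    using False by (cases m) (auto simp: plus_shape_def column_def)
  moreover have "D \<noteq> minus_shape (Suc (Suc m))"
    using False by (auto simp: minus_shape_def)
  ultimately show ?thesis
    using signed_coeff_top[OF D(2)] k by (simp add: column_coeff_eq_0 ge)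
next
  case True
  note top = signed_coeff_top[OF D(2), unfolded k] column_coeff_top[OF D(2), unfolded k]
  have 01: "(0, 1) \<in> plus_shape (Suc (Suc m))"
    by (auto simp: plus_shape_def numeral_2_eq_2)
  have cc: "2 * content_sum (column n) = - (of_nat n * (of_nat n - 1))" for n
    by (rule content_sum_column)
  from shape_cases[OF D k True] show ?thesis
  proof cases
    \<comment> \<open>For the column all three column coefficients are 1, and 1 - 2 + 1 = 0.\<close>
    case 1
    have "(0, 1) \<notin> D" unfolding 1 by (simp add: column_iff)
    then have b: "signed_coeff D (Suc (Suc m)) = 0" using 01 top(1) by (auto simp: minus_shape_def)
    have "column_coeff D m = of_nat 1"
    proof (rule column_coeff_diff[OF True])
      show "D - column m = {(m, 0), (Suc m, 0)}" unfolding 1 by (auto simp: column_def)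
      have "max_cells {(m, 0), (Suc m, 0)} = {(Suc m, 0)}" by (auto simp: max_cells_def)
      then show "card (max_cells {(m, 0), (Suc m, 0)}) = 1" by simp
    qed simp
    then show ?thesis using b top(2) 1 column_coeff_column_pred[of "Suc m"] by simp
  next
    case 2
    have nc: "D \<noteq> column (Suc (Suc m))" unfolding 2 by (auto simp: column_iff)
    have "D - column (Suc m) = {(0, 1)}" unfolding 2 by (auto simp: column_iff)
    moreover have "column (Suc m) \<subseteq> D" unfolding 2 by blast
    ultimately have p1: "column_coeff D (Suc m) = 1"
      using card_std_fillings_singleton by (simp add: column_coeff_def skew_count_def)
    have "(1, 1) \<notin> D" unfolding 2 by (simp add: column_iff)
    then have nm: "D \<noteq> minus_shape (Suc (Suc m))" by (auto simp: minus_shape_def)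
    have diff: "D - column m = {(0, 1), (m, 0)}" unfolding 2 by (auto simp: column_def)
    show ?thesis
    proof (cases m)
      \<comment> \<open>The shape (2): its two cells lie in one row, so the first factor is 0 - 2 +
        1 = -1; the second is -2.\<close>
      case 0
      have "column_coeff D m = of_nat 1"
      proof (rule column_coeff_diff[OF True diff])
        have "max_cells {(0, 1), (m, 0)} = {(0, 1)}" unfolding 0 by (auto simp: max_cells_def)
        then show "card (max_cells {(0, 1), (m, 0)}) = 1" by simp
      qed simp
      moreover have "D = plus_shape 2" unfolding 2 0 by (auto simp: plus_shape_def column_def numeral_2_eq_2 less_Suc_eq)
      moreover have "content_sum (column (Suc 0)) = 0" using cc[of "Suc 0"] by simp
      then have "content_sum D = 1" unfolding 2 0 by (simp add: content_sum_insert finite_column column_iff)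
      ultimately show ?thesis using 0 top nc p1 nm by (simp add: numeral_2_eq_2)
    next
      \<comment> \<open>The two remaining cells are now incomparable, so the coefficient at
        \<open>m\<close> is 2 and the first factor is 0 - 2 + 2 = 0.\<close>
      case (Suc l)
      have "column_coeff D m = of_nat 2"
      proof (rule column_coeff_diff[OF True diff])
        have "max_cells {(0, 1), (m, 0)} = {(0, 1), (m, 0)}" unfolding Suc by (auto simp: max_cells_def)
        then show "card (max_cells {(0, 1), (m, 0)}) = 2" by simp
      qed simp
      moreover have "(0, 2) \<notin> D" unfolding 2 by (simp add: column_iff)
      then have "D \<noteq> plus_shape (Suc (Suc m))" using Suc by (auto simp: plus_shape_def)
      ultimately show ?thesis using top nc p1 nm by simp
    qed
  next
    \<comment> \<open>The first factor is 1 and the contents make the second one 2.\<close>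
    case 3
    have "\<not> column (Suc m) \<subseteq> D" unfolding 3(2) by (auto simp: column_def)
    then have "column_coeff D (Suc m) = 0" "column_coeff D (Suc (Suc m)) = 0"
      using column_mono[of "Suc m" "Suc (Suc m)"] by (auto intro: column_coeff_eq_0)
    moreover have "column_coeff D m = of_nat 1"
    proof (rule column_coeff_diff[OF True])
      show "D - column m = {(0, 1), (0, 2)}" unfolding 3(2) by (auto simp: column_iff)
      have "max_cells {(0, 1), (0, 2)} = {(0::nat, 2::nat)}" by (auto simp: max_cells_def)
      then show "card (max_cells {(0, 1), (0::nat, 2::nat)}) = 1" by simp
    qed simp
    moreover have "(1, 1) \<notin> D" unfolding 3(2) by (simp add: column_iff)
    then have "D \<noteq> minus_shape (Suc (Suc m))" by (auto simp: minus_shape_def)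
    moreover have "D = plus_shape (Suc (Suc m))" using 3 by (simp add: plus_shape_def)
    moreover have "2 * content_sum D = 6 - of_nat m * (of_nat m - 1)"
    proof -
      have "content_sum D = 1 + (2 + content_sum (column m))"
        unfolding 3(2) by (simp add: content_sum_insert finite_column column_iff)
      then show ?thesis using cc[of m] by (simp add: algebra_simps)
    qed
    ultimately show ?thesis using top by (simp add: algebra_simps)
  next
    \<comment> \<open>Compared with the hook, the content 2 of (0, 2) is replaced by the content 0
      of (1, 1). This turns the second factor from 2 into -2 and is the origin of the negative
      shape.\<close>
    case 4
    have "\<not> column (Suc m) \<subseteq> D" unfolding 4(2) by (auto simp: column_def)
    then have "column_coeff D (Suc m) = 0" "column_coeff D (Suc (Suc m)) = 0"
      using column_mono[of "Suc m" "Suc (Suc m)"] by (auto intro: column_coeff_eq_0)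
    moreover have "column_coeff D m = of_nat 1"
    proof (rule column_coeff_diff[OF True])
      show "D - column m = {(0, 1), (1, 1)}" unfolding 4(2) by (auto simp: column_iff)
      have "max_cells {(0, 1), (1, 1)} = {(1::nat, 1::nat)}" by (auto simp: max_cells_def)
      then show "card (max_cells {(0, 1), (1::nat, 1::nat)}) = 1" by simp
    qed simp
    moreover have "(0, 2) \<notin> D" unfolding 4(2) by (simp add: column_iff)
    then have "D \<noteq> plus_shape (Suc (Suc m))" using 4(1) by (auto simp: plus_shape_def)
    moreover have "D = minus_shape (Suc (Suc m))" using 4 by (simp add: minus_shape_def)
    moreover have "2 * content_sum D = 2 - of_nat m * (of_nat m - 1)"
    proof -
      have "content_sum D = 1 + (0 + content_sum (column m))"
        unfolding 4(2) by (simp add: content_sum_insert finite_column column_iff)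
      then show ?thesis using cc[of m] by (simp add: algebra_simps)
    qed
    ultimately show ?thesis using top 4(1) by (simp add: algebra_simps)
  qed
qed

section \<open>Polynomials in the size\<close>

definition bin_poly :: "nat \<Rightarrow> complex poly" where
  "bin_poly j = smult (1 / fact j) (\<Prod>i<j. [:- of_nat i, 1:])"

lemma poly_bin_poly: "poly (bin_poly j) x = x gchoose j"
  by (simp add: bin_poly_def poly_prod gbinomial_prod_rev atLeast0LessThan)

text \<open>The binomial expansion with coefficients \<open>a h\<close> of the statement, with \<open>s\<close> in the role of 2.\<close>

definition bin_sum :: "complex \<Rightarrow> nat \<Rightarrow> (nat \<Rightarrow> complex) \<Rightarrow> complex poly" where
  "bin_sum s k a = (\<Sum>h\<le>k. smult ((-1) ^ h * a h) (pcompose (bin_poly (k - h)) [:- s, 1:]))"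

lemma poly_bin_sum: "poly (bin_sum s k a) x = (\<Sum>h\<le>k. (-1) ^ h * a h * ((x - s) gchoose (k - h)))"
  by (simp add: bin_sum_def poly_sum poly_pcompose poly_bin_poly)

lemma poly_eqI_nat:
  fixes p q :: "complex poly"
  assumes "\<And>n. N \<le> n \<Longrightarrow> poly p (of_nat n) = poly q (of_nat n)"
  shows "p = q"
proof (rule ccontr)
  assume "p \<noteq> q"
  then have "finite {x. poly (p - q) x = 0}" by (intro poly_roots_finite) simp
  moreover have "of_nat ` {N..} \<subseteq> {x. poly (p - q) x = 0}" using assms by auto
  ultimately have "finite ((of_nat :: nat \<Rightarrow> complex) ` {N..})" by (rule finite_subset[rotated])
  then show False using infinite_Ici[of N] by (simp add: finite_image_iff inj_on_def)
qed

text \<open>Pascal's rule term by term. The coefficients stay in place, and the term with h = k + 1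
  is constant and drops out.\<close>

lemma bin_sum_step:
  "poly (bin_sum s (Suc k) a) (x + 1) - poly (bin_sum s (Suc k) a) x = poly (bin_sum s k a) x"
proof -
  have "((x + 1 - s) gchoose (Suc k - h)) - ((x - s) gchoose (Suc k - h)) = ((x - s) gchoose (k - h))" if "h \<le> k" for h
    using gbinomial_Suc_Suc[of "x - s" "k - h"] that by (simp add: Suc_diff_le algebra_simps)
  then have "(-1) ^ h * a h * ((x + 1 - s) gchoose (Suc k - h)) - (-1) ^ h * a h * ((x - s) gchoose (Suc k - h))
    = (-1) ^ h * a h * ((x - s) gchoose (k - h))" if "h \<le> k" for h
    using that by (simp only: right_diff_distrib[symmetric])
  then show ?thesis
    unfolding poly_bin_sum by (simp add: sum_subtractf[symmetric])
qed

text \<open>A discrete antiderivative is unique up to a constant, and the only constant term of the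
  expansion is the one with h = k + 1.\<close>

lemma bin_sum_integrate:
  assumes "\<And>n. N \<le> n \<Longrightarrow> H (Suc n) - H n = poly (bin_sum s k a) (of_nat n)"
  shows "\<exists>b. \<forall>n\<ge>N. H n = poly (bin_sum s (Suc k) (a(Suc k := b))) (of_nat n)"
proof -
  define Q where "Q = bin_sum s (Suc k) (a(Suc k := 0))"
  define K where "K = H N - poly Q (of_nat N)"
  have cong: "bin_sum s k (a(Suc k := c)) = bin_sum s k a" for c
    unfolding bin_sum_def by (intro sum.cong) auto
  have "H n = poly Q (of_nat n) + K" if "N \<le> n" for n
    using that
  proof (induction n rule: dec_induct)
    case base
    then show ?case by (simp add: K_def)
  next
    case (step n)
    have "poly Q (of_nat n + 1) - poly Q (of_nat n) = poly (bin_sum s k a) (of_nat n)"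
      unfolding Q_def by (simp only: bin_sum_step cong)
    then show ?case using assms[OF step(1)] step by (simp add: algebra_simps)
  qed
  \<comment> \<open>The last term has the sign \<open>(-1) ^ Suc k\<close> and the binomial 1, so
    this coefficient turns it into \<open>K\<close>.\<close>
  moreover have "poly (bin_sum s (Suc k) (a(Suc k := (-1) ^ Suc k * K))) x = poly Q x + K" for x
    unfolding Q_def by (simp add: poly_bin_sum algebra_simps power_mult_distrib[symmetric])
  ultimately have "\<forall>n\<ge>N. H n = poly (bin_sum s (Suc k) (a(Suc k := (-1) ^ Suc k * K))) (of_nat n)"
    by simp
  then show ?thesis by (rule exI)
qed

section \<open>Dimensions and character values as functions of the size\<close>

definition dim_fun :: "(nat \<times> nat) set \<Rightarrow> nat \<Rightarrow> complex" where
  "dim_fun D n = of_nat (card (std_fillings (stack (n - card D) D)))"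

definition char_fun :: "(nat \<times> nat) set \<Rightarrow> nat \<Rightarrow> complex" where
  "char_fun D n = specht_char (stack (n - card D) D) (transpose 1 2)"

lemma downset_width:
  assumes "downset D" "finite D" "(i, j) \<in> D" shows "j < card D"
proof -
  have "(\<lambda>l. (0, l)) ` {..j} \<subseteq> D" using downsetD[OF assms(1,3)] by auto
  then have "card ((\<lambda>l. (0::nat, l)) ` {..j}) \<le> card D" by (rule card_mono[OF assms(2)])
  then show ?thesis by (simp add: card_image inj_on_def)
qed

text \<open>The width of \<open>D\<close> is at most its number of cells, so this crude bound makes
  the first row long enough; sharper bounds are not at issue where only large n count.\<close>

lemma stack_facts:
  assumes D: "downset D" "finite D" and n: "2 * card D \<le> n"
  shows "downset (stack (n - card D) D)" "card (stack (n - card D) D) = n"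
    "\<And>i j. (i, j) \<in> D \<Longrightarrow> j < n - card D"
proof -
  show w: "j < n - card D" if "(i, j) \<in> D" for i j using downset_width[OF D that] n by linarith
  show "downset (stack (n - card D) D)" by (rule downset_stack[OF D(1) w])
  show "card (stack (n - card D) D) = n" using n by (simp add: card_stack[OF D(2)])
qed

lemma card_remove_max_cell:
  assumes "finite D" "c \<in> max_cells D" shows "card D = Suc (card (D - {c}))"
  using card_Suc_Diff1[OF assms(1), of c] assms(2) max_cells_subset by force

lemma stack_sum_branching:
  assumes D: "downset D" "finite D" and n: "2 * card D \<le> n"
  shows "(\<Sum>c\<in>max_cells (stack (Suc n - card D) D). g (stack (Suc n - card D) D - {c}))
    = g (stack (n - card D) D) + (\<Sum>c\<in>max_cells D. g (stack (n - card (D - {c})) (D - {c})))"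
proof -
  have e: "Suc n - card D = Suc (n - card D)" using n by simp
  \<comment> \<open>The first row of the shape of size n + 1 has the length that belongs to size n
    once a cell of \<open>D\<close> is gone; so the corners of \<open>D\<close> contribute values at
    n.\<close>
  have "n - card (D - {c}) = Suc (n - card D)" if "c \<in> max_cells D" for c
    using card_remove_max_cell[OF D(2) that] n by simp
  then have "(\<Sum>c\<in>max_cells D. g (stack (n - card (D - {c})) (D - {c})))
     = (\<Sum>c\<in>max_cells D. g (stack (Suc (n - card D)) (D - {c})))"
    by (intro sum.cong) auto
  then show ?thesis
    unfolding e by (simp only: sum_max_cells_stack[OF D(2) stack_facts(3)[OF D n]])
qed

lemma dim_fun_step:
  assumes D: "downset D" "finite D" and n: "2 * card D \<le> n"
  shows "dim_fun D (Suc n) - dim_fun D n = (\<Sum>c\<in>max_cells D. dim_fun (D - {c}) n)"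
proof -
  let ?S = "stack (Suc n - card D) D"
  have "card ?S = Suc n" using stack_facts(2)[OF D, of "Suc n"] n by simp
  then have "?S \<noteq> {}" by auto
  then have "card (std_fillings ?S) = (\<Sum>c\<in>max_cells ?S. card (std_fillings (?S - {c})))"
    by (rule card_std_fillings[OF finite_stack[OF D(2)]])
  then show ?thesis
    unfolding dim_fun_def
    using stack_sum_branching[OF D n, of "\<lambda>S. card (std_fillings S)"] by simp
qed

lemma char_fun_step:
  assumes D: "downset D" "finite D" and n: "2 * card D \<le> n" "2 \<le> n"
  shows "char_fun D (Suc n) - char_fun D n = (\<Sum>c\<in>max_cells D. char_fun (D - {c}) n)"
proof -
  let ?S = "stack (Suc n - card D) D"
  have c: "card ?S = Suc n" and d: "downset ?S" using stack_facts[OF D, of "Suc n"] n by simp_all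
  then have "?S \<noteq> {}" by auto
  moreover have "transpose 1 2 permutes {1..card ?S - 1}"
    unfolding c using n by (intro permutes_swap_id) auto
  ultimately have "specht_char ?S (transpose 1 2) = (\<Sum>c\<in>max_cells ?S. specht_char (?S - {c}) (transpose 1 2))"
    by (intro specht_char_branching[OF d finite_stack[OF D(2)]])
  then show ?thesis
    unfolding char_fun_def
    using stack_sum_branching[OF D n(1), of "\<lambda>S. specht_char S (transpose 1 2)"] by simp
qed

lemma char_fun_content:
  assumes D: "downset D" "finite D" and n: "2 * card D \<le> n" "2 \<le> n"
  shows "of_nat n * (of_nat n - 1) * char_fun D n =
    dim_fun D n * ((of_nat n - of_nat (card D)) * (of_nat n - of_nat (card D) - 1) + 2 * content_sum D - 2 * of_nat (card D))"
proof -
  let ?S = "stack (n - card D) D"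
  note S = stack_facts[OF D n(1)]
  have "of_nat (card ?S * (card ?S - 1)) * specht_char ?S (transpose 1 2)
    = 2 * of_nat (card (std_fillings ?S)) * content_sum ?S"
    by (rule class_sum[OF S(1) finite_stack[OF D(2)]]) (use S(2) n in auto)
  then have "of_nat n * (of_nat n - 1) * char_fun D n = dim_fun D n * (2 * content_sum ?S)"
    using n by (simp add: S(2) char_fun_def dim_fun_def of_nat_diff mult_ac)
  then show ?thesis
    using n by (simp only: content_sum_stack[OF D(2)]) (simp add: of_nat_diff)
qed

text \<open>The number in the name counts from \<open>s\<close>: at \<open>x = s\<close> only the
  binomial with lower index 0 survives. For the character \<open>s\<close> is 2, for the dimension
  it is 0.\<close>

lemma bin_sum_at_0: "poly (bin_sum s k a) s = (-1) ^ k * a k"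
proof -
  have "(-1) ^ h * a h * ((s - s) gchoose (k - h)) = (if h = k then (-1) ^ k * a k else 0)" if "h \<le> k" for h
    using that by (cases "k - h") auto
  then have "poly (bin_sum s k a) s = (\<Sum>h\<le>k. if h = k then (-1) ^ k * a k else 0)"
    unfolding poly_bin_sum by (intro sum.cong) auto
  then show ?thesis by simp
qed

lemma bin_sum_at_1: "poly (bin_sum s (Suc k) a) (s + 1) = (-1) ^ k * (a k - a (Suc k))"
  using bin_sum_step[of s k a s] by (simp add: bin_sum_at_0 algebra_simps)

text \<open>Two forward differences from \<open>s\<close> on produce a second difference of the last
  three coefficients; for \<open>s = 0\<close> this is the value Q(2).\<close>

lemma bin_sum_at_2: "poly (bin_sum s (Suc (Suc k)) a) (s + 2) = (-1) ^ k * (a k - 2 * a (Suc k) + a (Suc (Suc k)))"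
proof -
  have "poly (bin_sum s (Suc (Suc k)) a) (s + 1 + 1) =
      poly (bin_sum s (Suc (Suc k)) a) (s + 1) + poly (bin_sum s (Suc k) a) (s + 1)"
    using bin_sum_step[of s "Suc k" a "s + 1"] by (simp add: algebra_simps)
  moreover have "s + 1 + 1 = s + 2" by simp
  ultimately have "poly (bin_sum s (Suc (Suc k)) a) (s + 2) =
      (-1) ^ Suc k * (a (Suc k) - a (Suc (Suc k))) + (-1) ^ k * (a k - a (Suc k))"
    by (simp only: bin_sum_at_1)
  then show ?thesis by (simp add: algebra_simps)
qed

lemma sum_bin_sum:
  assumes "\<And>h. h \<le> k \<Longrightarrow> a h = (\<Sum>c\<in>C. f c h)"
  shows "(\<Sum>c\<in>C. poly (bin_sum s k (f c)) x) = poly (bin_sum s k a) x"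
proof -
  have "(\<Sum>c\<in>C. poly (bin_sum s k (f c)) x) =
      (\<Sum>h\<le>k. \<Sum>c\<in>C. (-1) ^ h * f c h * ((x - s) gchoose (k - h)))"
    unfolding poly_bin_sum by (rule sum.swap)
  also have "\<dots> = poly (bin_sum s k a) x"
    unfolding poly_bin_sum
    by (rule sum.cong[OF refl]) (simp add: assms sum_distrib_left sum_distrib_right)
  finally show ?thesis .
qed

lemma dim_fun_empty: "dim_fun {} n = 1"
proof (induction n)
  case 0
  then show ?case by (simp add: dim_fun_def stack_def std_fillings_empty)
next
  case (Suc n)
  have "downset {}" by (simp add: downset_def)
  then have "dim_fun {} (Suc n) - dim_fun {} n = 0"
    using dim_fun_step[of "{}" n] by (simp add: max_cells_def)
  then show ?case using Suc by simp
qed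

lemma top_coefficients:
  assumes D: "downset D" "finite D" and k: "card D = Suc k"
    and P1: "\<And>x. x * (x - 1) * poly (bin_sum 2 (Suc k) ((signed_coeff D)(Suc k := b2))) x =
      poly (bin_sum 0 (Suc k) ((column_coeff D)(Suc k := b1))) x *
      ((x - of_nat (Suc k)) * (x - of_nat (Suc k) - 1) + 2 * content_sum D - 2 * of_nat (Suc k))"
  shows "b1 = column_coeff D (Suc k)" and "b2 = signed_coeff D (Suc k)"
proof -
  let ?R = "\<lambda>x. (x - of_nat (Suc k)) * (x - of_nat (Suc k) - 1) + 2 * content_sum D - 2 * of_nat (Suc k)"
  have sgn: "(- 1) ^ j \<noteq> (0::complex)" for j by simp
  show b1: "b1 = column_coeff D (Suc k)"
  proof (cases "D = column (Suc k)")
    case False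
    have "2 * content_sum D + of_nat (Suc k) * (of_nat (Suc k) - 1) \<noteq> 0"
      using content_sum_neq[OF D] False unfolding k by simp
    then have "?R 0 \<noteq> 0" by (simp add: algebra_simps)
    moreover have "(-1) ^ Suc k * b1 * ?R 0 = 0"
      using P1[of 0] bin_sum_at_0[of 0] by simp
    ultimately have "b1 = 0" using sgn by (simp only: mult_eq_0_iff) blast
    then show ?thesis using column_coeff_top[OF D(2)] False k by simp
  next
    \<comment> \<open>For the column x = 0 carries no information, but \<open>?R 1\<close> is -2 (k
      + 1). Hence the last two coefficients of Q agree, and the earlier one is known to be
      1.\<close>
    case True
    have "?R 1 = - (2 * of_nat (Suc k))"
      using content_sum_column[of "Suc k"] True by (simp add: algebra_simps)
    then have "?R 1 \<noteq> 0" using of_nat_neq_0[of k, where 'a = complex] by (simp only: neg_equal_0_iff_equal mult_eq_0_iff) simp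
    moreover have "(-1) ^ k * (column_coeff D k - b1) * ?R 1 = 0"
      using P1[of 1] bin_sum_at_1[of 0 k "(column_coeff D)(Suc k := b1)"] by simp
    ultimately have "column_coeff D k - b1 = 0" using sgn by (simp only: mult_eq_0_iff) blast
    then show ?thesis using column_coeff_top[OF D(2)] k column_coeff_column_pred[of k] True by simp
  qed
  have P: "2 * ((-1) ^ Suc k * b2) = poly (bin_sum 0 (Suc k) (column_coeff D)) 2 * ?R 2"
    using P1[of 2] bin_sum_at_0[of 2 "Suc k" "(signed_coeff D)(Suc k := b2)"] b1 by simp
  show "b2 = signed_coeff D (Suc k)"
  proof (cases k)
    \<comment> \<open>With a single cell there are too few coefficients for the second difference.
      Here Q(2) = 2 - 1 = 1 and \<open>?R 2\<close> is -2, so \<open>b2\<close> is 1.\<close>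
    case 0
    have "column (Suc 0) = D"
    proof (rule card_subset_eq[OF D(2)])
      have "D \<noteq> {}" using k by auto
      then obtain i j where "(i, j) \<in> D" by auto
      then show "column (Suc 0) \<subseteq> D" using downsetD[OF D(1), of i j 0 0] by (auto simp: column_iff)
      show "card (column (Suc 0)) = card D" using k 0 by (simp add: card_column)
    qed
    then have DD: "D = column (Suc 0)" by simp
    have "poly (bin_sum 0 (Suc 0) (column_coeff D)) 2 = 2 * column_coeff D 0 - column_coeff D (Suc 0)"
      by (simp add: poly_bin_sum)
    also have "\<dots> = 1" using column_coeff_column_pred[of 0] column_coeff_top[OF D(2)] k 0 DD by simp
    finally have "b2 = 1" using P 0 content_sum_column[of "Suc 0"] DD by simp
    moreover have "D = plus_shape (Suc 0)" using DD by (auto simp: plus_shape_def column_def)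
    ultimately show ?thesis using signed_coeff_top[OF D(2)] k 0 by simp
  next
    case (Suc m)
    have e: "poly (bin_sum 0 (Suc (Suc m)) (column_coeff D)) 2 =
        (-1) ^ m * (column_coeff D m - 2 * column_coeff D (Suc m) + column_coeff D (Suc (Suc m)))"
      using bin_sum_at_2[of 0 m "column_coeff D"] by simp
    have "?R 2 = of_nat m * (of_nat m + 1) + 2 * content_sum D - 2 * of_nat (Suc (Suc m))"
      unfolding Suc by (simp add: algebra_simps)
    then have "2 * ((-1) ^ m * b2) = (-1) ^ m * ((column_coeff D (Suc (Suc m)) - 2 * column_coeff D (Suc m) + column_coeff D m) *
      (of_nat m * (of_nat m + 1) + 2 * content_sum D - 2 * of_nat (Suc (Suc m))))"
      using P unfolding Suc e by (simp add: mult_ac add_ac)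
    also have "\<dots> = (-1) ^ m * (2 * signed_coeff D (Suc (Suc m)))"
      using boundary_identity[OF D] k Suc by simp
    finally show ?thesis unfolding Suc by simp
  qed
qed

text \<open>Both formulas go through one induction because their constants are determined together.
  They are claimed only for large n, since each corner brings its own threshold.\<close>

lemma stable_formulas:
  assumes "downset D" "finite D"
  shows "\<forall>\<^sub>F n in sequentially. dim_fun D n = poly (bin_sum 0 (card D) (column_coeff D)) (of_nat n) \<and>
    char_fun D n = poly (bin_sum 2 (card D) (signed_coeff D)) (of_nat n)"
  using assms
proof (induction "card D" arbitrary: D)
  case 0
  then have D: "D = {}" "downset D" "finite D" by auto
  have "column_coeff {} 0 = 1" "signed_coeff {} 0 = 1"
    using column_coeff_top[of "{}"] signed_coeff_top[of "{}"] by (simp_all add: column_def plus_shape_def)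
  then have v: "poly (bin_sum s (card D) (column_coeff D)) x = 1" "poly (bin_sum s (card D) (signed_coeff D)) x = 1" for s x
    by (simp_all add: poly_bin_sum D)
  have "char_fun D n = 1" if "2 \<le> n" for n
  proof -
    have "of_nat n * (of_nat n - 1) * char_fun D n = of_nat n * (of_nat n - 1)"
      using char_fun_content[OF D(2,3) _ that] D(1) by (simp add: dim_fun_empty content_sum_def)
    moreover have "of_nat n * (of_nat n - 1) \<noteq> (0::complex)" using that by auto
    ultimately show ?thesis by (metis mult_cancel_left1)
  qed
  then show ?case unfolding v eventually_sequentially using D dim_fun_empty by auto
next
  case (Suc k)
  note D = Suc.prems and k = Suc.hyps(2)[symmetric]
  have ck: "card (D - {c}) = k" if "c \<in> max_cells D" for c
    using card_remove_max_cell[OF D(2) that] k by simp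
  have "\<forall>\<^sub>F n in sequentially. \<forall>c\<in>max_cells D.
      dim_fun (D - {c}) n = poly (bin_sum 0 k (column_coeff (D - {c}))) (of_nat n) \<and>
      char_fun (D - {c}) n = poly (bin_sum 2 k (signed_coeff (D - {c}))) (of_nat n)"
  proof (rule eventually_ball_finite[OF finite_max_cells[OF D(2)]], rule ballI)
    fix c assume c: "c \<in> max_cells D"
    show "\<forall>\<^sub>F n in sequentially. dim_fun (D - {c}) n = poly (bin_sum 0 k (column_coeff (D - {c}))) (of_nat n) \<and>
      char_fun (D - {c}) n = poly (bin_sum 2 k (signed_coeff (D - {c}))) (of_nat n)"
      using Suc.hyps(1)[of "D - {c}"] ck[OF c] downset_remove[OF D(1) c] D(2) by simp
  qed
  then obtain N0 where N0: "\<And>n c. N0 \<le> n \<Longrightarrow> c \<in> max_cells D \<Longrightarrow>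
      dim_fun (D - {c}) n = poly (bin_sum 0 k (column_coeff (D - {c}))) (of_nat n) \<and>
      char_fun (D - {c}) n = poly (bin_sum 2 k (signed_coeff (D - {c}))) (of_nat n)"
    unfolding eventually_sequentially by blast
  \<comment> \<open>From here on the formulas hold for all corners, the stacked shapes are diagrams,
    and the entries 1 and 2 are present.\<close>
  define N where "N = N0 + 2 * card D + 2"
  have N: "N0 \<le> n" "2 * card D \<le> n" "2 \<le> n" if "N \<le> n" for n using that by (auto simp: N_def)
  have "dim_fun D (Suc n) - dim_fun D n = poly (bin_sum 0 k (column_coeff D)) (of_nat n)" if n: "N \<le> n" for n
  proof -
    have "dim_fun D (Suc n) - dim_fun D n = (\<Sum>c\<in>max_cells D. poly (bin_sum 0 k (column_coeff (D - {c}))) (of_nat n))"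
      unfolding dim_fun_step[OF D N(2)[OF n]] by (rule sum.cong[OF refl]) (use N0[OF N(1)[OF n]] in blast)
    also have "\<dots> = poly (bin_sum 0 k (column_coeff D)) (of_nat n)"
      by (rule sum_bin_sum) (use column_coeff_branching[OF D(2)] k in simp)
    finally show ?thesis .
  qed
  then have "\<exists>b. \<forall>n\<ge>N. dim_fun D n = poly (bin_sum 0 (Suc k) ((column_coeff D)(Suc k := b))) (of_nat n)"
    by (rule bin_sum_integrate)
  then obtain b1 where b1: "\<And>n. N \<le> n \<Longrightarrow> dim_fun D n = poly (bin_sum 0 (Suc k) ((column_coeff D)(Suc k := b1))) (of_nat n)"
    by blast
  have "char_fun D (Suc n) - char_fun D n = poly (bin_sum 2 k (signed_coeff D)) (of_nat n)" if n: "N \<le> n" for n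
  proof -
    have "char_fun D (Suc n) - char_fun D n = (\<Sum>c\<in>max_cells D. poly (bin_sum 2 k (signed_coeff (D - {c}))) (of_nat n))"
      unfolding char_fun_step[OF D N(2,3)[OF n]] by (rule sum.cong[OF refl]) (use N0[OF N(1)[OF n]] in blast)
    also have "\<dots> = poly (bin_sum 2 k (signed_coeff D)) (of_nat n)"
      by (rule sum_bin_sum) (use signed_coeff_branching[OF D(2)] k in simp)
    finally show ?thesis .
  qed
  then have "\<exists>b. \<forall>n\<ge>N. char_fun D n = poly (bin_sum 2 (Suc k) ((signed_coeff D)(Suc k := b))) (of_nat n)"
    by (rule bin_sum_integrate)
  then obtain b2 where b2: "\<And>n. N \<le> n \<Longrightarrow> char_fun D n = poly (bin_sum 2 (Suc k) ((signed_coeff D)(Suc k := b2))) (of_nat n)"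
    by blast
  let ?P1 = "bin_sum 0 (Suc k) ((column_coeff D)(Suc k := b1))" and ?P2 = "bin_sum 2 (Suc k) ((signed_coeff D)(Suc k := b2))"
  let ?c = "of_nat (Suc k) :: complex"
  \<comment> \<open>Stated between polynomials, so that it may be evaluated at 0, 1 and 2, which lie
    outside the range of n.\<close>
  have "[:0, 1:] * [:- 1, 1:] * ?P2 = ?P1 * ([:- ?c, 1:] * [:- ?c - 1, 1:] + [:2 * content_sum D - 2 * ?c:])"
  proof (rule poly_eqI_nat)
    fix n assume n: "N \<le> n"
    show "poly ([:0, 1:] * [:- 1, 1:] * ?P2) (of_nat n) =
      poly (?P1 * ([:- ?c, 1:] * [:- ?c - 1, 1:] + [:2 * content_sum D - 2 * ?c:])) (of_nat n)"
      using char_fun_content[OF D N(2,3)[OF n]] unfolding b1[OF n] b2[OF n] k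
      by (simp add: algebra_simps)
  qed
  then have "poly ([:0, 1:] * [:- 1, 1:] * ?P2) x =
      poly (?P1 * ([:- ?c, 1:] * [:- ?c - 1, 1:] + [:2 * content_sum D - 2 * ?c:])) x" for x
    by simp
  then have P: "x * (x - 1) * poly ?P2 x = poly ?P1 x * ((x - ?c) * (x - ?c - 1) + 2 * content_sum D - 2 * ?c)" for x
    by (simp add: algebra_simps)
  have "(column_coeff D)(Suc k := b1) = column_coeff D" "(signed_coeff D)(Suc k := b2) = signed_coeff D"
    using top_coefficients[OF D k P] by simp_all
  then show ?case using b1 b2 k unfolding eventually_sequentially by auto
qed

section \<open>Transfer to lists of parts\<close>

text \<open>The value at \<open>s\<close> isolates the last coefficient, and the forward difference
  passes to the remaining ones without changing them.\<close>

lemma bin_sum_unique: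
  assumes "\<And>x. poly (bin_sum s k a) x = poly (bin_sum s k b) x" and "h \<le> k"
  shows "a h = b h"
  using assms
proof (induction k)
  case 0
  then show ?case using bin_sum_at_0[of s 0 a] bin_sum_at_0[of s 0 b] by simp
next
  case (Suc k)
  show ?case
  proof (cases "h = Suc k")
    case True
    then show ?thesis
      using Suc.prems(1)[of s] by (simp add: bin_sum_at_0)
  next
    case False
    have "poly (bin_sum s k a) x = poly (bin_sum s k b) x" for x
      using Suc.prems(1)[of x] Suc.prems(1)[of "x + 1"] bin_sum_step[of s k a x] bin_sum_step[of s k b x]
      by simp
    then show ?thesis using Suc.IH Suc.prems(2) False by simp
  qed
qed

section \<open>Diagrams, tableaux and characters of lists of parts\<close>

lemma diagram_Nil: "diagram [] = {}"
  by (simp add: diagram_def)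

lemma diagram_Cons: "diagram (x # xs) = stack x (diagram xs)"
proof (rule set_eqI)
  fix c :: "nat \<times> nat" obtain i j where c: "c = (i, j)" by (cases c)
  show "c \<in> diagram (x # xs) \<longleftrightarrow> c \<in> stack x (diagram xs)"
    unfolding c by (cases i) (simp_all add: diagram_def stack_iff)
qed

lemma finite_diagram: "finite (diagram \<mu>)"
  by (induction \<mu>) (simp_all add: diagram_Nil diagram_Cons finite_stack)

lemma card_diagram: "card (diagram \<mu>) = sum_list \<mu>"
  by (induction \<mu>) (simp_all add: diagram_Nil diagram_Cons card_stack finite_diagram)

lemma downset_diagram:
  assumes "sorted_wrt (\<ge>) \<mu>" shows "downset (diagram \<mu>)"
  unfolding downset_def
proof (intro allI impI)
  fix i j i' j' assume A: "(i, j) \<in> diagram \<mu>" "i' \<le> i" "j' \<le> j"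
  then have "\<mu> ! i \<le> \<mu> ! i'"
    using sorted_wrt_nth_less[OF assms, of i' i] by (cases "i' = i") (auto simp: diagram_def)
  then show "(i', j') \<in> diagram \<mu>" using A by (auto simp: diagram_def)
qed

lemma num_skew_SYT_eq: "num_skew_SYT \<mu> \<nu> = skew_count (diagram \<mu>) (diagram \<nu>)"
  by (simp add: num_skew_SYT_def skew_count_def skew_SYT_def std_fillings_def Let_def)

lemma diagram_replicate: "diagram (replicate m (Suc 0)) = column m"
  by (auto simp: diagram_def column_iff)

lemma b_plus_eq: "b_plus lam h = skew_count (diagram lam) (plus_shape h)"
proof -
  have "diagram (if h = 0 then [] else [h]) = plus_shape h" if h: "h \<le> 3"
  proof -
    consider "h = 0" | "0 < h" "h \<le> 2" | "h = 3" using h by linarith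
    then show ?thesis
    proof cases
      case 3
      then show ?thesis
        by (auto simp: diagram_Cons diagram_Nil plus_shape_def stack_def column_def)
    qed (auto simp: diagram_Cons diagram_Nil plus_shape_def stack_def)
  qed
  moreover have "diagram (3 # replicate (h - 3) 1) = plus_shape h" if "\<not> h \<le> 3"
  proof (rule set_eqI)
    fix c :: "nat \<times> nat" obtain i j where c: "c = (i, j)" by (cases c)
    show "c \<in> diagram (3 # replicate (h - 3) 1) \<longleftrightarrow> c \<in> plus_shape h"
      using that unfolding c
      by (cases i) (auto simp: diagram_Cons diagram_replicate plus_shape_def stack_iff column_iff)
  qed
  ultimately show ?thesis by (auto simp: b_plus_def num_skew_SYT_eq)
qed

lemma b_minus_eq: "b_minus lam h = (if h \<le> 3 then 0 else skew_count (diagram lam) (minus_shape h))"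
proof -
  have "diagram (2 # 2 # replicate (h - 4) 1) = minus_shape h" if "\<not> h \<le> 3"
  proof (rule set_eqI)
    fix c :: "nat \<times> nat" obtain i j where c: "c = (i, j)" by (cases c)
    show "c \<in> diagram (2 # 2 # replicate (h - 4) 1) \<longleftrightarrow> c \<in> minus_shape h"
      using that unfolding c
      by (auto simp: diagram_Cons diagram_replicate minus_shape_def stack_iff column_iff split: nat.splits)
  qed
  then show ?thesis by (auto simp: b_minus_def num_skew_SYT_eq)
qed

lemma tableaux_eq: "tableaux \<mu> = fillings (diagram \<mu>)"
  by (simp add: tableaux_def fillings_def card_diagram)

lemma column_group_eq: "column_group \<mu> t = column_stabiliser (diagram \<mu>) t"
  unfolding column_group_def column_stabiliser_def column_entries_def card_diagram by (auto; blast)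

lemma polytabloid_eq: "polytabloid \<mu> t = polytab (diagram \<mu>) t"
  by (simp add: polytabloid_def polytab_def column_group_eq tabloid_of_def rows_of_def)

lemma sym_char_eq_specht_char:
  assumes "downset (diagram \<mu>)" and "\<sigma> permutes {1..sum_list \<mu>}"
  shows "sym_char \<mu> \<sigma> = specht_char (diagram \<mu>) \<sigma>"
proof -
  have "polytabloid \<mu> ` tableaux \<mu> = polytab (diagram \<mu>) ` fillings (diagram \<mu>)"
    by (simp add: polytabloid_eq tableaux_eq)
  then show ?thesis
    unfolding sym_char_def specht_module_def
    using subspace_trace_polytab[OF assms(1) finite_diagram] assms(2) by (simp add: card_diagram)
qed

text \<open>The transposition may vary with n; conjugation invariance replaces it by the fixed one
  in \<open>char_fun\<close>.\<close>

lemma sym_char_eq_char_fun: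
  assumes "sorted_wrt (\<ge>) lam" and k: "sum_list lam = k" and n: "2 * k \<le> n" "2 \<le> n"
    and \<tau>: "is_transposition n \<tau>"
  shows "sym_char ((n - k) # lam) \<tau> = char_fun (diagram lam) n"
proof -
  let ?D = "diagram lam"
  let ?S = "stack (n - k) ?D"
  have D: "downset ?D" "finite ?D" using assms(1) by (simp_all add: downset_diagram finite_diagram)
  have ck: "card ?D = k" by (simp add: card_diagram k)
  have S: "downset ?S" "card ?S = n" using stack_facts(1,2)[OF D, of n] n by (simp_all add: ck)
  obtain a b where ab: "a \<in> {1..n}" "b \<in> {1..n}" "a \<noteq> b" "\<tau> = transpose a b"
    using \<tau> by (auto simp: is_transposition_def)
  have "sym_char ((n - k) # lam) \<tau> = specht_char ?S \<tau>"
  proof -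
    have "\<tau> permutes {1..sum_list ((n - k) # lam)}"
      using ab n k by (auto intro: permutes_swap_id)
    then show ?thesis using sym_char_eq_specht_char[of "(n - k) # lam" \<tau>] S by (simp add: diagram_Cons)
  qed
  also have "\<dots> = specht_char ?S (transpose 1 2)"
    unfolding ab(4) by (rule specht_char_transpose_eq[OF S(1) finite_stack[OF D(2)]]) (use ab n S(2) in auto)
  finally show ?thesis by (simp add: char_fun_def ck)
qed

theorem theorem2p5:
  fixes lam :: "nat list" and k :: nat
    and \<tau> :: "nat \<Rightarrow> nat \<Rightarrow> nat"
    and P :: "complex poly" and b :: "nat \<Rightarrow> complex"
  assumes "lam \<turnstile>p k"
    and "\<And>n. n \<ge> max (k + largest_part lam) 2 \<Longrightarrow> is_transposition n (\<tau> n)"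
    and "degree P = k"
    and "\<And>n. n \<ge> max (k + largest_part lam) 2 \<Longrightarrow>
           poly P (of_nat n) = sym_char ((n - k) # lam) (\<tau> n)"
    and "\<And>x. poly P x = (\<Sum>h=0..k. (-1) ^ h * b h * ((x - 2) gchoose (k - h)))"
    and "\<And>h. h > k \<Longrightarrow> b h = 0"
  shows "\<forall>h \<le> length lam + 2. b h = of_nat (b_plus lam h) - of_nat (b_minus lam h)"
proof -
  let ?D = "diagram lam"
  have lam: "sorted_wrt (\<ge>) lam" "sum_list lam = k" using assms(1) by (simp_all add: is_partition_def)
  have D: "downset ?D" "finite ?D" using lam by (simp_all add: downset_diagram finite_diagram)
  have ck: "card ?D = k" by (simp add: card_diagram lam)
  obtain N where N: "\<And>n. N \<le> n \<Longrightarrow> char_fun ?D n = poly (bin_sum 2 k (signed_coeff ?D)) (of_nat n)"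
    using stable_formulas[OF D] unfolding eventually_sequentially ck by blast
  have "P = bin_sum 2 k (signed_coeff ?D)"
  proof (rule poly_eqI_nat)
    fix n assume n: "N + 2 * k + largest_part lam + 2 \<le> n"
    then have ge: "n \<ge> max (k + largest_part lam) 2" by simp
    have "poly P (of_nat n) = sym_char ((n - k) # lam) (\<tau> n)" by (rule assms(4)[OF ge])
    also have "\<dots> = char_fun ?D n"
      by (rule sym_char_eq_char_fun[OF lam _ _ assms(2)[OF ge]]) (use n in auto)
    also have "\<dots> = poly (bin_sum 2 k (signed_coeff ?D)) (of_nat n)" by (rule N) (use n in simp)
    finally show "poly P (of_nat n) = poly (bin_sum 2 k (signed_coeff ?D)) (of_nat n)" .
  qed
  moreover have "poly P x = poly (bin_sum 2 k b) x" for x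
    by (simp add: assms(5) poly_bin_sum atLeast0AtMost)
  ultimately have "b h = signed_coeff ?D h" if "h \<le> k" for h
    using bin_sum_unique[of 2 k b "signed_coeff ?D" h] that by simp
  \<comment> \<open>Beyond \<open>k\<close> the convention on \<open>b\<close> agrees with the skew
    numbers, as no shape with more than \<open>k\<close> cells fits into the diagram.\<close>
  moreover have "b h = signed_coeff ?D h" if "h > k" for h
    using assms(6)[OF that] signed_coeff_gt[OF D(2)] that ck by simp
  ultimately have "b h = signed_coeff ?D h" for h by (cases "h \<le> k") auto
  then show ?thesis by (simp add: signed_coeff_def b_plus_eq b_minus_eq)
qed

end
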